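(* Let $\Omega\subset\mathbb{R}^n$ be a bounded smooth domain, $\sigma>1$, and suppose $f$ satisfies (F1)–(F8) on $K=K_n^+$. If $\epsilon>0$ is sufficiently small, then every admissible solution $u\in C^\infty(\bar\Omega)$ of $f(\kappa[u])=\sigma$ in $\Omega$, $u=\epsilon$ on $\partial\Omega$, satisfies $u|D^2u|\le C$ on $\partial\Omega$, where $C$ is independent of $\epsilon$.
   Context: For $u>0$ with $|Du|<1$, set $w=\sqrt{1-|Du|^2}$, $\gamma^{ij}=\delta_{ij}+\frac{u_iu_j}{w(1+w)}$; $\kappa[u]$ denotes the eigenvalues of $A[u]=(a_{ij})$, $a_{ij}=\frac1w(\delta_{ij}-u\gamma^{ik}u_{kl}\gamma^{lj})$ (the de Sitter principal curvatures of the graph of $u$ in the half-space model $x_{n+1}^{-2}(dx^2-dx_{n+1}^2)$ of the steady state space). $u$ is admissible if $u>0$, $|Du|<1$ and $|x|^2-u^2$ is locally strictly convex. $K_n^+=\{\lambda_i>0\}$; conditions: (F1) $f$ symmetric; (F2) $\partial f/\partial\lambda_i>0$; (F3) concave; (F4) $(f(1/\lambda_1,\dots,1/\lambda_n))^{-1}$ concave; (F5) $f>0$ in $K$, $f=0$ on $\partial K$; (F6) $f(1,\dots,1)=1$; (F7) homogeneous of degree one; (F8) $\lim_{R\to\infty}f(\lambda_1,\dots,\lambda_n+R)\ge1+\varepsilon_0$ uniformly on $B_{\delta_0}(1,\dots,1)$ for some $\varepsilon_0,\delta_0>0$. *)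

theory Defs
  imports "HOL-Analysis.Analysis"
begin

definition pd :: "'n::finite \<Rightarrow> (real^'n \<Rightarrow> real) \<Rightarrow> real^'n \<Rightarrow> real" where
  "pd i g x = deriv (\<lambda>t. g (x + t *\<^sub>R axis i 1)) 0"

fun ipd :: "'n::finite list \<Rightarrow> (real^'n \<Rightarrow> real) \<Rightarrow> real^'n \<Rightarrow> real" where
  "ipd [] g = g"
| "ipd (i # is) g = pd i (ipd is g)"

definition smooth_on :: "(real^'n::finite) set \<Rightarrow> (real^'n \<Rightarrow> real) \<Rightarrow> bool" where
  "smooth_on U g \<longleftrightarrow> open U \<and>
     (\<forall>is. continuous_on U (ipd is g) \<and>
       (\<forall>i. \<forall>x\<in>U. (\<lambda>t. ipd is g (x + t *\<^sub>R axis i 1)) differentiable (at 0)))"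

definition smooth_on_closure :: "(real^'n::finite) set \<Rightarrow> (real^'n \<Rightarrow> real) \<Rightarrow> bool" where
  "smooth_on_closure \<Omega> g \<longleftrightarrow> (\<exists>U. closure \<Omega> \<subseteq> U \<and> smooth_on U g)"

definition grad :: "(real^'n::finite \<Rightarrow> real) \<Rightarrow> real^'n \<Rightarrow> real^'n" where
  "grad g x = (\<chi> i. pd i g x)"

definition hess :: "(real^'n::finite \<Rightarrow> real) \<Rightarrow> real^'n \<Rightarrow> real^'n^'n" where
  "hess g x = (\<chi> i j. pd i (pd j g) x)"

definition smooth_bounded_domain :: "(real^'n::finite) set \<Rightarrow> bool" where
  "smooth_bounded_domain \<Omega> \<longleftrightarrow> open \<Omega> \<and> connected \<Omega> \<and> bounded \<Omega> \<and> \<Omega> \<noteq> {} \<and>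
     (\<forall>p\<in>frontier \<Omega>. \<exists>U \<rho>. open U \<and> p \<in> U \<and> smooth_on U \<rho> \<and>
        (\<forall>x\<in>U. grad \<rho> x \<noteq> 0) \<and> \<Omega> \<inter> U = {x\<in>U. \<rho> x < 0})"

section \<open>De Sitter principal curvatures of a graph\<close>

definition wfun :: "(real^'n::finite \<Rightarrow> real) \<Rightarrow> real^'n \<Rightarrow> real" where
  "wfun u x = sqrt (1 - (norm (grad u x))\<^sup>2)"

definition gam :: "(real^'n::finite \<Rightarrow> real) \<Rightarrow> real^'n \<Rightarrow> real^'n^'n" where
  "gam u x = (\<chi> i j. (if i = j then 1 else 0)
       + grad u x $ i * grad u x $ j / (wfun u x * (1 + wfun u x)))"

definition Amat :: "(real^'n::finite \<Rightarrow> real) \<Rightarrow> real^'n \<Rightarrow> real^'n^'n" where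
  "Amat u x = (1 / wfun u x) *\<^sub>R (mat 1 - u x *\<^sub>R (gam u x ** hess u x ** gam u x))"

definition eigenvalue_tuple :: "real^'n^'n \<Rightarrow> real^'n::finite \<Rightarrow> bool" where
  "eigenvalue_tuple M lam \<longleftrightarrow> (\<forall>t::real. det (t *\<^sub>R mat 1 - M) = (\<Prod>i\<in>UNIV. t - lam $ i))"

definition strictly_convex_on :: "(real^'n::finite) set \<Rightarrow> (real^'n \<Rightarrow> real) \<Rightarrow> bool" where
  "strictly_convex_on S g \<longleftrightarrow> convex S \<and>
     (\<forall>x\<in>S. \<forall>y\<in>S. \<forall>t. x \<noteq> y \<and> 0 < t \<and> t < 1 \<longrightarrow>
        g ((1 - t) *\<^sub>R x + t *\<^sub>R y) < (1 - t) * g x + t * g y)"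

definition locally_strictly_convex :: "(real^'n::finite) set \<Rightarrow> (real^'n \<Rightarrow> real) \<Rightarrow> bool" where
  "locally_strictly_convex S g \<longleftrightarrow>
     (\<forall>x\<in>S. \<exists>r>0. ball x r \<subseteq> S \<and> strictly_convex_on (ball x r) g)"

definition admissible :: "(real^'n::finite) set \<Rightarrow> (real^'n \<Rightarrow> real) \<Rightarrow> bool" where
  "admissible \<Omega> u \<longleftrightarrow> (\<forall>x\<in>closure \<Omega>. u x > 0 \<and> norm (grad u x) < 1) \<and>
     locally_strictly_convex \<Omega> (\<lambda>x. (norm x)\<^sup>2 - (u x)\<^sup>2)"

definition Kpos :: "(real^'n::finite) set" where
  "Kpos = {lam. \<forall>i. lam $ i > 0}"

definition F_conditions :: "(real^'n::finite \<Rightarrow> real) \<Rightarrow> bool" where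
  "F_conditions f \<longleftrightarrow>
     \<comment> \<open>(F1) symmetric\<close>
     (\<forall>lam\<in>Kpos. \<forall>p. p permutes (UNIV::'n set) \<longrightarrow> f (\<chi> i. lam $ p i) = f lam) \<and>
     \<comment> \<open>(F2) positive partial derivatives\<close>
     (\<forall>lam\<in>Kpos. f differentiable (at lam) \<and>
        (\<forall>i. frechet_derivative f (at lam) (axis i 1) > 0)) \<and>
     \<comment> \<open>(F3) concave\<close>
     concave_on Kpos f \<and>
     \<comment> \<open>(F4)\<close>
     concave_on Kpos (\<lambda>lam. 1 / f (\<chi> i. 1 / lam $ i)) \<and>
     \<comment> \<open>(F5)\<close>
     (\<forall>lam\<in>Kpos. f lam > 0) \<and> (\<forall>lam\<in>frontier Kpos. f lam = 0) \<and>
     \<comment> \<open>(F6)\<close>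
     f (\<chi> i. 1) = 1 \<and>
     \<comment> \<open>(F7) homogeneous of degree one\<close>
     (\<forall>lam\<in>Kpos. \<forall>t>0. f (t *\<^sub>R lam) = t * f lam) \<and>
     \<comment> \<open>(F8)\<close>
     (\<exists>e0>0. \<exists>d0>0. \<forall>i. \<forall>\<eta>>0. \<exists>R0. \<forall>R\<ge>R0. \<forall>lam\<in>ball (\<chi> j. 1) d0.
         f (lam + R *\<^sub>R axis i 1) \<ge> 1 + e0 - \<eta>)"

definition admissible_solution ::
  "(real^'n::finite) set \<Rightarrow> (real^'n \<Rightarrow> real) \<Rightarrow> real \<Rightarrow> real \<Rightarrow> (real^'n \<Rightarrow> real) \<Rightarrow> bool" where
  "admissible_solution \<Omega> f \<sigma> \<epsilon> u \<longleftrightarrow>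
     smooth_on_closure \<Omega> u \<and> admissible \<Omega> u \<and>
     (\<forall>x\<in>\<Omega>. \<exists>lam. eigenvalue_tuple (Amat u x) lam \<and> lam \<in> Kpos \<and> f lam = \<sigma>) \<and>
     (\<forall>x\<in>frontier \<Omega>. u x = \<epsilon>)"

end

theory Submission
  imports Defs "HOL-Combinatorics.Permutations" "HOL-Computational_Algebra.Polynomial"
begin

text \<open>
  Write \<open>p = Du\<close>, \<open>g = I - p p\<^sup>T\<close> and \<open>M = g - u D\<^sup>2u\<close>, which is half the Hessian of \<open>\<bar>x\<bar>\<^sup>2 - u\<^sup>2\<close>; since
  \<open>\<gamma> g \<gamma> = I\<close>, one has \<open>A[u] = \<gamma> M \<gamma> / w\<close>. Positivity of \<open>A[u]\<close> bounds \<open>u D\<^sup>2u\<close> from above, so only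
  an upper bound for \<open>M\<close> on the boundary is at stake.

  Umbilic hyperboloids over interior and exterior balls are barriers for \<open>u\<close>. They pin \<open>u\<close> between two
  almost equal linear functions near each boundary point, and together with \<open>u D\<^sup>2u \<le> I\<close> this forces
  \<open>Du\<close> to be close to \<open>\<surd>(1 - 1/\<sigma>\<^sup>2)\<close> times the inner normal, that is, \<open>w\<close> to be close to \<open>1/\<sigma>\<close>.
  Tangential second derivatives are bounded because \<open>u\<close> is constant on the boundary.

  For the mixed derivatives let \<open>X\<close> be an infinitesimal rigid motion tangent to the boundary to second
  order at \<open>x\<^sub>0\<close>. The Killing derivative \<open>\<eta> = X\<cdot>Du\<close> satisfies the linearized equation and is compared
  with the light-cone function \<open>Z = (\<bar>x - y\<bar>\<^sup>2 - (u + \<rho>)\<^sup>2)/(2u)\<close>, whose vertex lies below the center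
  \<open>y\<close> of an exterior ball touching at \<open>x\<^sub>0\<close>. Since \<open>\<bar>\<eta>\<bar> \<le> C\<bar>x - x\<^sub>0\<bar>\<^sup>2 \<le> C' Z\<close> on the boundary and \<open>Z\<close> is small
  only near \<open>x\<^sub>0\<close>, a large interior maximum of \<open>\<eta>/Z\<close> would sit where \<open>Du\<close> is almost normal; there the
  linearized equation excludes it. Hence \<open>\<bar>\<eta>\<bar> \<le> K Z\<close>, and the slope of \<open>Z\<close> at \<open>x\<^sub>0\<close> is of order \<open>1/\<epsilon>\<close>.

  Finally, if the double normal entry of \<open>M\<close> were huge, \<open>A[u]\<close> would dominate \<open>(1 - \<theta>)/w\<close> times
  \<open>I + R N N\<^sup>T\<close> with \<open>R\<close> large, and (F8) would give \<open>\<sigma> \<ge> (1 - \<theta>)(1 + \<epsilon>\<^sub>0/2)/w\<close>, contradicting \<open>1/w \<approx> \<sigma>\<close>.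
\<close>

section \<open>Partial derivatives of smooth functions\<close>

text \<open>The function \<open>f\<close> lives on eigenvalue tuples and is merely differentiable
  there, so no derivative with respect to matrix entries is at hand. Concavity, homogeneity and
  symmetry replace it: at each point they yield positive weights c_i such that the weighted trace of
  \<open>A[u]\<close> in a fixed orthonormal frame is at least \<sigma> throughout the domain and
  equals \<sigma> at that point. No lower bound for a single c_i is available; the maximum principle
  has to work with sum c_i \<kappa>_i = \<sigma> and sum c_i \<ge> 1. This is why w close to
  1/\<sigma> matters there: the term \<rho> (sum c_i - w \<sigma>) is harmless only if w \<sigma>
  hardly exceeds 1. The form of Z has a similar origin. Half the Hessian of |x - y|^2 - (u +
  \<rho>)^2 is M - \<rho> D^2u, so in a frame that diagonalizes M against g the comparison function
  is expressed through the curvatures alone. Since the bound must survive \<epsilon> tending to 0,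
  every constant is fixed from \<Omega>, \<sigma> and \<open>f\<close> before \<epsilon> and u
  enter.\<close>

lemma smooth_on_open: "smooth_on U g \<Longrightarrow> open U"
  by (simp add: smooth_on_def)

lemma smooth_on_continuous: "smooth_on U g \<Longrightarrow> continuous_on U g"
  unfolding smooth_on_def by (metis ipd.simps(1))

lemma ipd_pd: "ipd is (pd i g) = ipd (is @ [i]) g"
  by (induction "is") auto

lemma smooth_on_pd: "smooth_on U g \<Longrightarrow> smooth_on U (pd i g)"
  unfolding smooth_on_def ipd_pd by blast

lemma smooth_on_pd_DERIV:
  assumes "smooth_on U g" "x + s *\<^sub>R axis i 1 \<in> U"
  shows "((\<lambda>t. g (x + t *\<^sub>R axis i 1)) has_real_derivative pd i g (x + s *\<^sub>R axis i 1)) (at s)"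
proof -
  let ?y = "x + s *\<^sub>R axis i 1"
  have "(\<lambda>t. ipd [] g (?y + t *\<^sub>R axis i 1)) differentiable (at 0)"
    using assms unfolding smooth_on_def by blast
  then have "((\<lambda>t. g (?y + t *\<^sub>R axis i 1)) has_real_derivative pd i g ?y) (at 0)"
    unfolding pd_def by (simp add: DERIV_deriv_iff_real_differentiable)
  then have "((\<lambda>t. g (?y + (t + (-s)) *\<^sub>R axis i 1)) has_real_derivative pd i g ?y) (at s)"
    using DERIV_shift[of "\<lambda>t. g (?y + t *\<^sub>R axis i 1)" "pd i g ?y" s "-s"] by simp
  then show ?thesis by (simp add: algebra_simps)
qed

lemma smooth_on_pd_continuous: "smooth_on U g \<Longrightarrow> continuous_on U (pd i g)"
  using smooth_on_continuous smooth_on_pd by blast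

lemma axis_line_mvt:
  fixes x :: "real^'n"
  assumes g: "smooth_on U g" and ball: "ball c r \<subseteq> U"
    and xy: "x \<in> ball c r" "x + h *\<^sub>R axis i 1 \<in> ball c r"
  shows "\<exists>\<theta>. \<bar>\<theta>\<bar> \<le> \<bar>h\<bar> \<and> x + \<theta> *\<^sub>R axis i 1 \<in> ball c r \<and>
    g (x + h *\<^sub>R axis i 1) - g x = h * pd i g (x + \<theta> *\<^sub>R axis i 1)"
proof -
  have inb: "x + t *\<^sub>R axis i 1 \<in> ball c r" if t: "t \<in> closed_segment 0 h" for t
  proof -
    obtain l where l: "0 \<le> l" "l \<le> 1" "t = l * h"
      using t unfolding closed_segment_def by auto
    have "x + t *\<^sub>R axis i 1 = (1 - l) *\<^sub>R x + l *\<^sub>R (x + h *\<^sub>R axis i 1)"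
      by (simp add: l algebra_simps)
    also have "\<dots> \<in> ball c r"
      using convexD_alt[OF convex_ball xy(1) xy(2)] l by auto
    finally show ?thesis .
  qed
  have der: "((\<lambda>t. g (x + t *\<^sub>R axis i 1)) has_real_derivative pd i g (x + t *\<^sub>R axis i 1)) (at t)"
    if "t \<in> closed_segment 0 h" for t
    using smooth_on_pd_DERIV[OF g] inb[OF that] ball by blast
  consider "h = 0" | "h > 0" | "h < 0" by linarith
  then show ?thesis
  proof cases
    case 1
    then show ?thesis using xy by (intro exI[of _ 0]) auto
  next
    case 2
    have "\<exists>z>0. z < h \<and> g (x + h *\<^sub>R axis i 1) - g (x + 0 *\<^sub>R axis i 1)
        = (h - 0) * pd i g (x + z *\<^sub>R axis i 1)"
      by (rule MVT2[OF 2]) (use der 2 in \<open>auto simp: closed_segment_eq_real_ivl\<close>)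
    then obtain z where "0 < z" "z < h" "g (x + h *\<^sub>R axis i 1) - g x = h * pd i g (x + z *\<^sub>R axis i 1)"
      by auto
    then show ?thesis using inb[of z] 2
      by (intro exI[of _ z]) (auto simp: closed_segment_eq_real_ivl)
  next
    case 3
    have "\<exists>z>h. z < 0 \<and> g (x + 0 *\<^sub>R axis i 1) - g (x + h *\<^sub>R axis i 1)
        = (0 - h) * pd i g (x + z *\<^sub>R axis i 1)"
      by (rule MVT2[OF 3]) (use der 3 in \<open>auto simp: closed_segment_eq_real_ivl\<close>)
    then obtain z where "h < z" "z < 0" "g (x + h *\<^sub>R axis i 1) - g x = h * pd i g (x + z *\<^sub>R axis i 1)"
      by auto
    then show ?thesis using inb[of z] 3
      by (intro exI[of _ z]) (auto simp: closed_segment_eq_real_ivl)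
  qed
qed

text \<open>\<open>smooth_on\<close> only speaks of derivatives along coordinate axes. Changing one
  coordinate at a time and applying the mean value theorem to each change turns continuity of the
  partials into a Frechet derivative.\<close>

lemma smooth_on_has_derivative:
  fixes g :: "real^'n::finite \<Rightarrow> real"
  assumes g: "smooth_on U g" and x: "x \<in> U"
  shows "(g has_derivative (\<lambda>h. h \<bullet> grad g x)) (at x)"
proof -
  have lin: "bounded_linear (\<lambda>h. h \<bullet> grad g x)"
    by (rule bounded_linear_inner_left)
  have est: "\<exists>d>0. \<forall>y. norm (y - x) < d \<longrightarrow> \<bar>g y - g x - (y - x) \<bullet> grad g x\<bar> \<le> e * norm (y - x)"
    if e: "e > 0" for e
  proof -
    let ?n = "real CARD('n)"
    define e' where "e' = e / ?n"
    have e': "e' > 0" using e by (simp add: e'_def)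
    have "\<forall>i. \<exists>d>0. ball x d \<subseteq> U \<and> (\<forall>y\<in>ball x d. \<bar>pd i g y - pd i g x\<bar> < e')"
    proof
      fix i
      have "isCont (pd i g) x"
        using smooth_on_pd_continuous[OF g, of i] smooth_on_open[OF g] x
        by (simp add: continuous_on_eq_continuous_at)
      then obtain d1 where d1: "d1 > 0" "\<And>y. dist y x < d1 \<Longrightarrow> dist (pd i g y) (pd i g x) < e'"
        using e' unfolding continuous_at by (metis tendstoD continuous_at_eps_delta \<open>isCont (pd i g) x\<close>)
      obtain d2 where d2: "d2 > 0" "ball x d2 \<subseteq> U"
        using smooth_on_open[OF g] x open_contains_ball by blast
      show "\<exists>d>0. ball x d \<subseteq> U \<and> (\<forall>y\<in>ball x d. \<bar>pd i g y - pd i g x\<bar> < e')"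
        using d1 d2 by (intro exI[of _ "min d1 d2"]) (auto simp: dist_commute dist_real_def)
    qed
    then obtain dd where dd: "\<And>i. dd i > 0" "\<And>i. ball x (dd i) \<subseteq> U"
      "\<And>i y. y \<in> ball x (dd i) \<Longrightarrow> \<bar>pd i g y - pd i g x\<bar> < e'" by metis
    define d where "d = Min (range dd)"
    have d: "d > 0" unfolding d_def using dd(1) by (subst Min_gr_iff) auto
    have dle: "d \<le> dd i" for i unfolding d_def by simp
    have bU: "ball x d \<subseteq> U" using dd(2) dle by (meson order_trans subset_ball)
    have close: "\<bar>pd i g y - pd i g x\<bar> < e'" if "y \<in> ball x d" for i y
      using dd(3)[of y i] that dle[of i] by auto
    \<comment> \<open>Induction over the set \<open>S\<close> of coordinates in which the increment
      may be nonzero; with \<open>e'\<close> = e / n the errors of all coordinates add up to at most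
      e times the norm.\<close>
    have ind: "\<bar>g (x + h) - g x - (\<Sum>i\<in>S. h $ i * pd i g x)\<bar> \<le> e' * (\<Sum>i\<in>S. \<bar>h $ i\<bar>)"
      if "finite S" "\<And>i. i \<notin> S \<Longrightarrow> h $ i = 0" "norm h < d" for S h
      using that
    proof (induction S arbitrary: h rule: finite_induct)
      case empty
      then have "h = 0" by (simp add: vec_eq_iff)
      then show ?case by simp
    next
      case (insert j S)
      define h' where "h' = h - (h $ j) *\<^sub>R axis j 1"
      have h'i: "h' $ i = (if i = j then 0 else h $ i)" for i
        by (simp add: h'_def axis_def)
      have "norm h' \<le> norm h"
        by (rule norm_le_componentwise_cart) (simp add: h'i)
      then have nh': "norm h' < d" using insert.prems by simp
      have IH: "\<bar>g (x + h') - g x - (\<Sum>i\<in>S. h' $ i * pd i g x)\<bar> \<le> e' * (\<Sum>i\<in>S. \<bar>h' $ i\<bar>)"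
        by (rule insert.IH) (use insert.prems nh' h'i in auto)
      have sums: "(\<Sum>i\<in>S. h' $ i * pd i g x) = (\<Sum>i\<in>S. h $ i * pd i g x)"
        "(\<Sum>i\<in>S. \<bar>h' $ i\<bar>) = (\<Sum>i\<in>S. \<bar>h $ i\<bar>)"
        using insert.hyps by (auto intro!: sum.cong simp: h'i)
      have hh: "(x + h') + (h $ j) *\<^sub>R axis j 1 = x + h" by (simp add: h'_def)
      obtain t where t: "x + h' + t *\<^sub>R axis j 1 \<in> ball x d"
        "g (x + h) - g (x + h') = h $ j * pd j g (x + h' + t *\<^sub>R axis j 1)"
        using axis_line_mvt[OF g bU, of "x + h'" "h $ j" j] hh nh' insert.prems
        by (auto simp: dist_norm)
      have "\<bar>h $ j * pd j g (x + h' + t *\<^sub>R axis j 1) - h $ j * pd j g x\<bar> \<le> e' * \<bar>h $ j\<bar>"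
        using close[OF t(1), of j]
        by (simp add: right_diff_distrib[symmetric] abs_mult mult.commute[of e'] mult_left_mono)
      then show ?case
        using IH sums t insert.hyps by (simp add: algebra_simps)
    qed
    show ?thesis
    proof (intro exI conjI allI impI)
      show "d > 0" by fact
      fix y assume y: "norm (y - x) < d"
      have "\<bar>g y - g x - (\<Sum>i\<in>UNIV. (y - x) $ i * pd i g x)\<bar> \<le> e' * (\<Sum>i\<in>UNIV. \<bar>(y - x) $ i\<bar>)"
        using ind[of UNIV "y - x"] y by simp
      also have "\<dots> \<le> e' * (\<Sum>i\<in>(UNIV::'n set). norm (y - x))"
        using e' by (intro mult_left_mono sum_mono component_le_norm_cart) auto
      also have "\<dots> = e * norm (y - x)" by (simp add: e'_def)
      finally show "\<bar>g y - g x - (y - x) \<bullet> grad g x\<bar> \<le> e * norm (y - x)"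
        by (simp add: inner_vec_def grad_def)
    qed
  qed
  show ?thesis
    unfolding has_derivative_at_alt using lin est by (auto simp: )
qed

text \<open>The second difference of g over a square of side s is symmetric in i and j, and equals
  s^2 times either mixed derivative at some nearby point; continuity of both mixed derivatives then
  identifies them at x.\<close>

lemma pd_commute:
  fixes g :: "real^'n::finite \<Rightarrow> real"
  assumes g: "smooth_on U g" and x: "x \<in> U"
  shows "pd i (pd j g) x = pd j (pd i g) x"
proof -
  have one: "\<exists>\<xi>. norm (\<xi> - x) \<le> 2 * s \<and>
      g (x + s *\<^sub>R axis i 1 + s *\<^sub>R axis j 1) - g (x + s *\<^sub>R axis i 1) - g (x + s *\<^sub>R axis j 1) + g x
       = s * s * pd j (pd i g) \<xi>"
    if b: "ball x r \<subseteq> U" and s: "0 < s" "4 * s < r" for r s and i j :: 'n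
  proof -
    have nrm: "norm (a *\<^sub>R (axis i 1 :: real^'n) + b *\<^sub>R axis j 1) \<le> \<bar>a\<bar> + \<bar>b\<bar>" for a b :: real and i j
      by (rule order_trans[OF norm_triangle_ineq]) simp
    have inb: "x + a *\<^sub>R axis i 1 + b *\<^sub>R axis j 1 \<in> U" if "\<bar>a\<bar> \<le> s" "\<bar>b\<bar> \<le> s" for a b
    proof -
      have "x + a *\<^sub>R axis i 1 + b *\<^sub>R axis j 1 \<in> ball x r"
        using nrm[of a i b j] that s by (simp add: dist_commute[of x]) (simp add: dist_norm add.assoc)
      then show ?thesis using b by blast
    qed
    define h where "h = (\<lambda>t. g (x + t *\<^sub>R axis i 1 + s *\<^sub>R axis j 1) - g (x + t *\<^sub>R axis i 1))"
    have dh: "(h has_real_derivative (pd i g (x + t *\<^sub>R axis i 1 + s *\<^sub>R axis j 1) - pd i g (x + t *\<^sub>R axis i 1))) (at t)"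
      if "0 \<le> t" "t \<le> s" for t
    proof -
      have 1: "((\<lambda>t. g ((x + s *\<^sub>R axis j 1) + t *\<^sub>R axis i 1)) has_real_derivative
          pd i g ((x + s *\<^sub>R axis j 1) + t *\<^sub>R axis i 1)) (at t)"
        using smooth_on_pd_DERIV[OF g, of "x + s *\<^sub>R axis j 1" t i] inb[of t s] that s
        by (simp add: algebra_simps)
      have 2: "((\<lambda>t. g (x + t *\<^sub>R axis i 1)) has_real_derivative pd i g (x + t *\<^sub>R axis i 1)) (at t)"
        using smooth_on_pd_DERIV[OF g, of x t i] inb[of t 0] that s by simp
      show ?thesis using DERIV_diff[OF 1 2] unfolding h_def by (simp add: algebra_simps)
    qed
    obtain t1 where t1: "0 < t1" "t1 < s" "h s - h 0 = (s - 0) *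
        (pd i g (x + t1 *\<^sub>R axis i 1 + s *\<^sub>R axis j 1) - pd i g (x + t1 *\<^sub>R axis i 1))"
      using MVT2[OF s(1) dh] by blast
    have d2: "((\<lambda>t. pd i g (x + t1 *\<^sub>R axis i 1 + t *\<^sub>R axis j 1)) has_real_derivative
          pd j (pd i g) (x + t1 *\<^sub>R axis i 1 + t *\<^sub>R axis j 1)) (at t)" if "0 \<le> t" "t \<le> s" for t
      using smooth_on_pd_DERIV[OF smooth_on_pd[OF g], of "x + t1 *\<^sub>R axis i 1" t j] inb[of t1 t] that t1
      by simp
    obtain t2 where t2: "0 < t2" "t2 < s"
      "pd i g (x + t1 *\<^sub>R axis i 1 + s *\<^sub>R axis j 1) - pd i g (x + t1 *\<^sub>R axis i 1 + 0 *\<^sub>R axis j 1)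
        = (s - 0) * pd j (pd i g) (x + t1 *\<^sub>R axis i 1 + t2 *\<^sub>R axis j 1)"
      using MVT2[OF s(1) d2] by blast
    show ?thesis
      using t1 t2 nrm[of t1 i t2 j]
      by (intro exI[of _ "x + t1 *\<^sub>R axis i 1 + t2 *\<^sub>R axis j 1"]) (auto simp: h_def add.assoc)
  qed
  obtain r where r: "r > 0" "ball x r \<subseteq> U"
    using smooth_on_open[OF g] x open_contains_ball by blast
  let ?f = "pd j (pd i g)" and ?f' = "pd i (pd j g)"
  have c: "isCont ?f x" "isCont ?f' x"
    using smooth_on_continuous[OF smooth_on_pd[OF smooth_on_pd[OF g]]] smooth_on_open[OF g] x
    by (simp_all add: continuous_on_eq_continuous_at)
  show ?thesis
  proof (rule ccontr)
    assume ne: "?f' x \<noteq> ?f x"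
    define e where "e = \<bar>?f' x - ?f x\<bar> / 2"
    have e: "e > 0" using ne by (simp add: e_def)
    obtain d1 where d1: "d1 > 0" "\<And>y. dist y x < d1 \<Longrightarrow> dist (?f y) (?f x) < e"
      using c(1)[unfolded continuous_at_eps_delta, rule_format, OF e] by blast
    obtain d2 where d2: "d2 > 0" "\<And>y. dist y x < d2 \<Longrightarrow> dist (?f' y) (?f' x) < e"
      using c(2)[unfolded continuous_at_eps_delta, rule_format, OF e] by blast
    define s where "s = min r (min d1 d2) / 8"
    have s: "0 < s" "4 * s < r" "2 * s < d1" "2 * s < d2"
      using r d1 d2 by (auto simp: s_def)
    obtain y where y: "norm (y - x) \<le> 2 * s" "g (x + s *\<^sub>R axis i 1 + s *\<^sub>R axis j 1) - g (x + s *\<^sub>R axis i 1) - g (x + s *\<^sub>R axis j 1) + g x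
       = s * s * ?f y" using one[OF r(2) s(1,2), of i j] by (elim exE conjE) (rule that)
    obtain y' where y': "norm (y' - x) \<le> 2 * s" "g (x + s *\<^sub>R axis j 1 + s *\<^sub>R axis i 1) - g (x + s *\<^sub>R axis j 1) - g (x + s *\<^sub>R axis i 1) + g x
       = s * s * ?f' y'" using one[OF r(2) s(1,2), of j i] by (elim exE conjE) (rule that)
    have "s * s * ?f y = s * s * ?f' y'"
      using y(2) y'(2) by (simp only: add.assoc add.commute[of "s *\<^sub>R axis i 1"])
    then have "?f y = ?f' y'" using s by simp
    moreover have "dist (?f y) (?f x) < e" "dist (?f' y') (?f' x) < e"
      using d1(2)[of y] d2(2)[of y'] y(1) y'(1) s by (auto simp: dist_norm)
    ultimately show False unfolding e_def dist_real_def by argo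
  qed
qed

lemma hess_symmetric:
  assumes "smooth_on U g" "x \<in> U"
  shows "transpose (hess g x) = hess g x"
  by (simp add: transpose_def hess_def vec_eq_iff pd_commute[OF assms])

lemma grad_has_derivative:
  fixes g :: "real^'n::finite \<Rightarrow> real"
  assumes g: "smooth_on U g" and x: "x \<in> U"
  shows "(grad g has_derivative (\<lambda>h. hess g x *v h)) (at x)"
proof -
  have "((\<lambda>y. grad g y $ i) has_derivative (\<lambda>h. (hess g x *v h) $ i)) (at x)" for i
  proof -
    have "(pd i g has_derivative (\<lambda>h. h \<bullet> grad (pd i g) x)) (at x)"
      by (rule smooth_on_has_derivative[OF smooth_on_pd[OF g] x])
    moreover have "h \<bullet> grad (pd i g) x = (hess g x *v h) $ i" for h
      by (simp add: inner_vec_def grad_def hess_def matrix_vector_mult_def pd_commute[OF g x, of i]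
          mult.commute)
    ultimately show ?thesis by (simp add: grad_def)
  qed
  then show ?thesis
    by (subst has_derivative_componentwise_within)
      (auto simp: Basis_vec_def inner_axis)
qed

definition thd :: "(real^'n::finite \<Rightarrow> real) \<Rightarrow> real^'n \<Rightarrow> real^'n \<Rightarrow> real^'n^'n" where
  "thd g x a = (\<chi> i j. a \<bullet> grad (pd i (pd j g)) x)"

lemma hess_has_derivative:
  fixes g :: "real^'n::finite \<Rightarrow> real"
  assumes g: "smooth_on U g" and x: "x \<in> U"
  shows "(hess g has_derivative thd g x) (at x)"
proof -
  have "((\<lambda>y. hess g y $ i $ j) has_derivative (\<lambda>h. thd g x h $ i $ j)) (at x)" for i j
    using smooth_on_has_derivative[OF smooth_on_pd[OF smooth_on_pd[OF g]] x, of i j]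
    by (simp add: hess_def thd_def)
  then show ?thesis
    by (subst has_derivative_componentwise_within)
      (auto simp: Basis_vec_def inner_axis)
qed

text \<open>Commuting the two outer partial derivatives exchanges the direction of differentiation
  with the left argument. This matches the third derivatives produced by X\<cdot>Du with those in
  the linearized equation.\<close>

lemma thd_symmetric:
  fixes g :: "real^'n::finite \<Rightarrow> real"
  assumes g: "smooth_on U g" and x: "x \<in> U"
  shows "a \<bullet> (thd g x b *v c) = b \<bullet> (thd g x a *v c)"
proof -
  have sw: "pd i (pd j (pd k g)) x = pd j (pd i (pd k g)) x" for i j k
    by (rule pd_commute[OF smooth_on_pd[OF g] x])
  have e: "a \<bullet> (thd g x b *v c) = (\<Sum>i\<in>UNIV. \<Sum>j\<in>UNIV. \<Sum>k\<in>UNIV. a $ i * b $ k * c $ j * pd k (pd i (pd j g)) x)"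
    for a b c
    by (simp add: inner_vec_def matrix_vector_mult_def thd_def grad_def sum_distrib_left sum_distrib_right ac_simps)
  have "a \<bullet> (thd g x b *v c) = (\<Sum>j\<in>UNIV. \<Sum>i\<in>UNIV. \<Sum>k\<in>UNIV. a $ i * b $ k * c $ j * pd k (pd i (pd j g)) x)"
    unfolding e by (rule sum.swap)
  also have "\<dots> = (\<Sum>j\<in>UNIV. \<Sum>k\<in>UNIV. \<Sum>i\<in>UNIV. a $ i * b $ k * c $ j * pd k (pd i (pd j g)) x)"
    by (intro sum.cong refl sum.swap)
  also have "\<dots> = (\<Sum>j\<in>UNIV. \<Sum>k\<in>UNIV. \<Sum>i\<in>UNIV. b $ k * a $ i * c $ j * pd i (pd k (pd j g)) x)"
    by (intro sum.cong refl) (simp add: sw mult.commute)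
  also have "\<dots> = (\<Sum>k\<in>UNIV. \<Sum>j\<in>UNIV. \<Sum>i\<in>UNIV. b $ k * a $ i * c $ j * pd i (pd k (pd j g)) x)"
    by (rule sum.swap)
  also have "\<dots> = b \<bullet> (thd g x a *v c)"
    unfolding e by simp
  finally show ?thesis .
qed

section \<open>Symmetric matrices and orthonormal frames\<close>

definition orthonormal_frame :: "('n::finite \<Rightarrow> real^'n) \<Rightarrow> bool" where
  "orthonormal_frame q \<longleftrightarrow> (\<forall>i j. q i \<bullet> q j = (if i = j then 1 else 0))"

lemma orthonormal_frameD:
  assumes "orthonormal_frame q"
  shows "q i \<bullet> q i = 1" "i \<noteq> j \<Longrightarrow> q i \<bullet> q j = 0" "norm (q i) = 1"
  using assms by (auto simp: orthonormal_frame_def norm_eq_1)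

lemma orthonormal_frame_matrix:
  fixes q :: "'n::finite \<Rightarrow> real^'n"
  assumes "orthonormal_frame q"
  defines "Q \<equiv> (\<chi> i. q i)"
  shows "Q ** transpose Q = mat 1" "transpose Q ** Q = mat 1"
proof -
  show 1: "Q ** transpose Q = mat 1"
    using assms by (auto simp: orthonormal_frame_def vec_eq_iff matrix_matrix_mult_def transpose_def
        mat_def inner_vec_def)
  then show "transpose Q ** Q = mat 1"
    by (simp add: matrix_left_right_inverse)
qed

lemma orthonormal_frame_expand:
  fixes q :: "'n::finite \<Rightarrow> real^'n"
  assumes "orthonormal_frame q"
  shows "v = (\<Sum>i\<in>UNIV. (q i \<bullet> v) *\<^sub>R q i)"
proof -
  let ?Q = "(\<chi> i. q i) :: real^'n^'n"
  have "v = transpose ?Q *v (?Q *v v)"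
    using orthonormal_frame_matrix(2)[OF assms] by (simp add: matrix_vector_mul_assoc)
  also have "\<dots> = (\<Sum>i\<in>UNIV. (q i \<bullet> v) *\<^sub>R q i)"
    by (simp add: vec_eq_iff matrix_vector_mult_def transpose_def inner_vec_def mult.commute)
  finally show ?thesis .
qed

lemma orthonormal_frame_inner:
  fixes q :: "'n::finite \<Rightarrow> real^'n"
  assumes "orthonormal_frame q"
  shows "v \<bullet> w = (\<Sum>i\<in>UNIV. (q i \<bullet> v) * (q i \<bullet> w))"
  by (subst orthonormal_frame_expand[OF assms, of v]) (simp add: inner_sum_left)

lemma compact_orthonormal_frames:
  "compact {Q :: real^'n^'n. orthonormal_frame (($) Q)}"
proof -
  have "{Q :: real^'n^'n. orthonormal_frame (($) Q)}
      = (\<Inter>i. \<Inter>j. {Q. Q $ i \<bullet> Q $ j = (if i = j then 1 else 0)})"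
    by (auto simp: orthonormal_frame_def)
  moreover have "closed {Q :: real^'n^'n. Q $ i \<bullet> Q $ j = c}" for i j c
    by (intro closed_Collect_eq continuous_intros)
  ultimately have "closed {Q :: real^'n^'n. orthonormal_frame (($) Q)}"
    by (auto intro!: closed_INT)
  moreover have "bounded {Q :: real^'n^'n. orthonormal_frame (($) Q)}"
  proof (rule boundedI)
    fix Q :: "real^'n^'n" assume "Q \<in> {Q. orthonormal_frame (($) Q)}"
    then have 1: "norm (Q $ i) = 1" for i using orthonormal_frameD(3) by blast
    have "norm Q \<le> (\<Sum>i\<in>UNIV. norm (Q $ i))" unfolding norm_vec_def by (rule L2_set_le_sum) simp
    then show "norm Q \<le> real CARD('n)" by (simp add: 1)
  qed
  ultimately show ?thesis by (simp add: compact_eq_bounded_closed)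
qed

lemma symmetric_dot:
  fixes B :: "real^'n^'n"
  assumes "transpose B = B"
  shows "v \<bullet> (B *v w) = w \<bullet> (B *v v)"
  by (metis assms dot_lmul_matrix inner_commute vector_transpose_matrix)

text \<open>Minimizing a weighted trace over orthonormal frames: stationarity under plane rotations
  forces a minimizing frame to diagonalize \<open>B\<close> when the weights are distinct.\<close>

lemma minimizing_eigenframe:
  fixes B :: "real^'n::finite^'n"
  assumes sym: "transpose B = B" and c: "inj c"
  obtains q \<mu> where "orthonormal_frame q" "\<And>i. B *v q i = \<mu> i *\<^sub>R q i"
    "\<And>r. orthonormal_frame r \<Longrightarrow> (\<Sum>i\<in>UNIV. c i * \<mu> i) \<le> (\<Sum>i\<in>UNIV. c i * (r i \<bullet> (B *v r i)))"
proof -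
  let ?O = "{Q :: real^'n^'n. orthonormal_frame (($) Q)}"
  define \<phi> where "\<phi> = (\<lambda>Q::real^'n^'n. \<Sum>i\<in>UNIV. c i * (Q $ i \<bullet> (B *v (Q $ i))))"
  have "mat 1 \<in> ?O"
    by (auto simp: orthonormal_frame_def mat_def inner_vec_def if_distrib[where f="\<lambda>x. x * _"] cong: if_cong)
  then have ne: "?O \<noteq> {}" by blast
  have "continuous_on ?O \<phi>"
    unfolding \<phi>_def by (intro continuous_intros linear_continuous_on_compose[of _ _ "(*v) B"]) auto
  then obtain Q where Q: "Q \<in> ?O" "\<And>R. R \<in> ?O \<Longrightarrow> \<phi> Q \<le> \<phi> R"
    using continuous_attains_inf[OF compact_orthonormal_frames ne] by blast
  define q where "q = ($) Q"
  have q: "orthonormal_frame q" using Q(1) by (simp add: q_def)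
  have min: "(\<Sum>i\<in>UNIV. c i * (q i \<bullet> (B *v q i))) \<le> (\<Sum>i\<in>UNIV. c i * (r i \<bullet> (B *v r i)))"
    if "orthonormal_frame r" for r
    using Q(2)[of "\<chi> i. r i"] that unfolding \<phi>_def q_def
    by (simp add: orthonormal_frame_def)
  have off: "q i \<bullet> (B *v q j) = 0" if ij: "i \<noteq> j" for i j
  proof -
    define r where "r = (\<lambda>\<theta> k. if k = i then cos \<theta> *\<^sub>R q i + sin \<theta> *\<^sub>R q j
        else if k = j then (- sin \<theta>) *\<^sub>R q i + cos \<theta> *\<^sub>R q j else q k)"
    have r: "orthonormal_frame (r \<theta>)" for \<theta>
    proof -
      have *: "cos \<theta> * cos \<theta> + sin \<theta> * sin \<theta> = 1" using sin_cos_squared_add[of \<theta>] by (simp add: power2_eq_square)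
      show ?thesis
        using q ij unfolding orthonormal_frame_def r_def
        by (auto simp: inner_simps * add.commute)
    qed
    define a where "a = q i \<bullet> (B *v q i)" define b where "b = q j \<bullet> (B *v q j)"
    define m where "m = q i \<bullet> (B *v q j)"
    have m': "q j \<bullet> (B *v q i) = m" unfolding m_def by (rule symmetric_dot[OF sym])
    let ?h = "\<lambda>\<theta>. c i * ((cos \<theta>)\<^sup>2 * a + 2 * cos \<theta> * sin \<theta> * m + (sin \<theta>)\<^sup>2 * b)
       + c j * ((sin \<theta>)\<^sup>2 * a - 2 * cos \<theta> * sin \<theta> * m + (cos \<theta>)\<^sup>2 * b)"
    have spl: "(\<Sum>k\<in>UNIV. g k) = g i + g j + (\<Sum>k\<in>UNIV - {i, j}. g k)" for g :: "'n \<Rightarrow> real"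
      using ij by (subst sum.subset_diff[of "{i,j}"]) auto
    have h: "(\<Sum>k\<in>UNIV. c k * (r \<theta> k \<bullet> (B *v r \<theta> k)))
        = ?h \<theta> + (\<Sum>k\<in>UNIV - {i, j}. c k * (q k \<bullet> (B *v q k)))" for \<theta>
      unfolding spl
      using ij by (simp add: r_def matrix_vector_right_distrib matrix_vector_mult_diff_distrib
          matrix_vector_mult_scaleR inner_simps a_def[symmetric] b_def[symmetric] m_def[symmetric] m'
          algebra_simps power2_eq_square)
    have "r 0 = q" using ij by (auto simp: r_def)
    then have hmin: "?h 0 \<le> ?h \<theta>" for \<theta>
      using min[OF r[of \<theta>]] h[of 0] h[of \<theta>] by simp
    have "(?h has_real_derivative 2 * (c i - c j) * m) (at 0)"
      by (auto intro!: derivative_eq_intros simp: algebra_simps)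
    then have "2 * (c i - c j) * m = 0"
      by (rule DERIV_local_min[where d=1]) (use hmin in auto)
    moreover have "c i \<noteq> c j" using c ij by (auto dest: injD)
    ultimately show ?thesis by (simp add: m_def)
  qed
  define \<mu> where "\<mu> = (\<lambda>i. q i \<bullet> (B *v q i))"
  have "B *v q i = \<mu> i *\<^sub>R q i" for i
  proof -
    have "B *v q i = (\<Sum>j\<in>UNIV. (q j \<bullet> (B *v q i)) *\<^sub>R q j)"
      by (rule orthonormal_frame_expand[OF q])
    also have "\<dots> = (\<Sum>j\<in>UNIV. if j = i then \<mu> i *\<^sub>R q i else 0)"
      by (intro sum.cong refl) (auto simp: off \<mu>_def)
    finally show ?thesis by simp
  qed
  then show thesis
    by (rule that[OF q]) (use min in \<open>simp add: \<mu>_def\<close>)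
qed

section \<open>Eigenvalue tuples and eigenframes\<close>

lemma eigenvalue_tuple_frame:
  fixes B :: "real^'n::finite^'n"
  assumes q: "orthonormal_frame q" and ev: "\<And>i. B *v q i = \<mu> i *\<^sub>R q i"
  shows "eigenvalue_tuple B (\<chi> i. \<mu> i)"
  unfolding eigenvalue_tuple_def
proof
  fix t
  let ?Q = "(\<chi> i. q i) :: real^'n^'n"
  note QQ = orthonormal_frame_matrix[OF q]
  have d: "?Q ** (t *\<^sub>R mat 1 - B) ** transpose ?Q = (\<chi> i j. if i = j then t - \<mu> i else 0)"
  proof -
    have "(?Q ** M ** transpose ?Q) $ i $ j = q i \<bullet> (M *v q j)" for M i j
      by (simp only: matrix_mul_assoc[symmetric])
        (simp add: matrix_matrix_mult_def matrix_vector_mult_def inner_vec_def transpose_def)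
    note this[of "t *\<^sub>R mat 1 - B"]
    also have "q i \<bullet> ((t *\<^sub>R mat 1 - B) *v q j) = (if i = j then t - \<mu> i else 0)" for i j
      using q by (simp add: matrix_vector_mult_diff_rdistrib ev scaleR_matrix_vector_assoc[symmetric]
          inner_diff_right orthonormal_frame_def)
    finally show ?thesis by (simp add: vec_eq_iff)
  qed
  have "det (t *\<^sub>R mat 1 - B) = det (?Q ** (t *\<^sub>R mat 1 - B) ** transpose ?Q)"
  proof -
    have "det ?Q * det (transpose ?Q) = 1"
      using QQ(1) by (metis det_I det_mul)
    then show ?thesis by (simp add: det_mul)
  qed
  also have "\<dots> = (\<Prod>i\<in>UNIV. t - \<mu> i)"
    unfolding d by (subst det_diagonal) auto
  finally show "det (t *\<^sub>R mat 1 - B) = (\<Prod>i\<in>UNIV. t - (\<chi> i. \<mu> i) $ i)" by simp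
qed

text \<open>Both products are the characteristic polynomial, and a polynomial determines the
  multiset of its roots. Eigenvalue tuples are thus fixed up to a permutation, which a symmetric
  \<open>f\<close> cannot see.\<close>

lemma eigenvalue_tuple_unique:
  fixes a b :: "real^'n::finite"
  assumes "eigenvalue_tuple B a" "eigenvalue_tuple B b"
  obtains p where "p permutes UNIV" "\<And>i. a $ i = b $ p i"
proof -
  let ?P = "\<lambda>a::real^'n. \<Prod>i\<in>UNIV. [:- a $ i, 1:]"
  have "poly (?P a) t = poly (?P b) t" for t
    using assms by (simp add: eigenvalue_tuple_def poly_prod)
  then have P: "?P a = ?P b" by (simp add: poly_eq_poly_eq_iff[symmetric] fun_eq_iff)
  have pr: "proots (?P a) = image_mset (($) a) (mset_set UNIV)" for a :: "real^'n"
  proof -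
    have "proots (?P a) = (\<Sum>i\<in>UNIV. {#a $ i#})" by (subst proots_prod) (auto simp: )
    also have "\<dots> = image_mset (($) a) (mset_set UNIV)"
    proof -
      have "(\<Sum>i\<in>S. {#a $ i#}) = image_mset (($) a) (mset_set S)" if "finite S" for S :: "'n set"
        using that by (induction S) auto
      then show ?thesis by simp
    qed
    finally show ?thesis .
  qed
  have "image_mset (($) a) (mset_set UNIV) = image_mset (($) b) (mset_set UNIV)"
    using P pr[of a] pr[of b] by simp
  then obtain p where "p permutes UNIV" "\<forall>x\<in>UNIV. a $ x = b $ p x"
    by (rule image_mset_eq_implies_permutes[OF finite]) auto
  then show thesis using that by simp
qed

text \<open>A Schur--Horn inequality in dual form.\<close>

lemma weighted_trace_ge_permuted_eigenvalues:
  fixes B :: "real^'n::finite^'n" and c :: "'n \<Rightarrow> real"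
  assumes sym: "transpose B = B" and lam: "eigenvalue_tuple B lam" and r: "orthonormal_frame r"
  obtains p where "p permutes UNIV" "(\<Sum>i\<in>UNIV. c i * lam $ p i) \<le> (\<Sum>i\<in>UNIV. c i * (r i \<bullet> (B *v r i)))"
proof -
  let ?S = "\<lambda>c. \<Sum>i\<in>UNIV. c i * (r i \<bullet> (B *v r i))"
  have inj_case: "\<exists>p. p permutes UNIV \<and> (\<Sum>i\<in>UNIV. c i * lam $ p i) \<le> ?S c" if ic: "inj c" for c
  proof -
    obtain q \<mu> where q: "orthonormal_frame q" "\<And>i. B *v q i = \<mu> i *\<^sub>R q i"
      and min: "\<And>r. orthonormal_frame r \<Longrightarrow> (\<Sum>i\<in>UNIV. c i * \<mu> i) \<le> (\<Sum>i\<in>UNIV. c i * (r i \<bullet> (B *v r i)))"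
      using minimizing_eigenframe[OF sym ic] by blast
    obtain p where p: "p permutes UNIV" "\<And>i. (\<chi> i. \<mu> i) $ i = lam $ p i"
      using eigenvalue_tuple_unique[OF eigenvalue_tuple_frame[OF q(1,2)] lam] by blast
    then show ?thesis using min[OF r] by auto
  qed
  obtain idx :: "'n \<Rightarrow> nat" where idx: "inj idx"
    using finite_imp_inj_to_nat_seg[of "UNIV :: 'n set"] by auto
  let ?P = "{p. p permutes (UNIV :: 'n set)}"
  have finP: "finite ?P" by (simp add: finite_permutations)
  \<comment> \<open>The permutation delivered for perturbed weights depends on the perturbation;
    comparing with the minimum over the finitely many permutations removes that dependence.\<close>
  define m where "m = Min ((\<lambda>p. \<Sum>i\<in>UNIV. c i * lam $ p i) ` ?P)"
  have "id \<in> ?P" by (simp add: permutes_id)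
  then have ne: "(\<lambda>p. \<Sum>i\<in>UNIV. c i * lam $ p i) ` ?P \<noteq> {}" by blast
  have mle: "m \<le> (\<Sum>i\<in>UNIV. c i * lam $ p i)" if "p permutes UNIV" for p
    unfolding m_def using that finP by (intro Min_le) auto
  define C where "C = (\<Sum>i\<in>UNIV. \<bar>real (idx i)\<bar> * \<bar>r i \<bullet> (B *v r i)\<bar>)
      + (\<Sum>i\<in>UNIV. \<Sum>j\<in>UNIV. \<bar>real (idx i)\<bar> * \<bar>lam $ j\<bar>)"
  have C0: "C \<ge> 0" unfolding C_def by (intro add_nonneg_nonneg sum_nonneg) auto
  have "m \<le> ?S c"
  proof (rule field_le_epsilon)
    fix e :: real assume e: "e > 0"
    \<comment> \<open>Adding t times distinct natural numbers makes the weights distinct unless t is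
      one of finitely many ratios. Below e / (C + 1) the perturbation costs at most e.\<close>
    define bad where "bad = (\<Union>i. \<Union>j. {(c i - c j) / (real (idx j) - real (idx i))})"
    have "finite bad" unfolding bad_def by auto
    then have "infinite ({0<..<e / (C + 1)} - bad)"
      using e C0 by (intro Diff_infinite_finite infinite_Ioo) auto
    then obtain t where t: "0 < t" "t < e / (C + 1)" "t \<notin> bad"
      by (metis DiffE ex_in_conv finite.emptyI greaterThanLessThan_iff)
    have inj: "inj (\<lambda>i. c i + t * real (idx i))"
    proof (rule injI, rule ccontr)
      fix i j assume eq: "c i + t * real (idx i) = c j + t * real (idx j)" and "i \<noteq> j"
      then have "real (idx j) - real (idx i) \<noteq> 0" using idx by (auto dest: injD)
      then have "t = (c i - c j) / (real (idx j) - real (idx i))"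
        using eq by (simp add: field_simps)
      then show False using t(3) unfolding bad_def by blast
    qed
    obtain p where p: "p permutes UNIV"
      "(\<Sum>i\<in>UNIV. (c i + t * real (idx i)) * lam $ p i) \<le> ?S (\<lambda>i. c i + t * real (idx i))"
      using inj_case[OF inj] by blast
    let ?X = "\<Sum>i\<in>UNIV. real (idx i) * lam $ p i" and ?Y = "\<Sum>i\<in>UNIV. real (idx i) * (r i \<bullet> (B *v r i))"
    have split: "(\<Sum>i\<in>UNIV. c i * lam $ p i) + t * ?X \<le> ?S c + t * ?Y"
      using p(2) by (simp add: algebra_simps sum.distrib sum_distrib_left)
    have "\<bar>?X\<bar> \<le> (\<Sum>i\<in>UNIV. \<Sum>j\<in>UNIV. \<bar>real (idx i)\<bar> * \<bar>lam $ j\<bar>)"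
    proof (rule order_trans[OF sum_abs], rule sum_mono)
      fix i show "\<bar>real (idx i) * lam $ p i\<bar> \<le> (\<Sum>j\<in>UNIV. \<bar>real (idx i)\<bar> * \<bar>lam $ j\<bar>)"
        unfolding abs_mult by (rule member_le_sum) auto
    qed
    moreover have "\<bar>?Y\<bar> \<le> (\<Sum>i\<in>UNIV. \<bar>real (idx i)\<bar> * \<bar>r i \<bullet> (B *v r i)\<bar>)"
      by (rule order_trans[OF sum_abs]) (simp add: abs_mult)
    ultimately have "?Y - ?X \<le> C" unfolding C_def by linarith
    then have "t * (?Y - ?X) \<le> t * C" using t by (intro mult_left_mono) auto
    also have "\<dots> \<le> t * (C + 1)" using t by simp
    also have "\<dots> \<le> e" using t C0 by (simp add: field_simps)
    finally show "m \<le> ?S c + e" using split mle[OF p(1)] by (simp add: algebra_simps)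
  qed
  moreover have "m \<in> (\<lambda>p. \<Sum>i\<in>UNIV. c i * lam $ p i) ` ?P"
    unfolding m_def using finP ne by (intro Min_in) auto
  ultimately show thesis using that by auto
qed

section \<open>The curvature function and the matrix \<open>A[u]\<close>\<close>

lemma F_perm: "F_conditions f \<Longrightarrow> lam \<in> Kpos \<Longrightarrow> p permutes UNIV \<Longrightarrow> f (\<chi> i. lam $ p i) = f lam"
  and F_differentiable: "F_conditions f \<Longrightarrow> lam \<in> Kpos \<Longrightarrow> f differentiable (at lam)"
  and F_deriv_pos: "F_conditions f \<Longrightarrow> lam \<in> Kpos \<Longrightarrow> frechet_derivative f (at lam) (axis i 1) > 0"
  and F_concave: "F_conditions f \<Longrightarrow> concave_on Kpos f"
  and F_one: "F_conditions f \<Longrightarrow> f (\<chi> i. 1) = 1"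
  and F_homogeneous: "F_conditions f \<Longrightarrow> lam \<in> Kpos \<Longrightarrow> t > 0 \<Longrightarrow> f (t *\<^sub>R lam) = t * f lam"
  and F_growth: "F_conditions f \<Longrightarrow> (\<exists>e0>0. \<exists>d0>0. \<forall>i. \<forall>\<eta>>0. \<exists>R0. \<forall>R\<ge>R0. \<forall>lam\<in>ball (\<chi> j. 1) d0.
         f (lam + R *\<^sub>R axis i 1) \<ge> 1 + e0 - \<eta>)"
  unfolding F_conditions_def by blast+

lemma has_derivative_line:
  assumes "(g has_derivative D) (at (x + s *\<^sub>R a))"
  shows "((\<lambda>t. g (x + t *\<^sub>R a)) has_vector_derivative D a) (at s)"
proof -
  have 1: "((\<lambda>t. x + t *\<^sub>R a) has_vector_derivative a) (at s)"
    by (auto intro!: derivative_eq_intros)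
  have "(g has_derivative D) (at (x + s *\<^sub>R a) within range (\<lambda>t. x + t *\<^sub>R a))"
    using assms has_derivative_at_withinI by blast
  then show ?thesis
    using vector_derivative_diff_chain_within[OF 1, of g D] by (simp add: o_def)
qed

text \<open>Concavity makes the difference quotients at \<open>lam\<close> towards \<open>mu\<close>
  at least f mu - f lam; the tangent plane bound is their limit from the right.\<close>

lemma concave_tangent:
  fixes f :: "real^'n::finite \<Rightarrow> real"
  assumes F: "F_conditions f" and lam: "lam \<in> Kpos" and mu: "mu \<in> Kpos"
  shows "f mu \<le> f lam + frechet_derivative f (at lam) (mu - lam)"
proof -
  let ?D = "frechet_derivative f (at lam)"
  have D: "(f has_derivative ?D) (at lam)"
    using F_differentiable[OF F lam] frechet_derivative_works by blast
  define h where "h = (\<lambda>t. f (lam + t *\<^sub>R (mu - lam)))"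
  have "(h has_vector_derivative ?D (mu - lam)) (at 0)"
    unfolding h_def by (rule has_derivative_line) (use D in simp)
  then have "(h has_real_derivative ?D (mu - lam)) (at 0)"
    by (simp add: has_real_derivative_iff_has_vector_derivative)
  then have lim: "((\<lambda>t. (h (0 + t) - h 0) / t) \<longlongrightarrow> ?D (mu - lam)) (at 0)"
    unfolding DERIV_def by simp
  have lim': "((\<lambda>t. (h (0 + t) - h 0) / t) \<longlongrightarrow> ?D (mu - lam)) (at_right 0)"
    by (rule tendsto_mono[OF _ lim]) (simp add: at_le)
  have ge: "f mu - f lam \<le> (h (0 + t) - h 0) / t" if t: "0 < t" "t < 1" for t
  proof -
    have "h t = f ((1 - t) *\<^sub>R lam + t *\<^sub>R mu)" by (simp add: h_def algebra_simps)
    also have "\<dots> \<ge> (1 - t) * f lam + t * f mu"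
      using F_concave[OF F] lam mu t unfolding concave_on_iff by auto
    finally have "t * (f mu - f lam) \<le> h t - f lam" by (simp add: algebra_simps)
    then show ?thesis using t by (simp add: h_def pos_le_divide_eq mult.commute)
  qed
  have "\<forall>\<^sub>F t in at_right 0. f mu - f lam \<le> (h (0 + t) - h 0) / t"
    unfolding eventually_at_right_field using ge by (intro exI[of _ 1]) auto
  then have "f mu - f lam \<le> ?D (mu - lam)"
    by (intro tendsto_lowerbound[OF lim']) auto
  then show ?thesis by simp
qed

text \<open>By homogeneity the tangent plane passes through the origin.\<close>

lemma supporting_functional:
  fixes f :: "real^'n::finite \<Rightarrow> real"
  assumes F: "F_conditions f" and lam: "lam \<in> Kpos"
  obtains c where "\<And>i. c i > 0" "(\<Sum>i\<in>UNIV. c i * lam $ i) = f lam"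
    "\<And>mu. mu \<in> Kpos \<Longrightarrow> f mu \<le> (\<Sum>i\<in>UNIV. c i * mu $ i)"
proof -
  let ?D = "frechet_derivative f (at lam)"
  have D: "(f has_derivative ?D) (at lam)"
    using F_differentiable[OF F lam] frechet_derivative_works by blast
  interpret D: bounded_linear ?D using D by (rule has_derivative_bounded_linear)
  define c where "c = (\<lambda>i. ?D (axis i 1))"
  have Dv: "?D v = (\<Sum>i\<in>UNIV. c i * v $ i)" for v
  proof -
    have "?D v = ?D (\<Sum>i\<in>UNIV. v $ i *\<^sub>R axis i 1)"
      using basis_expansion[of v] by (simp add: scalar_mult_eq_scaleR)
    also have "\<dots> = (\<Sum>i\<in>UNIV. c i * v $ i)"
      by (simp add: D.sum D.scaleR c_def mult.commute)
    finally show ?thesis .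
  qed
  have "((\<lambda>t. f (lam + t *\<^sub>R lam)) has_vector_derivative ?D lam) (at 0)"
    by (rule has_derivative_line) (use D in simp)
  then have d1: "((\<lambda>t. f (lam + t *\<^sub>R lam)) has_real_derivative ?D lam) (at 0)"
    by (simp add: has_real_derivative_iff_has_vector_derivative)
  have d2: "((\<lambda>t. f (lam + t *\<^sub>R lam)) has_real_derivative f lam) (at 0)"
  proof (rule has_field_derivative_transform_within[where d=1 and f="\<lambda>t. (1 + t) * f lam"])
    show "((\<lambda>t. (1 + t) * f lam) has_real_derivative f lam) (at 0)"
      by (auto intro!: derivative_eq_intros)
    fix t :: real assume "dist t 0 < 1"
    then have "f ((1 + t) *\<^sub>R lam) = (1 + t) * f lam"
      by (intro F_homogeneous[OF F lam]) (simp add: dist_real_def abs_if split: if_splits)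
    then show "(1 + t) * f lam = f (lam + t *\<^sub>R lam)"
      by (simp add: algebra_simps)
  qed auto
  have euler: "?D lam = f lam" using DERIV_unique[OF d1 d2] .
  show thesis
  proof (rule that[of c])
    show "c i > 0" for i using F_deriv_pos[OF F lam] by (simp add: c_def)
    show "(\<Sum>i\<in>UNIV. c i * lam $ i) = f lam" using euler Dv by metis
    show "f mu \<le> (\<Sum>i\<in>UNIV. c i * mu $ i)" if "mu \<in> Kpos" for mu
      using concave_tangent[OF F lam that] euler Dv[of mu] by (simp add: D.diff)
  qed
qed

lemma F_scaled_one:
  fixes f :: "real^'n::finite \<Rightarrow> real"
  assumes "F_conditions f" "b > 0"
  shows "f (\<chi> i. b) = b"
proof -
  have "f (b *\<^sub>R (\<chi> i. 1)) = b * f (\<chi> i. 1)"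
    using assms by (intro F_homogeneous) (auto simp: Kpos_def)
  moreover have "b *\<^sub>R (\<chi> i. 1) = ((\<chi> i. b) :: real^'n)" by (simp add: vec_eq_iff)
  ultimately show ?thesis using F_one[OF assms(1)] by simp
qed

text \<open>The weights supporting \<open>f\<close> at (b, ..., b) are positive and sum to 1, so f
  lam is at most a weighted mean of the entries of lam. With the companion lower bound, this
  compares a solution with umbilic graphs, whose curvatures are all equal.\<close>

lemma F_le:
  fixes f :: "real^'n::finite \<Rightarrow> real"
  assumes F: "F_conditions f" and lam: "lam \<in> Kpos" and le: "\<And>i. lam $ i \<le> b"
  shows "f lam \<le> b"
proof -
  have b: "b > 0" using lam le[of undefined] unfolding Kpos_def by (smt (verit) mem_Collect_eq)
  have K: "(\<chi> i. b) \<in> Kpos" using b by (simp add: Kpos_def)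
  obtain c where c: "\<And>i. c i > 0" "(\<Sum>i\<in>UNIV. c i * (\<chi> i. b) $ i) = f (\<chi> i. b)"
    "\<And>mu. mu \<in> Kpos \<Longrightarrow> f mu \<le> (\<Sum>i\<in>UNIV. c i * mu $ i)"
    using supporting_functional[OF F K] by blast
  have "f lam \<le> (\<Sum>i\<in>UNIV. c i * lam $ i)" by (rule c(3)[OF lam])
  also have "\<dots> \<le> (\<Sum>i\<in>UNIV. c i * b)"
    using c(1) le by (intro sum_mono mult_left_mono) (auto simp: less_imp_le)
  also have "\<dots> = b" using c(2) F_scaled_one[OF F b] by simp
  finally show ?thesis .
qed

lemma F_ge:
  fixes f :: "real^'n::finite \<Rightarrow> real"
  assumes F: "F_conditions f" and lam: "lam \<in> Kpos" and ge: "\<And>i. b \<le> lam $ i" and b: "b > 0"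
  shows "b \<le> f lam"
proof -
  obtain c where c: "\<And>i. c i > 0" "(\<Sum>i\<in>UNIV. c i * lam $ i) = f lam"
    "\<And>mu. mu \<in> Kpos \<Longrightarrow> f mu \<le> (\<Sum>i\<in>UNIV. c i * mu $ i)"
    using supporting_functional[OF F lam] by blast
  have "b = f (\<chi> i. b)" using F_scaled_one[OF F b] by simp
  also have "\<dots> \<le> (\<Sum>i\<in>UNIV. c i * (\<chi> i. b) $ i)" using b by (intro c(3)) (simp add: Kpos_def)
  also have "\<dots> \<le> (\<Sum>i\<in>UNIV. c i * lam $ i)"
    using c(1) ge by (intro sum_mono mult_left_mono) (auto simp: less_imp_le)
  finally show ?thesis using c(2) by simp
qed

section \<open>The induced metric, the matrix \<gamma> and the quadratic form of
  \<open>A[u]\<close>\<close>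

text \<open>Up to the factor u^-2 this is the metric that the half-space model induces on the graph.
  A principal curvature is an eigenvalue of \<open>mform\<close> relative to w times this
  form.\<close>

definition gform :: "(real^'n::finite \<Rightarrow> real) \<Rightarrow> real^'n \<Rightarrow> real^'n \<Rightarrow> real^'n \<Rightarrow> real" where
  "gform u x a b = a \<bullet> b - (grad u x \<bullet> a) * (grad u x \<bullet> b)"

text \<open>This is half the Hessian of \<open>\<bar>x\<bar>\<^sup>2 - u\<^sup>2\<close>.\<close>
definition mform :: "(real^'n::finite \<Rightarrow> real) \<Rightarrow> real^'n \<Rightarrow> real^'n \<Rightarrow> real^'n \<Rightarrow> real" where
  "mform u x a b = gform u x a b - u x * (a \<bullet> (hess u x *v b))"

context
  fixes u :: "real^'n::finite \<Rightarrow> real" and x :: "real^'n"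
  assumes p1: "norm (grad u x) < 1"
begin

lemma wfun_pos: "wfun u x > 0"
  using p1 by (simp add: wfun_def power_less_one_iff abs_square_less_1)

lemma wfun_square: "(wfun u x)\<^sup>2 = 1 - (norm (grad u x))\<^sup>2"
  using p1 by (simp add: wfun_def abs_square_le_1 power_le_one)

lemma wfun_le_1: "wfun u x \<le> 1"
  by (simp add: wfun_def)

lemma gam_vec: "gam u x *v v = v + ((grad u x \<bullet> v) / (wfun u x * (1 + wfun u x))) *\<^sub>R grad u x"
  by (simp add: vec_eq_iff gam_def matrix_vector_mult_def inner_vec_def algebra_simps sum.distrib
      sum_divide_distrib sum_distrib_left if_distrib[where f="\<lambda>x. x * _"] if_distrib[where f="\<lambda>x. _ * x"] cong: if_cong)

lemma gam_aux: "1 + (grad u x \<bullet> grad u x) / (wfun u x * (1 + wfun u x)) = 1 / wfun u x"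
proof -
  have "grad u x \<bullet> grad u x = (1 - wfun u x) * (1 + wfun u x)"
    using wfun_square by (simp add: power2_norm_eq_inner[symmetric] algebra_simps power2_eq_square)
  then show ?thesis using wfun_pos by (simp add: divide_simps)
qed

lemma grad_gam: "grad u x \<bullet> (gam u x *v v) = (grad u x \<bullet> v) / wfun u x"
proof -
  have "grad u x \<bullet> (gam u x *v v)
      = (grad u x \<bullet> v) * (1 + (grad u x \<bullet> grad u x) / (wfun u x * (1 + wfun u x)))"
    by (simp add: gam_vec inner_right_distrib algebra_simps)
  then show ?thesis using gam_aux by simp
qed

lemma gam_inner: "(gam u x *v v) \<bullet> (gam u x *v v') = v \<bullet> v' + (grad u x \<bullet> v) * (grad u x \<bullet> v') / (wfun u x)\<^sup>2"
proof -
  let ?w = "wfun u x" and ?p = "grad u x"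
  have "(gam u x *v v) \<bullet> (gam u x *v v')
     = v \<bullet> (gam u x *v v') + ((?p \<bullet> v) / (?w * (1 + ?w))) * (?p \<bullet> (gam u x *v v'))"
    by (subst gam_vec[of v]) (simp add: inner_left_distrib)
  also have "v \<bullet> (gam u x *v v') = v \<bullet> v' + ((?p \<bullet> v') / (?w * (1 + ?w))) * (?p \<bullet> v)"
    by (simp only: gam_vec inner_right_distrib inner_scaleR_right inner_commute[of v ?p])
  also have "?p \<bullet> (gam u x *v v') = (?p \<bullet> v') / ?w" by (rule grad_gam)
  also have "v \<bullet> v' + ((?p \<bullet> v') / (?w * (1 + ?w))) * (?p \<bullet> v)
      + ((?p \<bullet> v) / (?w * (1 + ?w))) * ((?p \<bullet> v') / ?w)
      = v \<bullet> v' + (?p \<bullet> v) * (?p \<bullet> v') * (1 / (?w * (1 + ?w)) + 1 / (?w * (1 + ?w) * ?w))"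
    by (simp add: distrib_left mult.commute)
  also have "1 / (?w * (1 + ?w)) + 1 / (?w * (1 + ?w) * ?w) = 1 / ?w\<^sup>2"
  proof -
    have "?w * ?w + ?w \<noteq> 0" using wfun_pos by (smt (verit) mult_pos_pos)
    then show ?thesis using wfun_pos by (simp add: divide_simps power2_eq_square)
  qed
  finally show ?thesis by simp
qed

lemma gform_gam: "gform u x (gam u x *v v) (gam u x *v v') = v \<bullet> v'"
  by (simp add: gform_def gam_inner grad_gam power2_eq_square)

lemma norm_gam_le: "norm (gam u x *v v) \<le> norm v / wfun u x"
proof -
  let ?w = "wfun u x" and ?p = "grad u x"
  have "(norm (gam u x *v v))\<^sup>2 = (norm v)\<^sup>2 + (?p \<bullet> v)\<^sup>2 / ?w\<^sup>2"
    by (simp add: gam_inner power2_norm_eq_inner) (simp add: power2_eq_square)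
  also have "\<dots> \<le> (norm v)\<^sup>2 + (norm ?p * norm v)\<^sup>2 / ?w\<^sup>2"
    using Cauchy_Schwarz_ineq2[of ?p v]
    by (intro add_left_mono divide_right_mono) (auto simp: abs_le_square_iff[symmetric])
  also have "\<dots> = (norm v / ?w)\<^sup>2"
  proof -
    have "(norm v)\<^sup>2 * ?w\<^sup>2 + (norm ?p * norm v)\<^sup>2 = (norm v)\<^sup>2"
      by (simp add: wfun_square power_mult_distrib algebra_simps)
    then show ?thesis using wfun_pos by (simp add: divide_simps power_divide)
  qed
  finally show ?thesis
    by (rule power2_le_imp_le) (use wfun_pos in simp)
qed

lemma gam_surj: obtains v' where "v = gam u x *v v'"
proof
  let ?w = "wfun u x" and ?p = "grad u x"
  \<comment> \<open>I - p p^T / (1 + w) is the square root of g = I - p p^T, hence the inverse of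
    \<gamma>.\<close>
  define v' where "v' = v - ((?p \<bullet> v) / (1 + ?w)) *\<^sub>R ?p"
  have pp: "?p \<bullet> ?p = (1 - ?w) * (1 + ?w)"
    using wfun_square by (simp add: power2_norm_eq_inner[symmetric] algebra_simps power2_eq_square)
  have "?p \<bullet> v' = ?w * (?p \<bullet> v)"
    unfolding v'_def inner_diff_right inner_scaleR_right pp using wfun_pos by (simp add: field_simps)
  then have "gam u x *v v' = v' + ((?p \<bullet> v) / (1 + ?w)) *\<^sub>R ?p"
    using wfun_pos by (simp add: gam_vec)
  then show "v = gam u x *v v'" by (simp add: v'_def)
qed

lemma gam_symmetric: "transpose (gam u x) = gam u x"
  by (simp add: transpose_def gam_def vec_eq_iff mult.commute)

text \<open>Moving \<gamma> onto the vectors trades the eigenvalue problem of \<open>Amat\<close>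
  for the pair (\<open>mform\<close>, \<open>gform\<close>), whose coefficients are polynomial in u,
  Du and D^2u; \<gamma> then survives only in the frame vectors.\<close>

lemma Amat_form: "a \<bullet> (Amat u x *v b) = mform u x (gam u x *v a) (gam u x *v b) / wfun u x"
proof -
  have "a \<bullet> ((gam u x ** hess u x ** gam u x) *v b) = a \<bullet> (gam u x *v (hess u x *v (gam u x *v b)))"
    by (simp add: matrix_vector_mul_assoc matrix_mul_assoc)
  also have "\<dots> = (gam u x *v a) \<bullet> (hess u x *v (gam u x *v b))"
    by (metis gam_symmetric dot_lmul_matrix vector_transpose_matrix)
  finally have 1: "a \<bullet> ((gam u x ** hess u x ** gam u x) *v b) = (gam u x *v a) \<bullet> (hess u x *v (gam u x *v b))" .
  have "a \<bullet> (Amat u x *v b) = (a \<bullet> b - u x * (a \<bullet> ((gam u x ** hess u x ** gam u x) *v b))) / wfun u x"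
    unfolding Amat_def
    by (simp add: scaleR_matrix_vector_assoc[symmetric] matrix_vector_mult_diff_rdistrib inner_diff_right)
  then show ?thesis by (simp add: 1 mform_def gform_gam)
qed

lemma Amat_symmetric:
  assumes "transpose (hess u x) = hess u x"
  shows "transpose (Amat u x) = Amat u x"
proof -
  have "transpose (gam u x ** hess u x ** gam u x) = gam u x ** hess u x ** gam u x"
    by (simp add: matrix_transpose_mul gam_symmetric assms matrix_mul_assoc)
  then have "(gam u x ** hess u x ** gam u x) $ j $ i = (gam u x ** hess u x ** gam u x) $ i $ j" for i j
    by (simp add: transpose_def vec_eq_iff)
  then show ?thesis
    by (simp add: Amat_def transpose_def vec_eq_iff mat_def)
qed

end

section \<open>The linearized equation\<close>

lemma has_vector_derivative_matrix_vector:
  fixes H :: "real \<Rightarrow> real^'n::finite^'m::finite"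
  assumes "(H has_vector_derivative H') (at t)" "(e has_vector_derivative e') (at t)"
  shows "((\<lambda>t. H t *v e t) has_vector_derivative (H t *v e' + H' *v e t)) (at t)"
proof -
  have "bilinear (\<lambda>(A :: real^'n^'m) v. A *v v)"
    unfolding bilinear_def
    by (auto intro!: linearI simp: matrix_vector_right_distrib matrix_vector_mult_add_rdistrib
        matrix_vector_mult_scaleR scaleR_matrix_vector_assoc)
  then have "bounded_bilinear (\<lambda>(A :: real^'n^'m) v. A *v v)"
    by (simp add: bilinear_conv_bounded_bilinear)
  from bounded_bilinear.has_vector_derivative[OF this assms] show ?thesis .
qed

lemma has_real_derivative_inner:
  fixes f g :: "real \<Rightarrow> 'a::real_inner"
  assumes "(f has_vector_derivative f') (at t)" "(g has_vector_derivative g') (at t)"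
  shows "((\<lambda>t. f t \<bullet> g t) has_real_derivative (f t \<bullet> g' + f' \<bullet> g t)) (at t)"
  using bounded_bilinear.has_vector_derivative[OF bounded_bilinear_inner assms]
  by (simp add: has_real_derivative_iff_has_vector_derivative)

lemma open_contains_line:
  fixes a :: "'a::real_normed_vector"
  assumes "open S" "x \<in> S"
  obtains r where "r > 0" "\<And>t. \<bar>t\<bar> < r \<Longrightarrow> x + t *\<^sub>R a \<in> S"
proof -
  obtain s where s: "s > 0" "ball x s \<subseteq> S" using assms open_contains_ball by blast
  show thesis
  proof (rule that[of "s / (norm a + 1)"])
    show "s / (norm a + 1) > 0" using s by (simp add: add_nonneg_pos)
    fix t assume "\<bar>t\<bar> < s / (norm a + 1)"
    then have "\<bar>t\<bar> * (norm a + 1) < s" by (simp add: pos_less_divide_eq add_nonneg_pos)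
    then have "\<bar>t\<bar> * norm a < s" using abs_ge_zero[of t] unfolding distrib_left by linarith
    then show "x + t *\<^sub>R a \<in> S" using s(2) by (auto simp: dist_norm)
  qed
qed

locale steady_state_graph =
  fixes \<Omega> :: "(real^'n::finite) set" and f :: "real^'n \<Rightarrow> real" and \<sigma> \<epsilon> :: real
    and u :: "real^'n \<Rightarrow> real"
  assumes open_domain: "open \<Omega>" and bounded_domain: "bounded \<Omega>"
    and F: "F_conditions f" and sigma: "\<sigma> > 1" and eps: "\<epsilon> > 0"
    and solution: "admissible_solution \<Omega> f \<sigma> \<epsilon> u"
begin

lemma Omega_closure: "x \<in> \<Omega> \<Longrightarrow> x \<in> closure \<Omega>"
  using closure_subset by blast

lemma u_pos: "x \<in> closure \<Omega> \<Longrightarrow> u x > 0"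
  and grad_less_1: "x \<in> closure \<Omega> \<Longrightarrow> norm (grad u x) < 1"
  using solution by (auto simp: admissible_solution_def admissible_def)

lemma u_boundary: "x \<in> frontier \<Omega> \<Longrightarrow> u x = \<epsilon>"
  using solution by (auto simp: admissible_solution_def)

lemma frontier_closure: "x \<in> frontier \<Omega> \<Longrightarrow> x \<in> closure \<Omega>"
  by (simp add: frontier_def)

lemma closure_cases: "x \<in> closure \<Omega> \<Longrightarrow> x \<in> \<Omega> \<or> x \<in> frontier \<Omega>"
  using interior_open[OF open_domain] by (auto simp: frontier_def)

lemma smooth: obtains U where "smooth_on U u" "closure \<Omega> \<subseteq> U"
  using solution by (auto simp: admissible_solution_def smooth_on_closure_def)

lemma u_has_derivative: "x \<in> closure \<Omega> \<Longrightarrow> (u has_derivative (\<lambda>h. h \<bullet> grad u x)) (at x)"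
  and grad_has_derivative': "x \<in> closure \<Omega> \<Longrightarrow> (grad u has_derivative (\<lambda>h. hess u x *v h)) (at x)"
  and hess_has_derivative': "x \<in> closure \<Omega> \<Longrightarrow> (hess u has_derivative thd u x) (at x)"
  and hess_sym: "x \<in> closure \<Omega> \<Longrightarrow> transpose (hess u x) = hess u x"
  and thd_sym: "x \<in> closure \<Omega> \<Longrightarrow> a \<bullet> (thd u x b *v c) = b \<bullet> (thd u x a *v c)"
  using smooth smooth_on_has_derivative grad_has_derivative hess_has_derivative hess_symmetric
    thd_symmetric by (metis subsetD)+

lemma hess_dot: "x \<in> closure \<Omega> \<Longrightarrow> a \<bullet> (hess u x *v b) = b \<bullet> (hess u x *v a)"
  by (rule symmetric_dot[OF hess_sym])

lemma continuous_on_u: "continuous_on (closure \<Omega>) u"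
  and continuous_on_grad: "continuous_on (closure \<Omega>) (grad u)"
  and continuous_on_hess: "continuous_on (closure \<Omega>) (hess u)"
  using u_has_derivative grad_has_derivative' hess_has_derivative'
  by (meson has_derivative_continuous continuous_at_imp_continuous_on)+

lemma compact_closure_domain: "compact (closure \<Omega>)"
  using bounded_domain by (simp add: compact_closure)

lemma w_pos: "x \<in> closure \<Omega> \<Longrightarrow> wfun u x > 0"
  using wfun_pos[OF grad_less_1] .

text \<open>The relation holds against every v because \<gamma> is onto. It is needed for vectors
  outside the frame, such as the derivative of a moving frame vector or its image under a rotation
  generator.\<close>

lemma eigenvector_mform:
  assumes x: "x \<in> closure \<Omega>" and ev: "Amat u x *v q = k *\<^sub>R q"
  shows "mform u x (gam u x *v q) v = wfun u x * k * gform u x (gam u x *v q) v"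
proof -
  note p1 = grad_less_1[OF x]
  obtain v' where v': "v = gam u x *v v'" using gam_surj[OF p1] .
  have "mform u x (gam u x *v q) v = wfun u x * (q \<bullet> (Amat u x *v v'))"
    using w_pos[OF x] by (simp add: Amat_form[OF p1] v')
  also have "q \<bullet> (Amat u x *v v') = v' \<bullet> (Amat u x *v q)"
    by (rule symmetric_dot[OF Amat_symmetric[OF p1 hess_sym[OF x]]])
  also have "\<dots> = k * gform u x (gam u x *v q) v"
    by (simp add: ev v' gform_gam[OF p1] inner_commute)
  finally show ?thesis by simp
qed

text \<open>A solution only supplies the roots of the characteristic polynomial. Symmetry of
  \<open>Amat\<close> gives an orthonormal eigenframe whose eigenvalues are a permutation of those
  roots, and (F1) carries the equation over.\<close>

lemma spectral_curvatures:
  assumes "x \<in> \<Omega>"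
  obtains q \<kappa> where "orthonormal_frame q" "\<And>i. Amat u x *v q i = \<kappa> i *\<^sub>R q i"
    "(\<chi> i. \<kappa> i) \<in> Kpos" "f (\<chi> i. \<kappa> i) = \<sigma>"
proof -
  have x: "x \<in> closure \<Omega>" using assms Omega_closure by blast
  obtain lam where lam: "eigenvalue_tuple (Amat u x) lam" "lam \<in> Kpos" "f lam = \<sigma>"
    using solution assms by (auto simp: admissible_solution_def)
  obtain idx :: "'n \<Rightarrow> nat" where "inj idx"
    using finite_imp_inj_to_nat_seg[of "UNIV :: 'n set"] by auto
  then have inj: "inj (\<lambda>i. real (idx i))" by (simp add: inj_def)
  obtain q \<kappa> where q: "orthonormal_frame q" "\<And>i. Amat u x *v q i = \<kappa> i *\<^sub>R q i"
    by (rule minimizing_eigenframe[OF Amat_symmetric[OF grad_less_1[OF x] hess_sym[OF x]] inj]) (rule that)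
  obtain p where p: "p permutes UNIV" "\<And>i. (\<chi> i. \<kappa> i) $ i = lam $ p i"
    using eigenvalue_tuple_unique[OF eigenvalue_tuple_frame[OF q] lam(1)] by blast
  have eq: "(\<chi> i. \<kappa> i) = (\<chi> i. lam $ p i)" using p(2) by (simp add: vec_eq_iff)
  show thesis
  proof (rule that[OF q])
    show "(\<chi> i. \<kappa> i) \<in> Kpos" using lam(2) by (simp add: eq Kpos_def)
    show "f (\<chi> i. \<kappa> i) = \<sigma>" unfolding eq using F_perm[OF F lam(2) p(1)] lam(3) by simp
  qed
qed

text \<open>At z the frame q need not diagonalize \<open>Amat\<close>, so the trace inequality is
  used with whichever permutation of the eigenvalues it yields; \<open>f\<close> takes the value
  \<sigma> on each of them.\<close>

lemma support_elsewhere: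
  assumes z: "z \<in> \<Omega>" and q: "orthonormal_frame q"
    and c: "\<And>mu. mu \<in> Kpos \<Longrightarrow> f mu \<le> (\<Sum>i\<in>UNIV. c i * mu $ i)"
  shows "\<sigma> \<le> (\<Sum>i\<in>UNIV. c i * (q i \<bullet> (Amat u z *v q i)))"
proof -
  have z': "z \<in> closure \<Omega>" using z Omega_closure by blast
  obtain lam where lam: "eigenvalue_tuple (Amat u z) lam" "lam \<in> Kpos" "f lam = \<sigma>"
    using solution z by (auto simp: admissible_solution_def)
  obtain p where p: "p permutes UNIV"
     "(\<Sum>i\<in>UNIV. c i * lam $ p i) \<le> (\<Sum>i\<in>UNIV. c i * (q i \<bullet> (Amat u z *v q i)))"
    using weighted_trace_ge_permuted_eigenvalues[OF
        Amat_symmetric[OF grad_less_1[OF z'] hess_sym[OF z']] lam(1) q] by blast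
  have "\<sigma> = f (\<chi> i. lam $ p i)" using F_perm[OF F lam(2) p(1)] lam(3) by simp
  also have "\<dots> \<le> (\<Sum>i\<in>UNIV. c i * (\<chi> i. lam $ p i) $ i)"
    using lam(2) by (intro c) (auto simp: Kpos_def)
  finally show ?thesis using p(2) by simp
qed

text \<open>The functional \<open>z \<mapsto> \<Sum> c\<^sub>i q\<^sub>i\<cdot>A(z) q\<^sub>i\<close> is minimal at \<open>x\<close>, and its vanishing derivative is the
  differentiated equation; \<open>f\<close> itself is never differentiated on matrices.\<close>

lemma linearized_equation:
  assumes x: "x \<in> \<Omega>" and q: "orthonormal_frame q"
    and ev: "\<And>i. Amat u x *v q i = \<kappa> i *\<^sub>R q i"
    and ck: "(\<Sum>i\<in>UNIV. c i * \<kappa> i) = \<sigma>"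
    and c: "\<And>mu. mu \<in> Kpos \<Longrightarrow> f mu \<le> (\<Sum>i\<in>UNIV. c i * mu $ i)"
  defines "e \<equiv> \<lambda>i. gam u x *v q i"
  shows "(\<Sum>i\<in>UNIV. c i * (u x * (e i \<bullet> (thd u x a *v e i)) + (a \<bullet> grad u x) * (e i \<bullet> (hess u x *v e i))))
    = \<sigma> / wfun u x * (grad u x \<bullet> (hess u x *v a))
      - 2 * (\<Sum>i\<in>UNIV. c i * (1 - wfun u x * \<kappa> i) * ((hess u x *v a) \<bullet> e i) * (grad u x \<bullet> e i))"
proof -
  have x': "x \<in> closure \<Omega>" using x Omega_closure by blast
  note p1 = grad_less_1[OF x']
  define w where "w = wfun u x" define p where "p = grad u x" define H where "H = hess u x"
  define pd where "pd = H *v a" define H' where "H' = thd u x a"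
  have w: "w > 0" using w_pos[OF x'] by (simp add: w_def)
  have mev: "mform u x (e i) v = w * \<kappa> i * gform u x (e i) v" for i v
    unfolding e_def w_def by (rule eigenvector_mform[OF x' ev])
  define P where "P = (\<lambda>t. grad u (x + t *\<^sub>R a))"
  define W where "W = (\<lambda>t. sqrt (1 - P t \<bullet> P t))"
  have P0: "P 0 = p" by (simp add: P_def p_def)
  have W0: "W 0 = w" by (simp add: W_def P0 w_def wfun_def p_def power2_norm_eq_inner)
  have dP: "(P has_vector_derivative pd) (at 0)"
    unfolding P_def pd_def H_def
    by (rule has_derivative_line) (use grad_has_derivative'[OF x'] in simp)
  have du: "((\<lambda>t. u (x + t *\<^sub>R a)) has_real_derivative a \<bullet> p) (at 0)"
    unfolding has_real_derivative_iff_has_vector_derivative p_def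
    by (rule has_derivative_line) (use u_has_derivative[OF x'] in simp)
  have dH: "((\<lambda>t. hess u (x + t *\<^sub>R a)) has_vector_derivative H') (at 0)"
    unfolding H'_def
    by (rule has_derivative_line) (use hess_has_derivative'[OF x'] in simp)
  have dPP: "((\<lambda>t. P t \<bullet> P t) has_real_derivative 2 * (p \<bullet> pd)) (at 0)"
    using has_real_derivative_inner[OF dP dP] by (simp add: P0 inner_commute)
  have pos: "1 - P 0 \<bullet> P 0 > 0"
    using w wfun_square[OF p1] by (simp add: P0 p_def w_def power2_norm_eq_inner[symmetric])
      (metis diff_gt_0_iff_gt zero_less_power)
  have dW: "(W has_real_derivative - (p \<bullet> pd) / w) (at 0)"
  proof -
    have "(W has_real_derivative (inverse (sqrt (1 - P 0 \<bullet> P 0)) / 2) * (0 - 2 * (p \<bullet> pd))) (at 0)"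
      unfolding W_def
      by (rule DERIV_chain2[where f=sqrt and g="\<lambda>t. 1 - P t \<bullet> P t", OF DERIV_real_sqrt[OF pos]])
        (rule DERIV_diff[OF DERIV_const dPP])
    moreover have "sqrt (1 - P 0 \<bullet> P 0) = w" using W0 by (simp add: W_def)
    ultimately show ?thesis by (simp add: field_simps)
  qed
  \<comment> \<open>The q_i stay fixed while \<gamma> moves with the point, so E_i(t) remains a unit
    vector for the moving metric. Its derivative is never computed: constancy of \<open>G i\<close>
    and the eigenvector relation determine everything it contributes.\<close>
  define E where "E = (\<lambda>i t. q i + ((P t \<bullet> q i) / (W t * (1 + W t))) *\<^sub>R P t)"
  have E0: "E i 0 = e i" for i
    by (simp add: E_def e_def gam_vec[OF p1] P0 W0 p_def w_def)
  have "\<exists>E'. \<forall>i. (E i has_vector_derivative E' i) (at 0)"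
  proof (rule choice, rule allI)
    fix i
    have "((\<lambda>t. P t \<bullet> q i) has_real_derivative pd \<bullet> q i) (at 0)"
      using has_real_derivative_inner[OF dP has_vector_derivative_const] by simp
    moreover have "W 0 * (1 + W 0) \<noteq> 0" using w by (simp add: W0)
    ultimately have "\<exists>k'. ((\<lambda>t. (P t \<bullet> q i) / (W t * (1 + W t))) has_real_derivative k') (at 0)"
      using dW by (intro exI) (rule DERIV_divide, assumption, (rule derivative_eq_intros refl | assumption)+)
    then obtain k' where "((\<lambda>t. (P t \<bullet> q i) / (W t * (1 + W t))) has_real_derivative k') (at 0)" ..
    from has_vector_derivative_add[OF has_vector_derivative_const has_vector_derivative_scaleR[OF this dP]]
    show "\<exists>E'. (E i has_vector_derivative E') (at 0)"
      unfolding E_def by blast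
  qed
  then obtain E' where dE: "\<And>i. (E i has_vector_derivative E' i) (at 0)" by blast
  have gm: "gam u (x + t *\<^sub>R a) *v q i = E i t" if "x + t *\<^sub>R a \<in> \<Omega>" for t i
    using gam_vec[OF grad_less_1[OF Omega_closure[OF that]], of "q i"]
    by (simp add: E_def P_def W_def wfun_def power2_norm_eq_inner)
  obtain r where r: "r > 0" "\<And>t. \<bar>t\<bar> < r \<Longrightarrow> x + t *\<^sub>R a \<in> \<Omega>"
    using open_contains_line[OF open_domain x] by blast
  define G where "G = (\<lambda>i t. E i t \<bullet> E i t - (P t \<bullet> E i t) * (P t \<bullet> E i t))"
  define M where "M = (\<lambda>i t. G i t - u (x + t *\<^sub>R a) * (E i t \<bullet> (hess u (x + t *\<^sub>R a) *v E i t)))"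
  have dPE: "((\<lambda>t. P t \<bullet> E i t) has_real_derivative p \<bullet> E' i + pd \<bullet> e i) (at 0)" for i
    using has_real_derivative_inner[OF dP dE[of i]] by (simp add: P0 E0)
  have dG: "(G i has_real_derivative 2 * gform u x (e i) (E' i) - 2 * (pd \<bullet> e i) * (p \<bullet> e i)) (at 0)" for i
  proof -
    have "(G i has_real_derivative (e i \<bullet> E' i + E' i \<bullet> e i)
        - ((p \<bullet> E' i + pd \<bullet> e i) * (p \<bullet> e i) + (p \<bullet> E' i + pd \<bullet> e i) * (p \<bullet> e i))) (at 0)"
      unfolding G_def
      using DERIV_diff[OF has_real_derivative_inner[OF dE[of i] dE[of i]] DERIV_mult[OF dPE[of i] dPE[of i]]]
      by (simp add: P0 E0)
    then show ?thesis by (simp add: gform_def p_def inner_commute algebra_simps)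
  qed
  have G1: "G i t = 1" if "\<bar>t\<bar> < r" for i t
    using gform_gam[OF grad_less_1[OF Omega_closure[OF r(2)[OF that]]], of "q i" "q i"]
      orthonormal_frameD(1)[OF q, of i]
    by (simp add: gm[OF r(2)[OF that]] gform_def G_def P_def)
  have dG0: "(G i has_real_derivative 0) (at 0)" for i
    by (rule has_field_derivative_transform_within[where f="\<lambda>_. 1", OF _ r(1)])
      (use r(1) G1 in \<open>auto simp: dist_real_def\<close>)
  have G': "gform u x (e i) (E' i) = (pd \<bullet> e i) * (p \<bullet> e i)" for i
    using DERIV_unique[OF dG[of i] dG0[of i]] by simp
  define m' where "m' = (\<lambda>i. - 2 * (1 - w * \<kappa> i) * (pd \<bullet> e i) * (p \<bullet> e i)
      - (u x * (e i \<bullet> (H' *v e i)) + (a \<bullet> p) * (e i \<bullet> (H *v e i))))"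
  have dM: "(M i has_real_derivative m' i) (at 0)" for i
  proof -
    have 1: "((\<lambda>t. hess u (x + t *\<^sub>R a) *v E i t) has_vector_derivative (H *v E' i + H' *v e i)) (at 0)"
      using has_vector_derivative_matrix_vector[OF dH dE[of i]] by (simp add: H_def E0)
    have 2: "((\<lambda>t. E i t \<bullet> (hess u (x + t *\<^sub>R a) *v E i t)) has_real_derivative
        e i \<bullet> (H *v E' i + H' *v e i) + E' i \<bullet> (H *v e i)) (at 0)"
      using has_real_derivative_inner[OF dE[of i] 1] by (simp add: H_def E0)
    have 3: "(M i has_real_derivative (2 * gform u x (e i) (E' i) - 2 * (pd \<bullet> e i) * (p \<bullet> e i))
        - ((a \<bullet> p) * (e i \<bullet> (H *v e i)) + (e i \<bullet> (H *v E' i + H' *v e i) + E' i \<bullet> (H *v e i)) * u x)) (at 0)"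
      unfolding M_def using DERIV_diff[OF dG[of i] DERIV_mult[OF du 2]] by (simp add: H_def E0)
    have 4: "E' i \<bullet> (H *v e i) = e i \<bullet> (H *v E' i)" unfolding H_def by (rule hess_dot[OF x'])
    \<comment> \<open>The eigenvector relation replaces u D^2u e_i by (1 - w \<kappa>_i) g e_i,
      which leaves only the metric product of e_i with its derivative, known from
      \<open>G'\<close>.\<close>
    have 5: "u x * (e i \<bullet> (H *v E' i)) = (1 - w * \<kappa> i) * ((pd \<bullet> e i) * (p \<bullet> e i))"
      using mev[of i "E' i"] G'[of i] by (simp add: mform_def H_def algebra_simps)
    have "(2 * gform u x (e i) (E' i) - 2 * (pd \<bullet> e i) * (p \<bullet> e i))
        - ((a \<bullet> p) * (e i \<bullet> (H *v e i)) + (e i \<bullet> (H *v E' i + H' *v e i) + E' i \<bullet> (H *v e i)) * u x)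
        = - 2 * (u x * (e i \<bullet> (H *v E' i))) - (u x * (e i \<bullet> (H' *v e i)) + (a \<bullet> p) * (e i \<bullet> (H *v e i)))"
      by (simp add: G' 4 inner_add_right algebra_simps)
    also have "\<dots> = m' i" unfolding 5 m'_def by (simp add: algebra_simps)
    finally show ?thesis by (rule DERIV_cong[OF 3])
  qed
  have M0: "M i 0 = w * \<kappa> i" for i
    using mev[of i "e i"] gform_gam[OF p1, of "q i" "q i"] orthonormal_frameD(1)[OF q, of i]
    by (simp add: M_def G_def mform_def gform_def P0 E0 p_def H_def) (simp add: e_def)
  define \<theta> where "\<theta> = (\<lambda>t. (\<Sum>i\<in>UNIV. c i * M i t) / W t)"
  have th: "\<theta> t = (\<Sum>i\<in>UNIV. c i * (q i \<bullet> (Amat u (x + t *\<^sub>R a) *v q i)))" if "\<bar>t\<bar> < r" for t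
  proof -
    have "q i \<bullet> (Amat u (x + t *\<^sub>R a) *v q i) = M i t / W t" for i
      using Amat_form[OF grad_less_1[OF Omega_closure[OF r(2)[OF that]]], of "q i" "q i"]
      by (simp add: gm[OF r(2)[OF that]] mform_def gform_def M_def G_def P_def W_def wfun_def power2_norm_eq_inner)
    then show ?thesis by (simp add: \<theta>_def sum_divide_distrib)
  qed
  have th0: "\<theta> 0 = \<sigma>"
    using w by (simp add: \<theta>_def M0 W0 sum_divide_distrib ck)
  have min: "\<forall>t. \<bar>0 - t\<bar> < r \<longrightarrow> \<theta> 0 \<le> \<theta> t"
    using th0 th support_elsewhere[OF r(2) q c] by simp
  have dsum: "((\<lambda>t. \<Sum>i\<in>UNIV. c i * M i t) has_real_derivative (\<Sum>i\<in>UNIV. c i * m' i)) (at 0)"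
    by (rule DERIV_sum) (rule DERIV_cmult[OF dM])
  have S0: "(\<Sum>i\<in>UNIV. c i * M i 0) = w * \<sigma>"
    by (simp add: M0 ck[symmetric] sum_distrib_left ac_simps)
  have "(\<theta> has_real_derivative ((\<Sum>i\<in>UNIV. c i * m' i) * w - w * \<sigma> * (- (p \<bullet> pd) / w)) / (w * w)) (at 0)"
    unfolding \<theta>_def using DERIV_divide[OF dsum dW] w by (simp add: W0 S0)
  from DERIV_local_min[OF this r(1) min]
  have "(\<Sum>i\<in>UNIV. c i * m' i) = - \<sigma> / w * (p \<bullet> pd)" using w by (simp add: field_simps)
  then have "(\<Sum>i\<in>UNIV. c i * (u x * (e i \<bullet> (H' *v e i)) + (a \<bullet> p) * (e i \<bullet> (H *v e i))))
     = \<sigma> / w * (p \<bullet> pd) - 2 * (\<Sum>i\<in>UNIV. c i * (1 - w * \<kappa> i) * (pd \<bullet> e i) * (p \<bullet> e i))"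
    by (simp add: m'_def algebra_simps sum.distrib sum_subtractf sum_negf sum_distrib_left)
  then show ?thesis by (simp add: w_def p_def H_def H'_def pd_def)
qed

text \<open>Generalized eigenvectors of the pair (\<open>mform\<close>, \<open>gform\<close>), with the weights \<open>c i\<close> playing the role of
  \<open>\<partial>f/\<partial>\<lambda>\<^sub>i\<close>.\<close>

definition curvature_frame :: "real^'n \<Rightarrow> ('n \<Rightarrow> real^'n) \<Rightarrow> ('n \<Rightarrow> real) \<Rightarrow> ('n \<Rightarrow> real) \<Rightarrow> bool" where
  "curvature_frame x e \<kappa> c \<longleftrightarrow>
    (\<forall>i j. gform u x (e i) (e j) = (if i = j then 1 else 0)) \<and>
    (\<forall>i v. mform u x (e i) v = wfun u x * \<kappa> i * gform u x (e i) v) \<and>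
    (\<forall>i. norm (e i) \<le> 1 / wfun u x) \<and>
    (\<forall>i. \<kappa> i > 0) \<and> (\<forall>i. c i > 0) \<and> f (\<chi> i. \<kappa> i) = \<sigma> \<and>
    (\<Sum>i\<in>UNIV. c i * \<kappa> i) = \<sigma> \<and> 1 \<le> (\<Sum>i\<in>UNIV. c i) \<and>
    (\<forall>a. (\<Sum>i\<in>UNIV. c i * (u x * (e i \<bullet> (thd u x a *v e i)) + (a \<bullet> grad u x) * (e i \<bullet> (hess u x *v e i))))
      = \<sigma> / wfun u x * (grad u x \<bullet> (hess u x *v a))
        - 2 * (\<Sum>i\<in>UNIV. c i * (1 - wfun u x * \<kappa> i) * ((hess u x *v a) \<bullet> e i) * (grad u x \<bullet> e i)))"

lemma curvature_frame_exists:
  assumes x: "x \<in> \<Omega>"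
  obtains e \<kappa> c where "curvature_frame x e \<kappa> c" "\<And>v. v = (\<Sum>i\<in>UNIV. gform u x (e i) v *\<^sub>R e i)"
proof -
  have x': "x \<in> closure \<Omega>" using x Omega_closure by blast
  note p1 = grad_less_1[OF x']
  obtain q \<kappa> where q: "orthonormal_frame q" "\<And>i. Amat u x *v q i = \<kappa> i *\<^sub>R q i"
    "(\<chi> i. \<kappa> i) \<in> Kpos" "f (\<chi> i. \<kappa> i) = \<sigma>" using spectral_curvatures[OF x] by blast
  obtain c where c: "\<And>i. c i > 0" "(\<Sum>i\<in>UNIV. c i * (\<chi> i. \<kappa> i) $ i) = f (\<chi> i. \<kappa> i)"
    "\<And>mu. mu \<in> Kpos \<Longrightarrow> f mu \<le> (\<Sum>i\<in>UNIV. c i * mu $ i)"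
    using supporting_functional[OF F q(3)] by blast
  have ck: "(\<Sum>i\<in>UNIV. c i * \<kappa> i) = \<sigma>" using c(2) q(4) by simp
  define e where "e = (\<lambda>i. gam u x *v q i)"
  \<comment> \<open>The supporting functional is tested at (1, ..., 1), where f = 1 by (F6).\<close>
  have "1 \<le> (\<Sum>i\<in>UNIV. c i)" using c(3)[of "\<chi> i. 1"] F_one[OF F] by (simp add: Kpos_def)
  moreover have "mform u x (e i) v = wfun u x * \<kappa> i * gform u x (e i) v" for i v
    unfolding e_def by (rule eigenvector_mform[OF x' q(2)])
  moreover have "norm (e i) \<le> 1 / wfun u x" for i
    using norm_gam_le[OF p1, of "q i"] orthonormal_frameD(3)[OF q(1)] by (simp add: e_def)
  moreover have "gform u x (e i) (e j) = (if i = j then 1 else 0)" for i j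
    using q(1) by (simp add: e_def gform_gam[OF p1] orthonormal_frame_def)
  moreover have "\<kappa> i > 0" for i using q(3) by (simp add: Kpos_def)
  moreover have "(\<Sum>i\<in>UNIV. c i * (u x * (e i \<bullet> (thd u x a *v e i)) + (a \<bullet> grad u x) * (e i \<bullet> (hess u x *v e i))))
      = \<sigma> / wfun u x * (grad u x \<bullet> (hess u x *v a))
        - 2 * (\<Sum>i\<in>UNIV. c i * (1 - wfun u x * \<kappa> i) * ((hess u x *v a) \<bullet> e i) * (grad u x \<bullet> e i))" for a
    unfolding e_def by (rule linearized_equation[OF x q(1,2) ck]) (rule c(3))
  ultimately have fr: "curvature_frame x e \<kappa> c"
    unfolding curvature_frame_def using c(1) q(4) ck by simp
  have ex: "v = (\<Sum>i\<in>UNIV. gform u x (e i) v *\<^sub>R e i)" for v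
  proof -
    obtain v' where v': "v = gam u x *v v'" using gam_surj[OF p1] .
    have "gam u x *v v' = gam u x *v (\<Sum>i\<in>UNIV. (q i \<bullet> v') *\<^sub>R q i)"
      using orthonormal_frame_expand[OF q(1), of v'] by simp
    also have "\<dots> = (\<Sum>i\<in>UNIV. (q i \<bullet> v') *\<^sub>R e i)"
      by (simp add: e_def matrix_vector_mult_scaleR
          linear_sum[OF matrix_vector_mul_linear, of "gam u x"])
    finally have "v = (\<Sum>i\<in>UNIV. (q i \<bullet> v') *\<^sub>R e i)" using v' by simp
    moreover have g: "gform u x (e i) v = q i \<bullet> v'" for i by (simp add: v' e_def gform_gam[OF p1])
    ultimately show ?thesis by (simp only: g)
  qed
  show thesis using that[OF fr ex] .
qed

end

section \<open>Comparison with umbilic hypersurfaces\<close>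

lemma second_derivative_local_min:
  fixes h h' :: "real \<Rightarrow> real"
  assumes r: "r > 0" and dh: "\<And>t. \<bar>t\<bar> < r \<Longrightarrow> (h has_real_derivative h' t) (at t)"
    and dh': "(h' has_real_derivative D) (at 0)"
    and min: "\<And>t. \<bar>t\<bar> < r \<Longrightarrow> h 0 \<le> h t"
  shows "h' 0 = 0" "0 \<le> D"
proof -
  show 0: "h' 0 = 0"
    using DERIV_local_min[OF dh[of 0] r] min r by auto
  show "0 \<le> D"
  proof (rule ccontr)
    assume "\<not> 0 \<le> D"
    then obtain d where d: "d > 0" "\<And>t. 0 < t \<Longrightarrow> t < d \<Longrightarrow> h' t < h' 0"
      using DERIV_neg_dec_right[OF dh'] by (auto simp: not_le)
    define s where "s = min d r / 2"
    have s: "0 < s" "s < d" "s < r" using d r by (auto simp: s_def)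
    obtain z where z: "0 < z" "z < s" "h s - h 0 = (s - 0) * h' z"
      using MVT2[OF s(1), of h h'] dh s by (metis abs_of_nonneg order.strict_trans1)
    have "h' z < 0" using d(2)[of z] z s 0 by simp
    then have "h s < h 0" using z s by (smt (verit) mult_pos_neg)
    then show False using min[of s] s by simp
  qed
qed

context steady_state_graph
begin

lemma u_line: "x + t *\<^sub>R a \<in> closure \<Omega> \<Longrightarrow>
    ((\<lambda>t. u (x + t *\<^sub>R a)) has_real_derivative a \<bullet> grad u (x + t *\<^sub>R a)) (at t)"
  unfolding has_real_derivative_iff_has_vector_derivative
  by (rule has_derivative_line[OF u_has_derivative])

lemma grad_line: "x + t *\<^sub>R a \<in> closure \<Omega> \<Longrightarrow>
    ((\<lambda>t. grad u (x + t *\<^sub>R a)) has_vector_derivative hess u (x + t *\<^sub>R a) *v a) (at t)"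
  by (rule has_derivative_line[OF grad_has_derivative'])

lemma hess_line: "x + t *\<^sub>R a \<in> closure \<Omega> \<Longrightarrow>
    ((\<lambda>t. hess u (x + t *\<^sub>R a)) has_vector_derivative thd u (x + t *\<^sub>R a) a) (at t)"
  by (rule has_derivative_line[OF hess_has_derivative'])

lemma grad_inner_line:
  assumes "x + t *\<^sub>R a \<in> closure \<Omega>"
  shows "((\<lambda>t. b \<bullet> grad u (x + t *\<^sub>R a)) has_real_derivative b \<bullet> (hess u (x + t *\<^sub>R a) *v a)) (at t)"
  using has_real_derivative_inner[OF has_vector_derivative_const grad_line[OF assms]] by simp

text \<open>Up to the constant \<beta>^2 the minimized function is |y - a|^2 - (u - \<beta>)^2, so
  the graph touches a hyperboloid centered at (a, \<beta>) from one side. The second-order condition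
  is multiplied by u so that it involves only \<open>gform\<close> and \<open>mform\<close>.\<close>

lemma touching:
  assumes z: "z \<in> \<Omega>" and r: "r > 0"
    and min: "\<And>y. y \<in> \<Omega> \<Longrightarrow> dist y z < r \<Longrightarrow>
      (norm (z - a))\<^sup>2 - (u z)\<^sup>2 + 2 * \<beta> * u z \<le> (norm (y - a))\<^sup>2 - (u y)\<^sup>2 + 2 * \<beta> * u y"
  shows "z - a = (u z - \<beta>) *\<^sub>R grad u z"
    and "\<beta> * gform u z e e + (u z - \<beta>) * mform u z e e \<ge> 0"
proof -
  have z': "z \<in> closure \<Omega>" using z Omega_closure by blast
  have both: "(z - a) \<bullet> e - (u z - \<beta>) * (e \<bullet> grad u z) = 0 \<and>
     0 \<le> 2 * (e \<bullet> e) - 2 * ((u z - \<beta>) * (e \<bullet> (hess u z *v e)) + (e \<bullet> grad u z) * (e \<bullet> grad u z))" for e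
  proof -
    have "open (\<Omega> \<inter> ball z r)" "z \<in> \<Omega> \<inter> ball z r" using open_domain z r by auto
    then obtain s where s: "s > 0" "\<And>t. \<bar>t\<bar> < s \<Longrightarrow> z + t *\<^sub>R e \<in> \<Omega> \<inter> ball z r"
      using open_contains_line by blast
    let ?G = "\<lambda>y. (norm (y - a))\<^sup>2 - (u y)\<^sup>2 + 2 * \<beta> * u y"
    define h where "h = (\<lambda>t. ?G (z + t *\<^sub>R e))"
    define h' where "h' = (\<lambda>t. 2 * ((z - a) \<bullet> e + t * (e \<bullet> e) - (u (z + t *\<^sub>R e) - \<beta>) * (e \<bullet> grad u (z + t *\<^sub>R e))))"
    have dh: "(h has_real_derivative h' t) (at t)" if "\<bar>t\<bar> < s" for t
    proof -
      have cl: "z + t *\<^sub>R e \<in> closure \<Omega>" using s(2)[OF that] Omega_closure by blast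
      have 1: "((\<lambda>t. (norm (z + t *\<^sub>R e - a))\<^sup>2) has_real_derivative 2 * ((z - a) \<bullet> e + t * (e \<bullet> e))) (at t)"
      proof -
        have "(\<lambda>t. (norm (z + t *\<^sub>R e - a))\<^sup>2) = (\<lambda>t. (z - a) \<bullet> (z - a) + 2 * t * ((z - a) \<bullet> e) + t\<^sup>2 * (e \<bullet> e))"
          unfolding power2_norm_eq_inner
          by (rule ext) (simp add: inner_simps inner_commute algebra_simps power2_eq_square)
        then show ?thesis by (auto intro!: derivative_eq_intros)
      qed
      show ?thesis
        unfolding h_def h'_def
        by (rule derivative_eq_intros refl 1 u_line[OF cl])+ (simp add: algebra_simps)
    qed
    have dh': "(h' has_real_derivative (2 * (e \<bullet> e) - 2 * ((u z - \<beta>) * (e \<bullet> (hess u z *v e)) + (e \<bullet> grad u z) * (e \<bullet> grad u z)))) (at 0)"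
    proof -
      have cl: "z + 0 *\<^sub>R e \<in> closure \<Omega>" using z' by simp
      show ?thesis
        unfolding h'_def
        by (rule derivative_eq_intros refl u_line[OF cl] grad_inner_line[OF cl])+ (simp add: algebra_simps)
    qed
    have mn: "h 0 \<le> h t" if "\<bar>t\<bar> < s" for t
      unfolding h_def using min[of "z + t *\<^sub>R e"] s(2)[OF that] by (auto simp: dist_commute)
    show ?thesis
      using second_derivative_local_min[OF s(1) dh dh' mn] by (simp add: h'_def)
  qed
  show "z - a = (u z - \<beta>) *\<^sub>R grad u z"
  proof (rule vector_eq_rdot[THEN iffD1], rule allI)
    fix e show "(z - a) \<bullet> e = ((u z - \<beta>) *\<^sub>R grad u z) \<bullet> e"
      using both[of e] by (simp add: inner_commute)
  qed
  have u: "u z > 0" using u_pos[OF z'] .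
  have "0 \<le> (e \<bullet> e) - ((u z - \<beta>) * (e \<bullet> (hess u z *v e)) + (e \<bullet> grad u z) * (e \<bullet> grad u z))"
    using both[of e] by simp
  then have "0 \<le> u z * ((e \<bullet> e) - ((u z - \<beta>) * (e \<bullet> (hess u z *v e)) + (e \<bullet> grad u z) * (e \<bullet> grad u z)))"
    using u by simp
  then show "\<beta> * gform u z e e + (u z - \<beta>) * mform u z e e \<ge> 0"
    by (simp add: mform_def gform_def inner_commute[of "grad u z"] algebra_simps)
qed

lemma curvature_frame_ex: "x \<in> \<Omega> \<Longrightarrow> \<exists>e \<kappa> c. curvature_frame x e \<kappa> c"
  by (rule curvature_frame_exists) auto

lemma curvature_frameD:
  assumes "curvature_frame x e \<kappa> c"
  shows "gform u x (e i) (e i) = 1" "mform u x (e i) (e i) = wfun u x * \<kappa> i"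
    "mform u x (e i) v = wfun u x * \<kappa> i * gform u x (e i) v"
    "norm (e i) \<le> 1 / wfun u x" "\<kappa> i > 0" "c i > 0" "f (\<chi> i. \<kappa> i) = \<sigma>"
    "(\<Sum>i\<in>UNIV. c i * \<kappa> i) = \<sigma>" "1 \<le> (\<Sum>i\<in>UNIV. c i)"
    "(\<Sum>i\<in>UNIV. c i * (u x * (e i \<bullet> (thd u x a *v e i)) + (a \<bullet> grad u x) * (e i \<bullet> (hess u x *v e i))))
      = \<sigma> / wfun u x * (grad u x \<bullet> (hess u x *v a))
        - 2 * (\<Sum>i\<in>UNIV. c i * (1 - wfun u x * \<kappa> i) * ((hess u x *v a) \<bullet> e i) * (grad u x \<bullet> e i))"
  using assms unfolding curvature_frame_def by auto

lemma sigma_le: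
  assumes "curvature_frame x e \<kappa> c" "\<And>i. \<kappa> i \<le> b"
  shows "\<sigma> \<le> b"
  using F_le[OF F, of "\<chi> i. \<kappa> i" b] curvature_frameD(5,7)[OF assms(1)] assms(2)
  by (simp add: Kpos_def)

lemma sigma_ge:
  assumes "curvature_frame x e \<kappa> c" "\<And>i. b \<le> \<kappa> i" "b > 0"
  shows "b \<le> \<sigma>"
  using F_ge[OF F, of "\<chi> i. \<kappa> i" b] curvature_frameD(5,7)[OF assms(1)] assms(2,3)
  by (simp add: Kpos_def)

text \<open>The expansion in the curvature frame is diagonal with entries w \<kappa>_i > 0. Its
  consequence u D^2u \<le> I is the semiconcavity behind the gradient estimate.\<close>

lemma mform_pos_semidef:
  assumes x: "x \<in> \<Omega>"
  shows "mform u x v v \<ge> 0"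
proof -
  obtain e \<kappa> c where fr: "curvature_frame x e \<kappa> c" and ex: "\<And>v. v = (\<Sum>i\<in>UNIV. gform u x (e i) v *\<^sub>R e i)"
    using curvature_frame_exists[OF x] by blast
  have x': "x \<in> closure \<Omega>" using x Omega_closure by blast
  have lin: "linear (\<lambda>a. mform u x a v)"
    by (rule linearI) (simp_all add: mform_def gform_def inner_add_left inner_add_right algebra_simps)
  have "mform u x v v = mform u x (\<Sum>i\<in>UNIV. gform u x (e i) v *\<^sub>R e i) v"
    using ex[of v] by simp
  also have "\<dots> = (\<Sum>i\<in>UNIV. gform u x (e i) v * mform u x (e i) v)"
    by (simp add: linear_sum[OF lin] linear_cmul[OF lin])
  also have "\<dots> = (\<Sum>i\<in>UNIV. wfun u x * \<kappa> i * (gform u x (e i) v)\<^sup>2)"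
    by (simp add: curvature_frameD(3)[OF fr] power2_eq_square ac_simps)
  also have "\<dots> \<ge> 0"
    using w_pos[OF x'] curvature_frameD(5)[OF fr] by (intro sum_nonneg) (simp add: less_imp_le)
  finally show ?thesis .
qed

text \<open>At an interior minimum Du = 0 and D^2u \<ge> 0, so w = 1 and every curvature is at most
  1, which \<open>sigma_le\<close> forbids for \<sigma> > 1.\<close>

lemma u_ge_eps:
  assumes "x \<in> closure \<Omega>"
  shows "\<epsilon> \<le> u x"
proof -
  have "closure \<Omega> \<noteq> {}" using assms by fastforce
  then obtain z where z: "z \<in> closure \<Omega>" "\<And>y. y \<in> closure \<Omega> \<Longrightarrow> u z \<le> u y"
    using continuous_attains_inf[OF compact_closure_domain _ continuous_on_u] by blast
  have "z \<notin> \<Omega>"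
  proof
    assume zO: "z \<in> \<Omega>"
    have both: "e \<bullet> grad u z = 0 \<and> 0 \<le> e \<bullet> (hess u z *v e)" for e
    proof -
      obtain s where s: "s > 0" "\<And>t. \<bar>t\<bar> < s \<Longrightarrow> z + t *\<^sub>R e \<in> \<Omega>"
        using open_contains_line[OF open_domain zO] by blast
      have dh: "((\<lambda>t. u (z + t *\<^sub>R e)) has_real_derivative e \<bullet> grad u (z + t *\<^sub>R e)) (at t)" if "\<bar>t\<bar> < s" for t
        by (rule u_line[OF Omega_closure[OF s(2)[OF that]]])
      have dh': "((\<lambda>t. e \<bullet> grad u (z + t *\<^sub>R e)) has_real_derivative e \<bullet> (hess u z *v e)) (at 0)"
        using grad_inner_line[of z 0 e e] z(1) by simp
      show ?thesis
        using second_derivative_local_min[OF s(1) dh dh'] z(2) s(2) Omega_closure by simp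
    qed
    have g0: "grad u z = 0" using both[of "grad u z"] by simp
    have w1: "wfun u z = 1" by (simp add: wfun_def g0)
    obtain e \<kappa> c where fr: "curvature_frame z e \<kappa> c"
      using curvature_frame_ex[OF zO] by blast
    have "\<kappa> i \<le> 1" for i
      using curvature_frameD(1,2)[OF fr, of i] both[of "e i"]
        mult_nonneg_nonneg[OF less_imp_le[OF u_pos[OF z(1)]], of "e i \<bullet> (hess u z *v e i)"]
      by (simp add: w1 mform_def)
    then show False using sigma_le[OF fr] sigma by fastforce
  qed
  then have "u z = \<epsilon>" using closure_cases[OF z(1)] u_boundary by blast
  then show ?thesis using z(2)[OF assms] by simp
qed

text \<open>The graph is tangent to a hyperboloid of radius R, so w at the contact point is R / |k|.
  This turns the inequality of \<open>touching\<close> into a comparison of each curvature with that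
  of the hyperboloid.\<close>

lemma slope_identity:
  assumes x: "x \<in> closure \<Omega>" and "x - a = k *\<^sub>R grad u x" "k > 0 \<or> k < 0" "R > 0" "k\<^sup>2 = R\<^sup>2 + (norm (x - a))\<^sup>2"
  shows "\<bar>k\<bar> * wfun u x = R"
proof -
  have "(\<bar>k\<bar> * wfun u x)\<^sup>2 = k\<^sup>2 - k\<^sup>2 * (norm (grad u x))\<^sup>2"
    by (simp add: power_mult_distrib wfun_square[OF grad_less_1[OF x]] algebra_simps)
  also have "k\<^sup>2 * (norm (grad u x))\<^sup>2 = (norm (x - a))\<^sup>2"
    unfolding assms(2) by (simp add: power_mult_distrib)
  also have "k\<^sup>2 - (norm (x - a))\<^sup>2 = R\<^sup>2" using assms(5) by simp
  finally show ?thesis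
    by (rule power2_eq_imp_eq) (use assms(4) less_imp_le[OF w_pos[OF x]] in simp_all)
qed

text \<open>Comparison with the umbilic cap \<open>\<sigma>R - \<surd>(R\<^sup>2 + \<bar>z - a\<bar>\<^sup>2)\<close> over an interior ball.\<close>

lemma lower_barrier:
  assumes r: "r > 0" and b: "ball a r \<subseteq> \<Omega>" and R: "R > 0" and Rr: "\<sigma> * R \<le> \<epsilon> + sqrt (R\<^sup>2 + r\<^sup>2)"
    and x: "x \<in> cball a r"
  shows "\<sigma> * R \<le> u x + sqrt (R\<^sup>2 + (norm (x - a))\<^sup>2)"
proof -
  let ?Q = "\<lambda>x. sqrt (R\<^sup>2 + (norm (x - a))\<^sup>2)"
  have Q2: "(?Q y)\<^sup>2 = R\<^sup>2 + (norm (y - a))\<^sup>2" for y by simp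
  have Qpos: "?Q y > 0" for y using R by (simp add: add_pos_nonneg)
  have cb: "cball a r \<subseteq> closure \<Omega>"
    using closure_mono[OF b] r by (simp add: closure_ball)
  have "continuous_on (cball a r) (\<lambda>x. u x + ?Q x)"
    by (intro continuous_intros continuous_on_subset[OF continuous_on_u cb])
  moreover have "cball a r \<noteq> {}" using r by simp
  ultimately have "\<exists>z\<in>cball a r. \<forall>y\<in>cball a r. u z + ?Q z \<le> u y + ?Q y"
    using continuous_attains_inf[OF compact_cball] by blast
  then obtain z where z: "z \<in> cball a r" "\<And>y. y \<in> cball a r \<Longrightarrow> u z + ?Q z \<le> u y + ?Q y" by blast
  define c where "c = u z + ?Q z"
  have "\<sigma> * R \<le> c"
  proof (cases "dist a z = r")
    case True
    then have "norm (z - a) = r" by (simp add: dist_norm norm_minus_commute)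
    then show ?thesis using Rr u_ge_eps[of z] cb z(1) by (auto simp: c_def)
  next
    case False
    then have zb: "z \<in> ball a r" using z(1) by simp
    then have zO: "z \<in> \<Omega>" using b by blast
    have z': "z \<in> closure \<Omega>" using zO Omega_closure by blast
    \<comment> \<open>\<open>touching\<close> compares squares, while minimality only gives c - u
      \<le> Q; the opposite bound - Q \<le> c - u holds near z by continuity.\<close>
    have "isCont (\<lambda>y. c + ?Q y - u y) z"
      by (intro continuous_intros) (use u_has_derivative[OF z'] has_derivative_continuous in blast)
    moreover have "c + ?Q z - u z > 0" using Qpos[of z] by (simp add: c_def)
    ultimately obtain d where d: "d > 0" "\<And>y. dist y z < d \<Longrightarrow> c + ?Q y - u y > 0"
      unfolding continuous_at_eps_delta by (smt (verit) dist_real_def)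
    define d' where "d' = min d (r - dist a z)"
    have d': "d' > 0" using d zb by (simp add: d'_def)
    have min: "(norm (z - a))\<^sup>2 - (u z)\<^sup>2 + 2 * c * u z \<le> (norm (y - a))\<^sup>2 - (u y)\<^sup>2 + 2 * c * u y"
      if "dist y z < d'" for y
    proof -
      have "dist a y < r" using that dist_triangle[of a y z] by (simp add: d'_def dist_commute)
      then have "c - u y \<le> ?Q y" using z(2)[of y] by (simp add: c_def)
      moreover have "- ?Q y \<le> c - u y" using d(2)[of y] that by (simp add: d'_def)
      ultimately have "(c - u y)\<^sup>2 \<le> (?Q y)\<^sup>2" using Qpos[of y]
        by (metis abs_le_iff abs_le_square_iff abs_of_pos minus_le_iff)
      moreover have "(c - u z)\<^sup>2 = (?Q z)\<^sup>2" by (simp add: c_def)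
      ultimately show ?thesis unfolding Q2 by (simp add: power2_eq_square algebra_simps)
    qed
    note t = touching[OF zO d' min]
    obtain e \<kappa> k where fr: "curvature_frame z e \<kappa> k"
      using curvature_frame_ex[OF zO] by blast
    have "\<bar>u z - c\<bar> * wfun u z = R"
      by (rule slope_identity[OF z' t(1) _ R]) (use Qpos[of z] in \<open>auto simp: c_def\<close>)
    then have QR: "(c - u z) * wfun u z = R" using Qpos[of z] by (simp add: c_def)
    have "\<kappa> i \<le> c / R" for i
    proof -
      have "(c - u z) * wfun u z * \<kappa> i \<le> c"
        using t(2)[of "e i"] curvature_frameD(1,2)[OF fr, of i] by (simp add: algebra_simps)
      then show ?thesis using R unfolding QR by (simp add: field_simps)
    qed
    from sigma_le[OF fr this] show ?thesis using R by (simp add: field_simps)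
  qed
  then show ?thesis using z(2)[OF x] by (simp add: c_def)
qed

section \<open>Growth of u away from the boundary\<close>

lemma frontier_segment:
  assumes "z \<in> closure \<Omega>" "y \<notin> \<Omega>"
  obtains x' where "x' \<in> frontier \<Omega>" "x' \<in> closed_segment z y"
proof (cases "z \<in> \<Omega>")
  case True
  have "closed_segment z y \<inter> frontier \<Omega> \<noteq> {}"
    by (rule connected_Int_frontier[OF connected_segment(1)]) (use True assms in auto)
  then show thesis using that by blast
next
  case False
  then show thesis using that[of z] closure_cases[OF assms(1)] by auto
qed

lemma nearest_boundary_point:
  assumes z: "z \<in> \<Omega>"
  obtains x' where "x' \<in> frontier \<Omega>" "ball z (dist z x') \<subseteq> \<Omega>" "\<And>y. y \<in> frontier \<Omega> \<Longrightarrow> dist z x' \<le> dist z y"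
proof -
  have "\<Omega> \<noteq> UNIV" using bounded_domain not_bounded_UNIV by blast
  then obtain y0 where "y0 \<notin> \<Omega>" by blast
  then obtain x0 where x0: "x0 \<in> frontier \<Omega>"
    using frontier_segment[OF Omega_closure[OF z]] by blast
  have cl: "closed (frontier \<Omega>)" by (rule frontier_closed)
  obtain x' where x': "x' \<in> frontier \<Omega>" "\<And>y. y \<in> frontier \<Omega> \<Longrightarrow> dist z x' \<le> dist z y"
    using distance_attains_inf[OF cl, of z] x0 by blast
  have "ball z (dist z x') \<subseteq> \<Omega>"
  proof
    fix v assume v: "v \<in> ball z (dist z x')"
    show "v \<in> \<Omega>"
    proof (rule ccontr)
      assume "v \<notin> \<Omega>"
      then obtain y where y: "y \<in> frontier \<Omega>" "y \<in> closed_segment z v"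
        using frontier_segment[OF Omega_closure[OF z]] by blast
      have "dist z y \<le> dist z v" using y(2) segment_bound(1)[of y z v] by (simp add: dist_norm norm_minus_commute)
      then show False using x'(2)[OF y(1)] v by simp
    qed
  qed
  then show thesis using that x' by blast
qed

text \<open>The bound |Du| < 1 is integrated along the segment to the nearest boundary point, which
  stays in the closure; the segment to y itself may leave it.\<close>

lemma u_le_dist_frontier:
  assumes z: "z \<in> closure \<Omega>" and y: "y \<in> frontier \<Omega>"
  shows "u z \<le> \<epsilon> + dist z y"
proof (cases "z \<in> \<Omega>")
  case False
  then show ?thesis using closure_cases[OF z] u_boundary by auto
next
  case True
  obtain x' where x': "x' \<in> frontier \<Omega>" "ball z (dist z x') \<subseteq> \<Omega>" "dist z x' \<le> dist z y"
    using nearest_boundary_point[OF True] y by metis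
  have "dist z x' > 0" using x'(1) True open_domain by (auto simp: frontier_def interior_open)
  then have "cball z (dist z x') \<subseteq> closure \<Omega>" using closure_mono[OF x'(2)] by (simp add: closure_ball)
  then have seg: "closed_segment z x' \<subseteq> closure \<Omega>"
    by (meson closed_segment_subset convex_cball dual_order.trans mem_cball centre_in_cball order_refl zero_le_dist)
  have "norm (u x' - u z) \<le> 1 * norm (x' - z)"
  proof (rule differentiable_bound[OF convex_closed_segment[of z x']])
    fix v assume v: "v \<in> closed_segment z x'"
    then have v': "v \<in> closure \<Omega>" using seg by blast
    show "(u has_derivative (\<lambda>h. h \<bullet> grad u v)) (at v within closed_segment z x')"
      using u_has_derivative[OF v'] has_derivative_at_withinI by blast
    have "norm (h \<bullet> grad u v) \<le> 1 * norm h" for h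
    proof -
      have "norm (h \<bullet> grad u v) \<le> norm h * norm (grad u v)" by (simp add: Cauchy_Schwarz_ineq2)
      also have "\<dots> \<le> norm h * 1" using grad_less_1[OF v'] by (intro mult_left_mono) auto
      finally show ?thesis by simp
    qed
    then show "onorm (\<lambda>h. h \<bullet> grad u v) \<le> 1" by (intro onorm_bound) auto
  qed auto
  then have "u z \<le> u x' + dist z x'" by (simp add: dist_norm norm_minus_commute)
  then show ?thesis using u_boundary[OF x'(1)] x'(3) by simp
qed

lemma exterior_ball_closure:
  assumes "ball y r \<inter> \<Omega> = {}" "z \<in> closure \<Omega>"
  shows "r \<le> norm (z - y)"
proof -
  have "closure \<Omega> \<inter> ball y r = {}"
    using assms(1) open_Int_closure_eq_empty[of "ball y r" \<Omega>] by auto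
  then show ?thesis using assms(2) by (auto simp: dist_norm norm_minus_commute)
qed

text \<open>The segment from z to the center y meets the boundary at a point whose distance from y
  is at least r, hence whose distance from z is at most |z - y| - r.\<close>

lemma u_le_exterior_cone:
  assumes b: "ball y r \<inter> \<Omega> = {}" and r: "r > 0" and z: "z \<in> closure \<Omega>"
  shows "u z \<le> \<epsilon> + norm (z - y) - r"
proof -
  have "y \<notin> \<Omega>" using b r by (metis IntI centre_in_ball empty_iff)
  then obtain x' where x': "x' \<in> frontier \<Omega>" "x' \<in> closed_segment z y"
    using frontier_segment[OF z] by blast
  have "dist z x' + dist x' y = dist z y"
    using x'(2) by (metis between_mem_segment between)
  moreover have "r \<le> norm (x' - y)" using exterior_ball_closure[OF b] x'(1) frontier_closure by blast
  ultimately show ?thesis using u_le_dist_frontier[OF z x'(1)] by (simp add: dist_norm)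
qed

text \<open>Comparison with the umbilic graphs \<open>\<surd>(R\<^sup>2 + \<bar>z - y\<bar>\<^sup>2) - sR\<close> of curvature \<open>s > \<sigma>\<close>: these are related
  by dilations, so \<open>u\<close> is trapped below by decreasing the dilation parameter \<open>R\<close>.\<close>

lemma upper_barrier_strict:
  assumes b: "ball y r \<inter> \<Omega> = {}" and r: "r > \<epsilon>" and R: "R > 0" and s: "s > \<sigma>"
    and Rr: "(\<epsilon> + s * R)\<^sup>2 \<le> R\<^sup>2 + r\<^sup>2" and x: "x \<in> closure \<Omega>"
  shows "(u x + s * R)\<^sup>2 \<le> R\<^sup>2 + (norm (x - y))\<^sup>2"
proof -
  define a where "a = s\<^sup>2 - 1"
  have s1: "s > 1" using s sigma by simp
  have a: "a > 0" using s1 by (simp add: a_def one_less_power)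
  \<comment> \<open>\<rho> z is the larger root T of (u z + s T)^2 = T^2 + |z - y|^2, that is, the
    dilation parameter of the umbilic graph through (z, u z).\<close>
  define \<rho> where "\<rho> = (\<lambda>z. (sqrt ((u z)\<^sup>2 + a * (norm (z - y))\<^sup>2) - s * u z) / a)"
  have ge: "(u z + s * T)\<^sup>2 \<le> T\<^sup>2 + (norm (z - y))\<^sup>2 \<longleftrightarrow> T \<le> \<rho> z" if T: "T \<ge> 0" and z: "z \<in> closure \<Omega>" for T z
  proof -
    have "T \<le> \<rho> z \<longleftrightarrow> a * T + s * u z \<le> sqrt ((u z)\<^sup>2 + a * (norm (z - y))\<^sup>2)"
      using a by (simp add: \<rho>_def pos_le_divide_eq) (simp add: algebra_simps)
    also have "\<dots> \<longleftrightarrow> (a * T + s * u z)\<^sup>2 \<le> (u z)\<^sup>2 + a * (norm (z - y))\<^sup>2"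
    proof
      assume "a * T + s * u z \<le> sqrt ((u z)\<^sup>2 + a * (norm (z - y))\<^sup>2)"
      moreover have "0 \<le> a * T + s * u z" using a T s1 u_pos[OF z] by simp
      ultimately show "(a * T + s * u z)\<^sup>2 \<le> (u z)\<^sup>2 + a * (norm (z - y))\<^sup>2"
        by (intro sqrt_ge_absD) simp
    qed (rule real_le_rsqrt)
    also have "\<dots> \<longleftrightarrow> a * (u z + s * T)\<^sup>2 \<le> a * (T\<^sup>2 + (norm (z - y))\<^sup>2)"
      by (simp add: a_def power2_eq_square algebra_simps)
    also have "\<dots> \<longleftrightarrow> (u z + s * T)\<^sup>2 \<le> T\<^sup>2 + (norm (z - y))\<^sup>2" using a by simp
    finally show ?thesis by simp
  qed
  have eq: "(u z + s * \<rho> z)\<^sup>2 = (\<rho> z)\<^sup>2 + (norm (z - y))\<^sup>2" for z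
  proof -
    have "(a * \<rho> z + s * u z)\<^sup>2 = (u z)\<^sup>2 + a * (norm (z - y))\<^sup>2"
      using a by (simp add: \<rho>_def)
    then have "a * (u z + s * \<rho> z)\<^sup>2 = a * ((\<rho> z)\<^sup>2 + (norm (z - y))\<^sup>2)"
      by (simp add: a_def power2_eq_square algebra_simps)
    then show ?thesis using a by simp
  qed
  have cont: "continuous_on (closure \<Omega>) \<rho>"
    unfolding \<rho>_def using a by (intro continuous_intros continuous_on_u) auto
  have ne: "closure \<Omega> \<noteq> {}" using x by fastforce
  obtain z where z: "z \<in> closure \<Omega>" "\<And>v. v \<in> closure \<Omega> \<Longrightarrow> \<rho> z \<le> \<rho> v"
    using continuous_attains_inf[OF compact_closure_domain ne cont] by blast
  have r0: "r > 0" using r eps by simp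
  \<comment> \<open>Here r > \<epsilon> enters: the exterior cone gives u < |z - y|, which makes the
    root positive.\<close>
  have rho_pos: "\<rho> z > 0"
  proof -
    have "u z < norm (z - y)" using u_le_exterior_cone[OF b r0 z(1)] r by simp
    then have "(u z)\<^sup>2 < (norm (z - y))\<^sup>2" using u_pos[OF z(1)] by (intro power_strict_mono) auto
    then have "(s * u z)\<^sup>2 < (u z)\<^sup>2 + a * (norm (z - y))\<^sup>2"
    proof -
      have "(s * u z)\<^sup>2 = (u z)\<^sup>2 + a * (u z)\<^sup>2" by (simp add: a_def power_mult_distrib algebra_simps)
      then show ?thesis using a \<open>(u z)\<^sup>2 < (norm (z - y))\<^sup>2\<close> by simp
    qed
    then have "s * u z < sqrt ((u z)\<^sup>2 + a * (norm (z - y))\<^sup>2)" by (rule real_less_rsqrt)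
    then show ?thesis using a by (simp add: \<rho>_def)
  qed
  have "R \<le> \<rho> z"
  \<comment> \<open>At a boundary minimum of \<rho> the hypothesis on R applies; at an interior one
    all curvatures would be at least s > \<sigma>.\<close>
  proof (cases "z \<in> \<Omega>")
    case False
    then have "u z = \<epsilon>" using closure_cases[OF z(1)] u_boundary by blast
    moreover have "r\<^sup>2 \<le> (norm (z - y))\<^sup>2"
      using exterior_ball_closure[OF b z(1)] r0 by (intro power_mono) auto
    ultimately show ?thesis using ge[of R z] z(1) R Rr by auto
  next
    case zO: True
    let ?T = "\<rho> z"
    have min: "(norm (z - y))\<^sup>2 - (u z)\<^sup>2 + 2 * (- s * ?T) * u z \<le> (norm (v - y))\<^sup>2 - (u v)\<^sup>2 + 2 * (- s * ?T) * u v"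
      if "v \<in> \<Omega>" for v
    proof -
      have "(u v + s * ?T)\<^sup>2 \<le> ?T\<^sup>2 + (norm (v - y))\<^sup>2"
        using ge[of ?T v] z(2)[of v] that Omega_closure rho_pos by auto
      then show ?thesis using eq[of z] by (simp add: power2_eq_square algebra_simps)
    qed
    note t = touching[OF zO zero_less_one min]
    obtain e \<kappa> k where fr: "curvature_frame z e \<kappa> k"
      using curvature_frame_ex[OF zO] by blast
    have pos: "u z + s * ?T > 0" using u_pos[OF z(1)] s1 rho_pos by (simp add: add_pos_pos)
    have "\<bar>u z - (- s * ?T)\<bar> * wfun u z = ?T"
      by (rule slope_identity[OF z(1) t(1) _ rho_pos]) (use pos eq[of z] in auto)
    then have QR: "(u z + s * ?T) * wfun u z = ?T" using pos by simp
    have "s \<le> \<kappa> i" for i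
    proof -
      have "s * ?T \<le> (u z + s * ?T) * wfun u z * \<kappa> i"
        using t(2)[of "e i"] curvature_frameD(1,2)[OF fr, of i] by (simp add: algebra_simps)
      then show ?thesis using QR rho_pos by simp
    qed
    from sigma_ge[OF fr this] s s1 show ?thesis by simp
  qed
  then have "R \<le> \<rho> x" using z(2)[OF x] by simp
  then show ?thesis using ge[of R x] R x by simp
qed

text \<open>For T < R the boundary inequality is strict, which leaves room for a curvature s >
  \<sigma> in the strict barrier; then T tends to R from below.\<close>

lemma upper_barrier:
  assumes b: "ball y r \<inter> \<Omega> = {}" and r: "r > \<epsilon>" and R: "R > 0"
    and Rr: "(\<epsilon> + \<sigma> * R)\<^sup>2 \<le> R\<^sup>2 + r\<^sup>2" and x: "x \<in> closure \<Omega>"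
  shows "(u x + \<sigma> * R)\<^sup>2 \<le> R\<^sup>2 + (norm (x - y))\<^sup>2"
proof -
  have small: "0 \<le> T\<^sup>2 + (norm (x - y))\<^sup>2 - (u x + \<sigma> * T)\<^sup>2" if T: "0 < T" "T < R" for T
  proof -
    define s where "s = (sqrt (T\<^sup>2 + r\<^sup>2) - \<epsilon>) / T"
    have sT: "\<epsilon> + s * T = sqrt (T\<^sup>2 + r\<^sup>2)" using T by (simp add: s_def)
    have "(\<epsilon> + \<sigma> * T)\<^sup>2 - T\<^sup>2 < (\<epsilon> + \<sigma> * R)\<^sup>2 - R\<^sup>2"
    proof -
      have "(\<sigma>\<^sup>2 - 1) * T\<^sup>2 \<le> (\<sigma>\<^sup>2 - 1) * R\<^sup>2" using sigma T by (intro mult_left_mono power_mono) auto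
      moreover have "2 * \<epsilon> * \<sigma> * T < 2 * \<epsilon> * \<sigma> * R" using T eps sigma by simp
      ultimately show ?thesis by (simp add: power2_eq_square algebra_simps)
    qed
    then have "(\<epsilon> + \<sigma> * T)\<^sup>2 < T\<^sup>2 + r\<^sup>2" using Rr by simp
    then have "\<epsilon> + \<sigma> * T < sqrt (T\<^sup>2 + r\<^sup>2)" by (rule real_less_rsqrt)
    then have s: "s > \<sigma>" using sT T by (smt (verit) mult_less_cancel_right_pos)
    have "(\<epsilon> + s * T)\<^sup>2 \<le> T\<^sup>2 + r\<^sup>2" unfolding sT by simp
    from upper_barrier_strict[OF b r T(1) s this x]
    have "(u x + s * T)\<^sup>2 \<le> T\<^sup>2 + (norm (x - y))\<^sup>2" .
    moreover have "(u x + \<sigma> * T)\<^sup>2 \<le> (u x + s * T)\<^sup>2"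
      using s T sigma u_pos[OF x] by (intro power_mono) auto
    ultimately show ?thesis by simp
  qed
  let ?g = "\<lambda>T. T\<^sup>2 + (norm (x - y))\<^sup>2 - (u x + \<sigma> * T)\<^sup>2"
  have "(?g \<longlongrightarrow> ?g R) (at_left R)" by (intro tendsto_intros)
  moreover have "\<forall>\<^sub>F T in at_left R. 0 \<le> ?g T"
    unfolding eventually_at_left_field using small R by (intro exI[of _ 0]) auto
  ultimately have "0 \<le> ?g R" by (intro tendsto_lowerbound) auto
  then show ?thesis by simp
qed

end

section \<open>The gradient near the boundary\<close>

definition slope :: "real \<Rightarrow> real" where
  "slope \<sigma> = sqrt (\<sigma>\<^sup>2 - 1) / \<sigma>"

lemma slope_bounds:
  assumes "\<sigma> > 1"
  shows "0 < slope \<sigma>" "slope \<sigma> < 1" "(slope \<sigma>)\<^sup>2 = 1 - 1 / \<sigma>\<^sup>2"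
proof -
  have a: "\<sigma>\<^sup>2 - 1 > 0" using assms by (simp add: one_less_power)
  show "0 < slope \<sigma>" using a assms by (simp add: slope_def)
  show s2: "(slope \<sigma>)\<^sup>2 = 1 - 1 / \<sigma>\<^sup>2"
    using a assms by (simp add: slope_def power_divide diff_divide_distrib)
  have "(slope \<sigma>)\<^sup>2 < 1\<^sup>2" unfolding s2 using assms by simp
  then show "slope \<sigma> < 1" by (rule power2_less_imp_less) simp
qed

text \<open>Explicit positive roots \<open>R\<close> of \<open>(\<sigma>R \<mp> \<epsilon>)\<^sup>2 = R\<^sup>2 + r\<^sup>2\<close>.\<close>

lemma barrier_radius:
  fixes \<sigma> \<epsilon> r :: real
  assumes sg: "\<sigma> > 1" and r: "r > 0" and e: "0 < \<epsilon>" "\<epsilon> < r"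
  defines "a \<equiv> \<sigma>\<^sup>2 - 1"
  obtains Rl Ru where "Rl > 0" "\<sigma> * Rl = \<epsilon> + sqrt (Rl\<^sup>2 + r\<^sup>2)" "Rl \<le> r / sqrt a + (\<sigma> + 1) * \<epsilon> / a"
    "Ru > 0" "\<epsilon> + \<sigma> * Ru = sqrt (Ru\<^sup>2 + r\<^sup>2)" "r / sqrt a - (\<sigma> + 1) * \<epsilon> / a \<le> Ru"
proof -
  have a: "a > 0" using sg by (simp add: a_def one_less_power)
  \<comment> \<open>Both equations are quadratic in R, namely a R^2 -/+ 2 \<sigma> \<epsilon> R +
    \<epsilon>^2 - r^2 = 0, with the same discriminant 4 S^2.\<close>
  define S where "S = sqrt (\<epsilon>\<^sup>2 + a * r\<^sup>2)"
  have S2: "S\<^sup>2 = \<epsilon>\<^sup>2 + a * r\<^sup>2" using a by (simp add: S_def)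
  have S_hi: "S \<le> \<epsilon> + sqrt a * r"
  proof -
    have "\<epsilon>\<^sup>2 + a * r\<^sup>2 \<le> (\<epsilon> + sqrt a * r)\<^sup>2"
      using a e r by (simp add: power2_sum power_mult_distrib)
    then show ?thesis unfolding S_def using e r a by (intro real_le_lsqrt) auto
  qed
  have S_lo: "sqrt a * r \<le> S"
    unfolding S_def using a by (intro real_le_rsqrt) (simp add: power_mult_distrib)
  have S_eps: "\<sigma> * \<epsilon> < S"
  proof -
    have "(\<sigma> * \<epsilon>)\<^sup>2 = \<epsilon>\<^sup>2 + a * \<epsilon>\<^sup>2" by (simp add: a_def power_mult_distrib algebra_simps)
    also have "\<dots> < \<epsilon>\<^sup>2 + a * r\<^sup>2" using a e by (simp add: power_strict_mono)
    finally show ?thesis unfolding S_def by (rule real_less_rsqrt)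
  qed
  have S0: "S > 0" using S_eps e sg by (smt (verit) mult_pos_pos)
  define Rl where "Rl = (\<sigma> * \<epsilon> + S) / a"
  define Ru where "Ru = (S - \<sigma> * \<epsilon>) / a"
  have ra: "r / sqrt a = sqrt a * r / a" using a by (simp add: field_simps)
  show thesis
  proof (rule that[of Rl Ru])
    show "Rl > 0" using a e sg S0 by (simp add: Rl_def add_pos_pos)
    show "Ru > 0" using a S_eps by (simp add: Ru_def)
    have l: "\<sigma> * Rl - \<epsilon> = (\<epsilon> + \<sigma> * S) / a"
      using a by (simp add: Rl_def field_simps) (simp add: a_def power2_eq_square algebra_simps)
    have "(\<epsilon> + \<sigma> * S)\<^sup>2 - (\<sigma> * \<epsilon> + S)\<^sup>2 = a * (S\<^sup>2 - \<epsilon>\<^sup>2)"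
      by (simp add: a_def power2_eq_square algebra_simps)
    then have "((\<epsilon> + \<sigma> * S)\<^sup>2 - (\<sigma> * \<epsilon> + S)\<^sup>2) / a\<^sup>2 = r\<^sup>2"
      unfolding S2 using a by (simp add: power2_eq_square)
    then have "(\<sigma> * Rl - \<epsilon>)\<^sup>2 = Rl\<^sup>2 + r\<^sup>2"
      unfolding l unfolding Rl_def power_divide diff_divide_distrib[of "_\<^sup>2"] by simp
    moreover have "\<sigma> * Rl - \<epsilon> \<ge> 0" unfolding l using a e sg S0 by simp
    ultimately show "\<sigma> * Rl = \<epsilon> + sqrt (Rl\<^sup>2 + r\<^sup>2)" by (metis diff_add_cancel add.commute real_sqrt_abs abs_of_nonneg)
    have u: "\<epsilon> + \<sigma> * Ru = (\<sigma> * S - \<epsilon>) / a"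
      using a by (simp add: Ru_def field_simps) (simp add: a_def power2_eq_square algebra_simps)
    have "(\<sigma> * S - \<epsilon>)\<^sup>2 - (S - \<sigma> * \<epsilon>)\<^sup>2 = a * (S\<^sup>2 - \<epsilon>\<^sup>2)"
      by (simp add: a_def power2_eq_square algebra_simps)
    then have "((\<sigma> * S - \<epsilon>)\<^sup>2 - (S - \<sigma> * \<epsilon>)\<^sup>2) / a\<^sup>2 = r\<^sup>2"
      unfolding S2 using a by (simp add: power2_eq_square)
    then have "(\<epsilon> + \<sigma> * Ru)\<^sup>2 = Ru\<^sup>2 + r\<^sup>2"
      unfolding u unfolding Ru_def power_divide diff_divide_distrib[of "_\<^sup>2"] by simp
    moreover have "\<epsilon> + \<sigma> * Ru \<ge> 0" using e sg \<open>Ru > 0\<close> by simp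
    ultimately show "\<epsilon> + \<sigma> * Ru = sqrt (Ru\<^sup>2 + r\<^sup>2)" by (metis real_sqrt_abs abs_of_nonneg)
    show "Rl \<le> r / sqrt a + (\<sigma> + 1) * \<epsilon> / a"
      unfolding ra Rl_def add_divide_distrib[symmetric] using a S_hi
      by (intro divide_right_mono) (auto simp: algebra_simps)
    show "r / sqrt a - (\<sigma> + 1) * \<epsilon> / a \<le> Ru"
      unfolding ra Ru_def diff_divide_distrib[symmetric] using a S_lo e
      by (intro divide_right_mono) (auto simp: algebra_simps)
  qed
qed

context steady_state_graph
begin

text \<open>The quadratic (r^2 - |z - a|^2) / (2 r) and its exterior counterpart agree to first
  order with the distance to the sphere. At a boundary point with balls on both sides, the two
  bounds confine the normal slope of u to within \<tau> of \<open>slope \<sigma>\<close>.\<close>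

definition close_slopes :: "real \<Rightarrow> real \<Rightarrow> bool" where
  "close_slopes r \<tau> \<longleftrightarrow>
    (\<forall>a z. ball a r \<subseteq> \<Omega> \<longrightarrow> z \<in> cball a r \<longrightarrow>
       \<epsilon> + (slope \<sigma> - \<tau>) * ((r\<^sup>2 - (norm (z - a))\<^sup>2) / (2 * r)) \<le> u z) \<and>
    (\<forall>y z. ball y r \<inter> \<Omega> = {} \<longrightarrow> z \<in> closure \<Omega> \<longrightarrow>
       u z \<le> \<epsilon> + (slope \<sigma> + \<tau>) * (((norm (z - y))\<^sup>2 - r\<^sup>2) / (2 * r)))"

lemma sqrt_diff_bounds:
  fixes R s t :: real
  assumes "R > 0" "0 \<le> s" "s \<le> t"
  shows "sqrt (R\<^sup>2 + t\<^sup>2) - sqrt (R\<^sup>2 + s\<^sup>2) = (t\<^sup>2 - s\<^sup>2) / (sqrt (R\<^sup>2 + t\<^sup>2) + sqrt (R\<^sup>2 + s\<^sup>2))"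
    "(t\<^sup>2 - s\<^sup>2) / (2 * sqrt (R\<^sup>2 + t\<^sup>2)) \<le> sqrt (R\<^sup>2 + t\<^sup>2) - sqrt (R\<^sup>2 + s\<^sup>2)"
    "sqrt (R\<^sup>2 + t\<^sup>2) - sqrt (R\<^sup>2 + s\<^sup>2) \<le> (t\<^sup>2 - s\<^sup>2) / (2 * sqrt (R\<^sup>2 + s\<^sup>2))"
proof -
  have p: "sqrt (R\<^sup>2 + t\<^sup>2) > 0" "sqrt (R\<^sup>2 + s\<^sup>2) > 0" using assms(1) by (simp_all add: add_pos_nonneg)
  have st: "s\<^sup>2 \<le> t\<^sup>2" using assms by (intro power_mono)
  have le: "sqrt (R\<^sup>2 + s\<^sup>2) \<le> sqrt (R\<^sup>2 + t\<^sup>2)" using st by simp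
  have "(sqrt (R\<^sup>2 + t\<^sup>2) - sqrt (R\<^sup>2 + s\<^sup>2)) * (sqrt (R\<^sup>2 + t\<^sup>2) + sqrt (R\<^sup>2 + s\<^sup>2)) = t\<^sup>2 - s\<^sup>2"
    by (simp add: algebra_simps flip: power2_eq_square)
  then show eq: "sqrt (R\<^sup>2 + t\<^sup>2) - sqrt (R\<^sup>2 + s\<^sup>2) = (t\<^sup>2 - s\<^sup>2) / (sqrt (R\<^sup>2 + t\<^sup>2) + sqrt (R\<^sup>2 + s\<^sup>2))"
    using add_pos_pos[OF p] by (subst eq_divide_eq) auto
  show "(t\<^sup>2 - s\<^sup>2) / (2 * sqrt (R\<^sup>2 + t\<^sup>2)) \<le> sqrt (R\<^sup>2 + t\<^sup>2) - sqrt (R\<^sup>2 + s\<^sup>2)"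
    unfolding eq using le st by (intro divide_left_mono mult_pos_pos add_pos_pos p) auto
  show "sqrt (R\<^sup>2 + t\<^sup>2) - sqrt (R\<^sup>2 + s\<^sup>2) \<le> (t\<^sup>2 - s\<^sup>2) / (2 * sqrt (R\<^sup>2 + s\<^sup>2))"
    unfolding eq using le st by (intro divide_left_mono mult_pos_pos add_pos_pos p) auto
qed

text \<open>The umbilic barriers meet their sphere with slope r / sqrt (R^2 + r^2). As \<delta>,
  which is proportional to \<epsilon>, tends to 0, the radii tend to r / sqrt (\<sigma>^2 - 1),
  where that slope is exactly \<open>slope \<sigma>\<close>.\<close>

lemma close_slopesI:
  assumes r: "r > 0" and er: "\<epsilon> < r"
    and d: "\<bar>r / sqrt ((r / sqrt (\<sigma>\<^sup>2 - 1) + \<delta>)\<^sup>2 + r\<^sup>2) - slope \<sigma>\<bar> \<le> \<tau>"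
      "\<bar>r / sqrt ((r / sqrt (\<sigma>\<^sup>2 - 1) - \<delta>)\<^sup>2 + r\<^sup>2) - slope \<sigma>\<bar> \<le> \<tau>"
    and del: "\<delta> = (\<sigma> + 1) * \<epsilon> / (\<sigma>\<^sup>2 - 1)" "\<delta> \<le> r / sqrt (\<sigma>\<^sup>2 - 1)"
  shows "close_slopes r \<tau>"
proof -
  obtain Rl Ru where R: "Rl > 0" "\<sigma> * Rl = \<epsilon> + sqrt (Rl\<^sup>2 + r\<^sup>2)" "Rl \<le> r / sqrt (\<sigma>\<^sup>2 - 1) + \<delta>"
    "Ru > 0" "\<epsilon> + \<sigma> * Ru = sqrt (Ru\<^sup>2 + r\<^sup>2)" "r / sqrt (\<sigma>\<^sup>2 - 1) - \<delta> \<le> Ru"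
    using barrier_radius[OF sigma r eps er] del(1) by metis
  have sl: "slope \<sigma> - \<tau> \<le> r / sqrt (Rl\<^sup>2 + r\<^sup>2)"
  proof -
    have "r / sqrt ((r / sqrt (\<sigma>\<^sup>2 - 1) + \<delta>)\<^sup>2 + r\<^sup>2) \<le> r / sqrt (Rl\<^sup>2 + r\<^sup>2)"
      using R(1,3) r by (intro divide_left_mono real_sqrt_le_mono add_right_mono power_mono mult_pos_pos)
        (auto simp: add_nonneg_pos)
    then show ?thesis using d(1) by linarith
  qed
  have su: "r / sqrt (Ru\<^sup>2 + r\<^sup>2) \<le> slope \<sigma> + \<tau>"
  proof -
    have "r / sqrt (Ru\<^sup>2 + r\<^sup>2) \<le> r / sqrt ((r / sqrt (\<sigma>\<^sup>2 - 1) - \<delta>)\<^sup>2 + r\<^sup>2)"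
      using R(4,6) r del(2) by (intro divide_left_mono real_sqrt_le_mono add_right_mono power_mono mult_pos_pos)
        (auto simp: add_nonneg_pos)
    then show ?thesis using d(2) by linarith
  qed
  show ?thesis
    unfolding close_slopes_def
  proof (intro conjI allI impI)
    fix a z assume b: "ball a r \<subseteq> \<Omega>" and z: "z \<in> cball a r"
    have zr: "norm (z - a) \<le> r" using z by (simp add: dist_norm norm_minus_commute)
    have "\<sigma> * Rl \<le> u z + sqrt (Rl\<^sup>2 + (norm (z - a))\<^sup>2)"
      using lower_barrier[OF r b R(1) _ z] R(2) by simp
    then have "\<epsilon> + (sqrt (Rl\<^sup>2 + r\<^sup>2) - sqrt (Rl\<^sup>2 + (norm (z - a))\<^sup>2)) \<le> u z" using R(2) by linarith
    moreover have "(r\<^sup>2 - (norm (z - a))\<^sup>2) / (2 * sqrt (Rl\<^sup>2 + r\<^sup>2)) \<le> sqrt (Rl\<^sup>2 + r\<^sup>2) - sqrt (Rl\<^sup>2 + (norm (z - a))\<^sup>2)"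
      by (rule sqrt_diff_bounds(2)[OF R(1) norm_ge_zero zr])
    moreover have "(slope \<sigma> - \<tau>) * ((r\<^sup>2 - (norm (z - a))\<^sup>2) / (2 * r))
        \<le> r / sqrt (Rl\<^sup>2 + r\<^sup>2) * ((r\<^sup>2 - (norm (z - a))\<^sup>2) / (2 * r))"
      using zr r by (intro mult_right_mono sl) (auto simp: power_mono)
    ultimately show "\<epsilon> + (slope \<sigma> - \<tau>) * ((r\<^sup>2 - (norm (z - a))\<^sup>2) / (2 * r)) \<le> u z"
      using r by simp
  next
    fix y z assume b: "ball y r \<inter> \<Omega> = {}" and z: "z \<in> closure \<Omega>"
    have zr: "r \<le> norm (z - y)" by (rule exterior_ball_closure[OF b z])
    have "(u z + \<sigma> * Ru)\<^sup>2 \<le> Ru\<^sup>2 + (norm (z - y))\<^sup>2"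
      using upper_barrier[OF b er R(4) _ z] R(5) by simp
    then have "u z + \<sigma> * Ru \<le> sqrt (Ru\<^sup>2 + (norm (z - y))\<^sup>2)" by (rule real_le_rsqrt)
    then have "u z \<le> \<epsilon> + (sqrt (Ru\<^sup>2 + (norm (z - y))\<^sup>2) - sqrt (Ru\<^sup>2 + r\<^sup>2))" using R(5) by linarith
    moreover have "sqrt (Ru\<^sup>2 + (norm (z - y))\<^sup>2) - sqrt (Ru\<^sup>2 + r\<^sup>2) \<le> ((norm (z - y))\<^sup>2 - r\<^sup>2) / (2 * sqrt (Ru\<^sup>2 + r\<^sup>2))"
      by (rule sqrt_diff_bounds(3)[OF R(4) _ zr]) (use r in simp)
    moreover have "r / sqrt (Ru\<^sup>2 + r\<^sup>2) * (((norm (z - y))\<^sup>2 - r\<^sup>2) / (2 * r))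
        \<le> (slope \<sigma> + \<tau>) * (((norm (z - y))\<^sup>2 - r\<^sup>2) / (2 * r))"
      using zr r by (intro mult_right_mono su) (auto simp: power_mono)
    ultimately show "u z \<le> \<epsilon> + (slope \<sigma> + \<tau>) * (((norm (z - y))\<^sup>2 - r\<^sup>2) / (2 * r))"
      using r by simp
  qed
qed

section \<open>From closeness of values to closeness of gradients\<close>

lemma hess_upper:
  assumes "x \<in> \<Omega>"
  shows "u x * (v \<bullet> (hess u x *v v)) \<le> (norm v)\<^sup>2"
  using mform_pos_semidef[OF assms, of v] zero_le_square[of "grad u x \<bullet> v"]
  unfolding mform_def gform_def power2_norm_eq_inner by linarith

lemma semiconcave_taylor:
  assumes T: "T > 0" and seg: "\<And>t. 0 \<le> t \<Longrightarrow> t \<le> T \<Longrightarrow> x + t *\<^sub>R v \<in> \<Omega>"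
    and K: "\<And>t. 0 \<le> t \<Longrightarrow> t \<le> T \<Longrightarrow> v \<bullet> (hess u (x + t *\<^sub>R v) *v v) \<le> K"
  shows "u (x + T *\<^sub>R v) \<le> u x + T * (v \<bullet> grad u x) + K * T\<^sup>2 / 2"
proof -
  note cl = Omega_closure[OF seg]
  have 1: "v \<bullet> grad u (x + t *\<^sub>R v) \<le> v \<bullet> grad u x + K * t" if t: "0 \<le> t" "t \<le> T" for t
  proof -
    have "(\<lambda>s. v \<bullet> grad u x + K * s - v \<bullet> grad u (x + s *\<^sub>R v)) 0
        \<le> (\<lambda>s. v \<bullet> grad u x + K * s - v \<bullet> grad u (x + s *\<^sub>R v)) t"
    proof (rule DERIV_nonneg_imp_nondecreasing[OF t(1)])
      fix s assume s: "0 \<le> s" "s \<le> t"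
      have "((\<lambda>s. v \<bullet> grad u x + K * s - v \<bullet> grad u (x + s *\<^sub>R v)) has_real_derivative
          K - v \<bullet> (hess u (x + s *\<^sub>R v) *v v)) (at s)"
        using s t by (auto intro!: derivative_eq_intros grad_inner_line cl)
      then show "\<exists>y. ((\<lambda>s. v \<bullet> grad u x + K * s - v \<bullet> grad u (x + s *\<^sub>R v)) has_real_derivative y) (at s) \<and> 0 \<le> y"
        using K[of s] s t by auto
    qed
    then show ?thesis by simp
  qed
  have "(\<lambda>s. u x + s * (v \<bullet> grad u x) + K * s\<^sup>2 / 2 - u (x + s *\<^sub>R v)) 0
      \<le> (\<lambda>s. u x + s * (v \<bullet> grad u x) + K * s\<^sup>2 / 2 - u (x + s *\<^sub>R v)) T"
  proof (rule DERIV_nonneg_imp_nondecreasing[OF less_imp_le[OF T]])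
    fix s assume s: "0 \<le> s" "s \<le> T"
    have "((\<lambda>s. u x + s * (v \<bullet> grad u x) + K * s\<^sup>2 / 2 - u (x + s *\<^sub>R v)) has_real_derivative
        (v \<bullet> grad u x + K * s - v \<bullet> grad u (x + s *\<^sub>R v))) (at s)"
      using s by (auto intro!: derivative_eq_intros u_line cl)
    then show "\<exists>y. ((\<lambda>s. u x + s * (v \<bullet> grad u x) + K * s\<^sup>2 / 2 - u (x + s *\<^sub>R v)) has_real_derivative y) (at s) \<and> 0 \<le> y"
      using 1[OF s] by (intro exI[of _ "v \<bullet> grad u x + K * s - v \<bullet> grad u (x + s *\<^sub>R v)"]) auto
  qed
  then show ?thesis by simp
qed

text \<open>\<open>C\<^sup>0\<close>-closeness to a linear function and the one-sided bound \<open>u D\<^sup>2u \<le> I\<close> give \<open>C\<^sup>1\<close>-closeness.\<close>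

lemma gradient_close_interior:
  assumes cs: "close_slopes r \<tau>1" and r: "r > 0" and t1: "0 < \<tau>1" "\<tau>1 \<le> slope \<sigma> / 2"
    and t': "0 < \<tau>'" "\<tau>' \<le> 1 / 4" and N: "norm N = 1"
    and inb: "ball (x1 + r *\<^sub>R N) r \<subseteq> \<Omega>" and exb: "ball (x1 - r *\<^sub>R N) r \<inter> \<Omega> = {}"
    and d: "0 < d" "d \<le> r / 2" "d \<le> slope \<sigma> * r / 16"
  defines "x \<equiv> x1 + d *\<^sub>R N"
  shows "norm (grad u x - slope \<sigma> *\<^sub>R N) \<le> \<tau>1 + 2 * \<tau>1 / \<tau>' + 3 * d / (r * \<tau>') + 2 * \<tau>' / slope \<sigma>"
    (is "_ \<le> ?E")
proof (cases "grad u x = slope \<sigma> *\<^sub>R N")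
  case True
  then show ?thesis using t1 t' d r slope_bounds(1)[OF sigma] by (simp add: add_nonneg_nonneg)
next
  case False
  let ?s = "slope \<sigma>"
  note sb = slope_bounds[OF sigma]
  define q where "q = grad u x - ?s *\<^sub>R N"
  \<comment> \<open>v points against the gradient error: moving along v from x, u falls below the
    linear lower bound unless the error is small.\<close>
  define v where "v = - (1 / norm q) *\<^sub>R q"
  have nq: "norm q > 0" using False by (simp add: q_def)
  have nv: "norm v = 1" using nq by (simp add: v_def)
  have vq: "v \<bullet> q = - norm q" using nq by (simp add: v_def power2_norm_eq_inner[symmetric] power2_eq_square)
  have NN: "N \<bullet> N = 1" using N by (simp add: norm_eq_1)
  have vv: "v \<bullet> v = 1" using nv by (simp add: norm_eq_1)
  define n where "n = N \<bullet> v"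
  have n: "\<bar>n\<bar> \<le> 1" using Cauchy_Schwarz_ineq2[of N v] N nv by (simp add: n_def)
  let ?a = "x1 + r *\<^sub>R N"
  \<comment> \<open>The length is proportional to d because u is at least s d / 4 on the segment, so
    \<open>hess_upper\<close> bounds D^2u only by 4 / (s d). After division by T this contributes 2
    \<tau>' / s, and the errors of the two barriers give the remaining terms of
    \<open>?E\<close>.\<close>
  define T where "T = \<tau>' * d"
  have T: "T > 0" "T \<le> d / 4" using t' d by (auto simp: T_def)
  have dist2: "(norm (x + t *\<^sub>R v - ?a))\<^sup>2 = (r - d)\<^sup>2 - 2 * (r - d) * t * n + t\<^sup>2" for t
  proof -
    have "x + t *\<^sub>R v - ?a = t *\<^sub>R v - (r - d) *\<^sub>R N" by (simp add: x_def algebra_simps)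
    then have "(norm (x + t *\<^sub>R v - ?a))\<^sup>2 = (t *\<^sub>R v - (r - d) *\<^sub>R N) \<bullet> (t *\<^sub>R v - (r - d) *\<^sub>R N)"
      by (simp only: power2_norm_eq_inner)
    also have "\<dots> = t * t * (v \<bullet> v) - 2 * (r - d) * t * (N \<bullet> v) + (r - d) * (r - d) * (N \<bullet> N)"
      by (simp add: inner_diff_left inner_diff_right inner_commute[of v N] algebra_simps)
    finally show ?thesis by (simp add: NN vv n_def power2_eq_square)
  qed
  have inball: "x + t *\<^sub>R v \<in> ball ?a r" if t: "0 \<le> t" "t \<le> T" for t
  proof -
    have "x + t *\<^sub>R v - ?a = t *\<^sub>R v - (r - d) *\<^sub>R N" by (simp add: x_def algebra_simps)
    then have "norm (x + t *\<^sub>R v - ?a) = norm (t *\<^sub>R v - (r - d) *\<^sub>R N)" by (rule arg_cong)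
    also have "\<dots> \<le> t + (r - d)"
      using norm_triangle_ineq4[of "t *\<^sub>R v" "(r - d) *\<^sub>R N"] t nv N d by simp
    also have "\<dots> < r" using t T d by linarith
    finally show ?thesis by (simp only: mem_ball dist_norm norm_minus_commute)
  qed
  have low: "\<epsilon> + (?s - \<tau>1) * (d + t * n) - 2 * d\<^sup>2 / r \<le> u (x + t *\<^sub>R v)" if t: "0 \<le> t" "t \<le> T" for t
  proof -
    have "\<epsilon> + (?s - \<tau>1) * ((r\<^sup>2 - (norm (x + t *\<^sub>R v - ?a))\<^sup>2) / (2 * r)) \<le> u (x + t *\<^sub>R v)"
      using cs inb inball[OF t] unfolding close_slopes_def by (metis ball_subset_cball subsetD)
    moreover have "(r\<^sup>2 - (norm (x + t *\<^sub>R v - ?a))\<^sup>2) / (2 * r) = (d + t * n) - (d\<^sup>2 + 2 * d * t * n + t\<^sup>2) / (2 * r)"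
      unfolding dist2 using r by (simp add: field_simps power2_eq_square)
    moreover have "(?s - \<tau>1) * ((d\<^sup>2 + 2 * d * t * n + t\<^sup>2) / (2 * r)) \<le> 2 * d\<^sup>2 / r"
    proof -
      have tn: "d * (t * n) \<le> d * t" using n t d by (intro mult_left_mono) (auto simp: mult_left_le)
      have td: "d * t \<le> d * d" "t * t \<le> d * d" using t T d by (auto intro!: mult_left_mono mult_mono)
      have tn': "- (d * t) \<le> d * (t * n)"
      proof -
        have "t * (-1) \<le> t * n" using n t by (intro mult_left_mono) auto
        then have "d * (t * (-1)) \<le> d * (t * n)" using d by (intro mult_left_mono[of "t * (-1)"]) auto
        then show ?thesis by simp
      qed
      have sq: "0 \<le> (d - t)\<^sup>2" by simp
      have lo: "0 \<le> d\<^sup>2 + 2 * d * t * n + t\<^sup>2" using sq tn' by (simp add: power2_eq_square algebra_simps)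
      have hi: "d\<^sup>2 + 2 * d * t * n + t\<^sup>2 \<le> 4 * d\<^sup>2" using tn td by (simp add: power2_eq_square algebra_simps)
      have "(?s - \<tau>1) * ((d\<^sup>2 + 2 * d * t * n + t\<^sup>2) / (2 * r)) \<le> 1 * (4 * d\<^sup>2 / (2 * r))"
        using sb t1 lo hi r by (intro mult_mono divide_right_mono) auto
      then show ?thesis by simp
    qed
    ultimately show ?thesis by (simp add: right_diff_distrib)
  qed
  have up: "u x \<le> \<epsilon> + (?s + \<tau>1) * d + d\<^sup>2 / r"
  proof -
    have xO: "x \<in> \<Omega>" using inball[of 0] T inb by auto
    have "x - (x1 - r *\<^sub>R N) = (d + r) *\<^sub>R N" by (simp add: x_def algebra_simps)
    then have nx: "norm (x - (x1 - r *\<^sub>R N)) = d + r" using N d r by simp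
    have "u x \<le> \<epsilon> + (?s + \<tau>1) * (((norm (x - (x1 - r *\<^sub>R N)))\<^sup>2 - r\<^sup>2) / (2 * r))"
      using cs exb Omega_closure[OF xO] unfolding close_slopes_def by blast
    also have "((norm (x - (x1 - r *\<^sub>R N)))\<^sup>2 - r\<^sup>2) / (2 * r) = d + d\<^sup>2 / (2 * r)"
      unfolding nx using r by (simp add: field_simps power2_eq_square)
    also have "(?s + \<tau>1) * (d + d\<^sup>2 / (2 * r)) \<le> (?s + \<tau>1) * d + d\<^sup>2 / r"
    proof -
      have "(?s + \<tau>1) * (d\<^sup>2 / (2 * r)) \<le> 2 * (d\<^sup>2 / (2 * r))"
        using sb t1 r by (intro mult_right_mono) auto
      then show ?thesis by (simp add: distrib_left)
    qed
    finally show ?thesis by simp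
  qed
  have ulow: "?s * d / 4 \<le> u (x + t *\<^sub>R v)" if t: "0 \<le> t" "t \<le> T" for t
  proof -
    have "\<bar>t * n\<bar> \<le> t" using n t by (simp add: abs_mult mult_left_le)
    then have "3 * d / 4 \<le> d + t * n" using t T by linarith
    then have "?s / 2 * (3 * d / 4) \<le> (?s - \<tau>1) * (d + t * n)"
      using t1 sb d by (intro mult_mono) auto
    moreover have "2 * d\<^sup>2 / r \<le> ?s * d / 8"
    proof -
      have "d * d \<le> d * (?s * r / 16)" using d by (intro mult_left_mono) auto
      then show ?thesis using r by (simp add: power2_eq_square field_simps)
    qed
    ultimately show ?thesis using low[OF t] eps by linarith
  qed
  have "u (x + T *\<^sub>R v) \<le> u x + T * (v \<bullet> grad u x) + (4 / (?s * d)) * T\<^sup>2 / 2"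
  proof (rule semiconcave_taylor[OF T(1)])
    fix t assume t: "0 \<le> t" "t \<le> T"
    show O: "x + t *\<^sub>R v \<in> \<Omega>" using inball[OF t] inb by blast
    let ?h = "v \<bullet> (hess u (x + t *\<^sub>R v) *v v)"
    have h1: "u (x + t *\<^sub>R v) * ?h \<le> 1" using hess_upper[OF O, of v] nv by simp
    show "?h \<le> 4 / (?s * d)"
    proof (cases "?h \<le> 0")
      case True
      then show ?thesis using sb d by (smt (verit) divide_nonneg_pos mult_pos_pos)
    next
      case False
      then have "?s * d / 4 * ?h \<le> 1" using ulow[OF t] h1 by (smt (verit) mult_right_mono)
      then show ?thesis using sb d by (simp add: field_simps)
    qed
  qed
  moreover have "\<epsilon> + (?s - \<tau>1) * (d + T * n) - 2 * d\<^sup>2 / r \<le> u (x + T *\<^sub>R v)"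
    by (rule low) (use T in auto)
  ultimately have "(?s - \<tau>1) * (d + T * n) - 2 * d\<^sup>2 / r \<le> (?s + \<tau>1) * d + d\<^sup>2 / r + T * (v \<bullet> grad u x) + (2 / (?s * d)) * T\<^sup>2"
    using up by (simp add: field_simps)
  then have "T * (?s * n - v \<bullet> grad u x) \<le> \<tau>1 * (T * n) + 2 * \<tau>1 * d + 3 * d\<^sup>2 / r + (2 / (?s * d)) * T\<^sup>2"
    by (simp add: algebra_simps)
  also have "?s * n - v \<bullet> grad u x = norm q"
    using vq by (simp add: q_def n_def inner_diff_right inner_commute)
  also have "\<tau>1 * (T * n) \<le> \<tau>1 * T" using t1 T n by (intro mult_left_mono) (auto simp: mult_left_le)
  also have "\<tau>1 * T + 2 * \<tau>1 * d + 3 * d\<^sup>2 / r + (2 / (?s * d)) * T\<^sup>2 = T * ?E"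
    using t' d r sb by (simp add: T_def field_simps power2_eq_square)
  finally have "norm q \<le> ?E" using T by simp
  then show ?thesis by (simp add: q_def)
qed

text \<open>The case d = 0 follows by continuity along the normal; the term depending on d is first
  replaced by its value at the largest distance D.\<close>

lemma gradient_close_closure:
  assumes cs: "close_slopes r \<tau>1" and r: "r > 0" and t1: "0 < \<tau>1" "\<tau>1 \<le> slope \<sigma> / 2"
    and t': "0 < \<tau>'" "\<tau>' \<le> 1 / 4" and N: "norm N = 1"
    and inb: "ball (x1 + r *\<^sub>R N) r \<subseteq> \<Omega>" and exb: "ball (x1 - r *\<^sub>R N) r \<inter> \<Omega> = {}"
    and D: "0 < D" "D \<le> r / 2" "D \<le> slope \<sigma> * r / 16"
    and d: "0 \<le> d" "d \<le> D" and x1: "x1 \<in> closure \<Omega>"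
  shows "norm (grad u (x1 + d *\<^sub>R N) - slope \<sigma> *\<^sub>R N) \<le> \<tau>1 + 2 * \<tau>1 / \<tau>' + 3 * D / (r * \<tau>') + 2 * \<tau>' / slope \<sigma>"
    (is "_ \<le> ?E D")
proof -
  have pos: "norm (grad u (x1 + d *\<^sub>R N) - slope \<sigma> *\<^sub>R N) \<le> ?E D" if d: "0 < d" "d \<le> D" for d
  proof -
    have "norm (grad u (x1 + d *\<^sub>R N) - slope \<sigma> *\<^sub>R N) \<le> ?E d"
      by (rule gradient_close_interior[OF cs r t1 t' N inb exb]) (use d D in auto)
    also have "\<dots> \<le> ?E D" using d r t' by (simp add: divide_right_mono)
    finally show ?thesis .
  qed
  show ?thesis
  proof (cases "d = 0")
    case False
    then show ?thesis using pos d by simp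
  next
    case True
    have "isCont (\<lambda>t. norm (grad u (x1 + t *\<^sub>R N) - slope \<sigma> *\<^sub>R N)) 0"
      by (intro continuous_intros)
        (use has_vector_derivative_continuous[OF grad_line[of x1 0 N]] x1 in simp)
    then have "((\<lambda>t. norm (grad u (x1 + t *\<^sub>R N) - slope \<sigma> *\<^sub>R N)) \<longlongrightarrow> norm (grad u (x1 + 0 *\<^sub>R N) - slope \<sigma> *\<^sub>R N)) (at_right 0)"
      unfolding isCont_def by (rule tendsto_mono[rotated]) (simp add: at_le)
    moreover have "\<forall>\<^sub>F t in at_right 0. norm (grad u (x1 + t *\<^sub>R N) - slope \<sigma> *\<^sub>R N) \<le> ?E D"
      unfolding eventually_at_right_field using pos D by (intro exI[of _ D]) auto
    ultimately show ?thesis using True by (intro tendsto_upperbound) auto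
  qed
qed

end

text \<open>The constants are chosen before \<Omega>, \<open>f\<close>, \<epsilon> and u and depend
  on \<sigma>, r and \<tau> only, which is the uniformity in \<epsilon> needed later.\<close>

lemma gradient_close:
  fixes \<sigma> r \<tau> :: real
  assumes sg: "\<sigma> > 1" and r: "r > 0" and t: "\<tau> > 0"
  obtains \<epsilon>1 D where "\<epsilon>1 > 0" "D > 0"
    "\<And>\<Omega> (f :: real^'n::finite \<Rightarrow> real) \<epsilon> u x1 N d. steady_state_graph \<Omega> f \<sigma> \<epsilon> u \<Longrightarrow> \<epsilon> < \<epsilon>1 \<Longrightarrow> norm N = 1 \<Longrightarrow>
      ball (x1 + r *\<^sub>R N) r \<subseteq> \<Omega> \<Longrightarrow> ball (x1 - r *\<^sub>R N) r \<inter> \<Omega> = {} \<Longrightarrow> x1 \<in> closure \<Omega> \<Longrightarrow>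
      0 \<le> d \<Longrightarrow> d \<le> D \<Longrightarrow> norm (grad u (x1 + d *\<^sub>R N) - slope \<sigma> *\<^sub>R N) \<le> \<tau>"
proof -
  let ?s = "slope \<sigma>" and ?a = "\<sigma>\<^sup>2 - 1"
  note sb = slope_bounds[OF sg]
  have a: "?a > 0" using sg by (simp add: one_less_power)
  \<comment> \<open>\<tau>' makes the semiconcavity term at most \<tau> / 4. The barrier errors are
    divided by \<tau>', so the choices of \<open>\<tau>1\<close> and \<open>D\<close> have to
    follow.\<close>
  define \<tau>' where "\<tau>' = min (1 / 4) (\<tau> * ?s / 8)"
  have t': "0 < \<tau>'" "\<tau>' \<le> 1 / 4" "2 * \<tau>' / ?s \<le> \<tau> / 4"
    using t sb by (auto simp: \<tau>'_def field_simps min_def)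
  define \<tau>1 where "\<tau>1 = min (?s / 2) (\<tau> * \<tau>' / 12)"
  have t1: "0 < \<tau>1" "\<tau>1 \<le> ?s / 2" using t t' sb by (auto simp: \<tau>1_def)
  have t1': "\<tau>1 + 2 * \<tau>1 / \<tau>' \<le> \<tau> / 4"
  proof -
    have "\<tau>1 * \<tau>' \<le> \<tau>1 * 1" using t1 t' by (intro mult_left_mono) auto
    then have "\<tau>1 \<le> \<tau>1 / \<tau>'" using t' by (simp add: field_simps)
    moreover have "\<tau>1 / \<tau>' \<le> \<tau> / 12" using t' by (simp add: \<tau>1_def field_simps min_def)
    moreover have "2 * \<tau>1 / \<tau>' = 2 * (\<tau>1 / \<tau>')" by simp
    ultimately show ?thesis by linarith
  qed
  define D where "D = min (r / 2) (min (?s * r / 16) (r * \<tau> * \<tau>' / 12))"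
  have D: "0 < D" "D \<le> r / 2" "D \<le> ?s * r / 16" "3 * D / (r * \<tau>') \<le> \<tau> / 4"
    using r sb t t' by (auto simp: D_def field_simps min_def)
  let ?g = "\<lambda>\<delta>. r / sqrt ((r / sqrt ?a + \<delta>)\<^sup>2 + r\<^sup>2)"
  have g0: "?g 0 = ?s"
  proof -
    have "(r / sqrt ?a)\<^sup>2 + r\<^sup>2 = (r * \<sigma> / sqrt ?a)\<^sup>2"
      using a by (simp add: power_divide power_mult_distrib field_simps)
    then have "sqrt ((r / sqrt ?a + 0)\<^sup>2 + r\<^sup>2) = r * \<sigma> / sqrt ?a" using r sg a by simp
    then show ?thesis using r sg a by (simp add: slope_def)
  qed
  have "isCont ?g 0"
  proof (intro continuous_intros)
    show "sqrt ((r / sqrt ?a + 0)\<^sup>2 + r\<^sup>2) \<noteq> 0" using r by (simp add: add_nonneg_eq_0_iff)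
  qed
  then obtain \<delta>0 where d0: "\<delta>0 > 0" "\<And>\<delta>. \<bar>\<delta>\<bar> < \<delta>0 \<Longrightarrow> \<bar>?g \<delta> - ?s\<bar> < \<tau>1"
    using t1(1) unfolding continuous_at_eps_delta g0 by (metis dist_real_def diff_zero)
  define \<epsilon>1 where "\<epsilon>1 = min r (min (\<delta>0 * ?a / (\<sigma> + 1)) (r / sqrt ?a * ?a / (\<sigma> + 1)))"
  have e1: "\<epsilon>1 > 0" using r d0 a sg by (simp add: \<epsilon>1_def)
  show thesis
  proof (rule that[OF e1 D(1)])
    fix \<Omega> and f :: "real^'n::finite \<Rightarrow> real" and \<epsilon> u x1 N d
    assume sol: "steady_state_graph \<Omega> f \<sigma> \<epsilon> u" and e: "\<epsilon> < \<epsilon>1" and N: "norm N = 1"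
      and b: "ball (x1 + r *\<^sub>R N) r \<subseteq> \<Omega>" "ball (x1 - r *\<^sub>R N) r \<inter> \<Omega> = {}" "x1 \<in> closure \<Omega>"
      and d: "0 \<le> d" "d \<le> D"
    interpret steady_state_graph \<Omega> f \<sigma> \<epsilon> u by (rule sol)
    define \<delta> where "\<delta> = (\<sigma> + 1) * \<epsilon> / ?a"
    have del: "0 < \<delta>" "\<delta> < \<delta>0" "\<delta> \<le> r / sqrt ?a"
    proof -
      have lt: "(\<sigma> + 1) * \<epsilon> / ?a < y" if "\<epsilon> < y * ?a / (\<sigma> + 1)" for y
      proof -
        have "\<epsilon> * (\<sigma> + 1) < y * ?a" using that sg by (subst (asm) pos_less_divide_eq) auto
        then show ?thesis using a by (subst pos_divide_less_eq) (auto simp: mult.commute)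
      qed
      show "0 < \<delta>" unfolding \<delta>_def using eps sg a by (intro divide_pos_pos mult_pos_pos) auto
      show "\<delta> < \<delta>0" unfolding \<delta>_def using e by (intro lt) (simp add: \<epsilon>1_def)
      show "\<delta> \<le> r / sqrt ?a" unfolding \<delta>_def using e by (intro less_imp_le lt) (simp add: \<epsilon>1_def)
    qed
    have cs: "close_slopes r \<tau>1"
      by (rule close_slopesI[OF r _ _ _ \<delta>_def del(3)])
        (use e d0(2)[of \<delta>] d0(2)[of "- \<delta>"] del in \<open>auto simp: \<epsilon>1_def\<close>)
    show "norm (grad u (x1 + d *\<^sub>R N) - slope \<sigma> *\<^sub>R N) \<le> \<tau>"
      using gradient_close_closure[OF cs r t1 t'(1,2) N b(1,2) D(1-3) d b(3)] t1' D(4) t'(3) t by linarith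
  qed
qed

section \<open>Killing fields\<close>

context steady_state_graph
begin

text \<open>Second-order test for the difference of a Killing derivative \<open>\<eta> = X\<cdot>Du\<close> and a multiple of the light-cone
  function \<open>(\<bar>z - y\<bar>\<^sup>2 - (u + \<rho>)\<^sup>2) / (2u)\<close>; all third derivatives cancel by the linearized equation.\<close>

lemma killing_touching:
  fixes B :: "real^'n \<Rightarrow> real^'n" and b y0 z :: "real^'n" and \<rho> :: real
  assumes z: "z \<in> \<Omega>" and B: "linear B" and anti: "\<And>v w. v \<bullet> B w = - (w \<bullet> B v)" and K: "K > 0"
    and fr: "curvature_frame z e \<kappa> c"
  defines "\<eta> \<equiv> \<lambda>y. (b + B y) \<bullet> grad u y"
  defines "Z \<equiv> ((norm (z - y0))\<^sup>2 - (u z + \<rho>)\<^sup>2) / (2 * u z)"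
  defines "\<zeta> \<equiv> z - y0 - (u z + Z + \<rho>) *\<^sub>R grad u z"
  assumes le: "\<And>y. y \<in> \<Omega> \<Longrightarrow> u y * \<eta> y \<le> K * ((norm (y - y0))\<^sup>2 - (u y + \<rho>)\<^sup>2) / 2"
    and eq: "\<eta> z = K * Z"
  shows "\<sigma> / wfun u z * (grad u z \<bullet> \<zeta>)
      + 2 * wfun u z * (\<Sum>i\<in>UNIV. c i * \<kappa> i * ((\<zeta> \<bullet> e i) * (grad u z \<bullet> e i)))
      - u z * wfun u z * \<sigma> + \<rho> * ((\<Sum>i\<in>UNIV. c i) - wfun u z * \<sigma>) \<le> 0"
proof -
  have z': "z \<in> closure \<Omega>" using z Omega_closure by blast
  define X where "X = b + B z"
  define p where "p = grad u z" define H where "H = hess u z" define w where "w = wfun u z"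
  have eta_z: "\<eta> z = X \<bullet> p" by (simp add: \<eta>_def X_def p_def)
  have u0: "u z > 0" using u_pos[OF z'] .
  have Bself: "v \<bullet> B v = 0" for v using anti[of v v] by simp
  \<comment> \<open>First- and second-order conditions in direction d for K (|y - y0|^2 - (u +
    \<rho>)^2) / 2 - u \<eta>, which is nonnegative and vanishes at z.\<close>
  have dir: "u z * (B d \<bullet> p + X \<bullet> (H *v d)) = K * (\<zeta> \<bullet> d) \<and>
    (d \<bullet> (H *v d)) * \<eta> z + 2 * (d \<bullet> p) * (B d \<bullet> p + X \<bullet> (H *v d))
      + u z * (2 * (B d \<bullet> (H *v d)) + X \<bullet> (thd u z d *v d))
      - K * (d \<bullet> d - (d \<bullet> p) * (d \<bullet> p) - (u z + \<rho>) * (d \<bullet> (H *v d))) \<le> 0" for d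
  proof -
    obtain s where s: "s > 0" "\<And>t. \<bar>t\<bar> < s \<Longrightarrow> z + t *\<^sub>R d \<in> \<Omega>"
      using open_contains_line[OF open_domain z] by blast
    let ?P = "\<lambda>t. grad u (z + t *\<^sub>R d)" and ?U = "\<lambda>t. u (z + t *\<^sub>R d)" and ?X = "\<lambda>t. X + t *\<^sub>R B d"
    have Xt: "b + B (z + t *\<^sub>R d) = ?X t" for t
      by (simp add: X_def linear_add[OF B] linear_cmul[OF B])
    define h where "h = (\<lambda>t. K / 2 * ((norm (z + t *\<^sub>R d - y0))\<^sup>2 - (?U t + \<rho>)\<^sup>2) - ?U t * (?X t \<bullet> ?P t))"
    define h' where "h' = (\<lambda>t. K * ((z - y0) \<bullet> d + t * (d \<bullet> d) - (?U t + \<rho>) * (d \<bullet> ?P t))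
        - ((d \<bullet> ?P t) * (?X t \<bullet> ?P t) + ?U t * (B d \<bullet> ?P t + ?X t \<bullet> (hess u (z + t *\<^sub>R d) *v d))))"
    have dX: "(?X has_vector_derivative B d) (at t)" for t
      by (auto intro!: derivative_eq_intros)
    have dXP: "((\<lambda>t. ?X t \<bullet> ?P t) has_real_derivative (?X t \<bullet> (hess u (z + t *\<^sub>R d) *v d) + B d \<bullet> ?P t)) (at t)"
      if "z + t *\<^sub>R d \<in> closure \<Omega>" for t
      by (rule has_real_derivative_inner[OF dX grad_line[OF that]])
    have dh: "(h has_real_derivative h' t) (at t)" if "\<bar>t\<bar> < s" for t
    proof -
      have cl: "z + t *\<^sub>R d \<in> closure \<Omega>" using s(2)[OF that] Omega_closure by blast
      have 1: "((\<lambda>t. (norm (z + t *\<^sub>R d - y0))\<^sup>2) has_real_derivative 2 * ((z - y0) \<bullet> d + t * (d \<bullet> d))) (at t)"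
      proof -
        have "(\<lambda>t. (norm (z + t *\<^sub>R d - y0))\<^sup>2) = (\<lambda>t. (z - y0) \<bullet> (z - y0) + 2 * t * ((z - y0) \<bullet> d) + t\<^sup>2 * (d \<bullet> d))"
          unfolding power2_norm_eq_inner
          by (rule ext) (simp add: inner_simps inner_commute algebra_simps power2_eq_square)
        then show ?thesis by (auto intro!: derivative_eq_intros)
      qed
      have 2: "((\<lambda>t. (?U t + \<rho>)\<^sup>2) has_real_derivative 2 * ((?U t + \<rho>) * (d \<bullet> ?P t))) (at t)"
        by (auto intro!: derivative_eq_intros u_line[OF cl])
      from DERIV_diff[OF DERIV_cmult[OF DERIV_diff[OF 1 2], of "K / 2"] DERIV_mult[OF u_line[OF cl] dXP[OF cl]]]
      show ?thesis
        unfolding h_def h'_def by (rule DERIV_cong) (simp add: algebra_simps)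
    qed
    have cl0: "z + 0 *\<^sub>R d \<in> closure \<Omega>" using z' by simp
    have dH: "((\<lambda>t. hess u (z + t *\<^sub>R d) *v d) has_vector_derivative thd u z d *v d) (at 0)"
      using has_vector_derivative_matrix_vector[OF hess_line[OF cl0] has_vector_derivative_const[of d]] by simp
    have dXH: "((\<lambda>t. ?X t \<bullet> (hess u (z + t *\<^sub>R d) *v d)) has_real_derivative (X \<bullet> (thd u z d *v d) + B d \<bullet> (H *v d))) (at 0)"
      using has_real_derivative_inner[OF dX dH] by (simp add: H_def)
    have dh': "(h' has_real_derivative
        - ((d \<bullet> (H *v d)) * \<eta> z + 2 * (d \<bullet> p) * (B d \<bullet> p + X \<bullet> (H *v d))
      + u z * (2 * (B d \<bullet> (H *v d)) + X \<bullet> (thd u z d *v d))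
      - K * (d \<bullet> d - (d \<bullet> p) * (d \<bullet> p) - (u z + \<rho>) * (d \<bullet> (H *v d))))) (at 0)"
      unfolding h'_def
      by (rule derivative_eq_intros refl u_line[OF cl0] grad_inner_line[OF cl0] dXP[OF cl0] dXH)+
        (simp add: eta_z p_def[symmetric] H_def[symmetric] algebra_simps)
    have mn: "h 0 \<le> h t" if "\<bar>t\<bar> < s" for t
    proof -
      have "0 \<le> h t" using le[OF s(2)[OF that]] by (simp add: h_def \<eta>_def Xt)
      moreover have "h 0 = 0"
        using eq u0 by (simp add: h_def \<eta>_def X_def Z_def)
      ultimately show ?thesis by simp
    qed
    have "h' 0 = 0" and D: "0 \<le> - ((d \<bullet> (H *v d)) * \<eta> z + 2 * (d \<bullet> p) * (B d \<bullet> p + X \<bullet> (H *v d))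
      + u z * (2 * (B d \<bullet> (H *v d)) + X \<bullet> (thd u z d *v d))
      - K * (d \<bullet> d - (d \<bullet> p) * (d \<bullet> p) - (u z + \<rho>) * (d \<bullet> (H *v d))))"
      using second_derivative_local_min[OF s(1) dh dh' mn] by blast+
    then have "K * ((z - y0) \<bullet> d - (u z + \<rho>) * (d \<bullet> p)) = (d \<bullet> p) * \<eta> z + u z * (B d \<bullet> p + X \<bullet> (H *v d))"
      by (simp add: h'_def \<eta>_def X_def p_def H_def)
    then have "u z * (B d \<bullet> p + X \<bullet> (H *v d)) = K * (\<zeta> \<bullet> d)"
      unfolding eq \<zeta>_def by (simp add: inner_diff_left inner_commute[of _ d] p_def[symmetric] algebra_simps)
    then show ?thesis using D by linarith
  qed
  define \<alpha> where "\<alpha> = (\<lambda>i. e i \<bullet> p)" define \<beta> where "\<beta> = (\<lambda>i. B (e i) \<bullet> p)"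
  define \<tau> where "\<tau> = (\<lambda>i. X \<bullet> (H *v e i))" define q where "q = (\<lambda>i. e i \<bullet> (H *v e i))"
  define T where "T = (\<lambda>i. e i \<bullet> (thd u z X *v e i))"
  have g1: "e i \<bullet> e i - \<alpha> i * \<alpha> i = 1" for i
    using curvature_frameD(1)[OF fr, of i] by (simp add: gform_def \<alpha>_def p_def inner_commute)
  have uq: "u z * q i = 1 - w * \<kappa> i" for i
    using curvature_frameD(1,2)[OF fr, of i] by (simp add: mform_def q_def H_def w_def)
  \<comment> \<open>Skew-symmetry removes e_i\<cdot>B e_i, so the eigenvector relation tested with B
    e_i leaves only products of gradient components.\<close>
  have uB: "u z * (B (e i) \<bullet> (H *v e i)) = - ((1 - w * \<kappa> i) * (\<alpha> i * \<beta> i))" for i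
  proof -
    have "gform u z (e i) (B (e i)) = - (\<alpha> i * \<beta> i)"
      by (simp add: gform_def Bself \<alpha>_def \<beta>_def p_def inner_commute)
    moreover have "e i \<bullet> (H *v B (e i)) = B (e i) \<bullet> (H *v e i)" unfolding H_def by (rule hess_dot[OF z'])
    ultimately show ?thesis
      using curvature_frameD(3)[OF fr, of i "B (e i)"]
      by (simp add: mform_def H_def w_def algebra_simps)
  qed
  have TX: "X \<bullet> (thd u z (e i) *v e i) = T i" for i unfolding T_def by (rule thd_sym[OF z'])
  have \<tau>': "(H *v X) \<bullet> e i = \<tau> i" for i
    unfolding \<tau>_def H_def using hess_dot[OF z', of X "e i"] by (simp add: inner_commute)
  have lin: "(\<Sum>i\<in>UNIV. c i * (u z * T i + \<eta> z * q i))
     = \<sigma> / w * (p \<bullet> (H *v X)) - 2 * (\<Sum>i\<in>UNIV. c i * (1 - w * \<kappa> i) * \<tau> i * \<alpha> i)"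
    using curvature_frameD(10)[OF fr, of X]
    by (simp add: T_def q_def p_def[symmetric] H_def[symmetric] w_def[symmetric] \<tau>' \<alpha>_def
        \<eta>_def X_def[symmetric] inner_commute[of p])
  \<comment> \<open>The direction p = Du turns the first-order condition into the very term on the
    right of the linearized equation, since p\<cdot>B p = 0.\<close>
  have pX: "u z * (p \<bullet> (H *v X)) = K * (\<zeta> \<bullet> p)"
    using dir[of p] Bself[of p] hess_dot[OF z', of p X] by (simp add: H_def inner_commute)
  have first: "u z * (\<beta> i + \<tau> i) = K * (\<zeta> \<bullet> e i)" for i
    using dir[of "e i"] by (simp add: \<beta>_def \<tau>_def)
  have each: "(u z * T i + \<eta> z * q i) + 2 * ((1 - w * \<kappa> i) * \<tau> i * \<alpha> i) + 2 * w * (\<kappa> i * \<alpha> i * (\<beta> i + \<tau> i))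
      - K * (w * \<kappa> i) + K * \<rho> * q i \<le> 0" for i
  proof -
    have "q i * \<eta> z + 2 * \<alpha> i * (\<beta> i + \<tau> i) + (2 * (u z * (B (e i) \<bullet> (H *v e i))) + u z * T i)
       - K * (1 - (u z * q i + \<rho> * q i)) \<le> 0"
    proof -
      have "e i \<bullet> e i = 1 + \<alpha> i * \<alpha> i" using g1[of i] by simp
      then show ?thesis
        using conjunct2[OF dir[of "e i"]] unfolding TX
        by (simp add: q_def \<alpha>_def \<beta>_def \<tau>_def algebra_simps)
    qed
    then show ?thesis unfolding uB uq by (simp add: algebra_simps)
  qed
  have "(\<Sum>i\<in>UNIV. c i * ((u z * T i + \<eta> z * q i) + 2 * ((1 - w * \<kappa> i) * \<tau> i * \<alpha> i) + 2 * w * (\<kappa> i * \<alpha> i * (\<beta> i + \<tau> i))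
      - K * (w * \<kappa> i) + K * \<rho> * q i)) \<le> 0"
    by (rule sum_nonpos) (use each curvature_frameD(6)[OF fr] in \<open>simp add: mult_nonneg_nonpos less_imp_le\<close>)
  moreover have "(\<Sum>i\<in>UNIV. c i * ((u z * T i + \<eta> z * q i) + 2 * ((1 - w * \<kappa> i) * \<tau> i * \<alpha> i) + 2 * w * (\<kappa> i * \<alpha> i * (\<beta> i + \<tau> i))
      - K * (w * \<kappa> i) + K * \<rho> * q i))
    = (\<Sum>i\<in>UNIV. c i * (u z * T i + \<eta> z * q i)) + 2 * (\<Sum>i\<in>UNIV. c i * (1 - w * \<kappa> i) * \<tau> i * \<alpha> i)
      + 2 * w * (\<Sum>i\<in>UNIV. c i * \<kappa> i * (\<alpha> i * (\<beta> i + \<tau> i))) - K * w * (\<Sum>i\<in>UNIV. c i * \<kappa> i)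
      + K * \<rho> * (\<Sum>i\<in>UNIV. c i * q i)"
    unfolding sum_distrib_left sum.distrib[symmetric] sum_subtractf[symmetric]
    by (intro sum.cong refl) (simp add: algebra_simps)
  ultimately have main: "\<sigma> / w * (p \<bullet> (H *v X)) + 2 * w * (\<Sum>i\<in>UNIV. c i * \<kappa> i * (\<alpha> i * (\<beta> i + \<tau> i)))
      - K * w * \<sigma> + K * \<rho> * (\<Sum>i\<in>UNIV. c i * q i) \<le> 0"
    unfolding lin curvature_frameD(8)[OF fr] by simp
  have s1: "u z * (\<Sum>i\<in>UNIV. c i * \<kappa> i * (\<alpha> i * (\<beta> i + \<tau> i))) = K * (\<Sum>i\<in>UNIV. c i * \<kappa> i * ((\<zeta> \<bullet> e i) * (p \<bullet> e i)))"
  proof -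
    have "u z * (c i * \<kappa> i * (\<alpha> i * (\<beta> i + \<tau> i))) = K * (c i * \<kappa> i * ((\<zeta> \<bullet> e i) * (p \<bullet> e i)))" for i
    proof -
      have "u z * (c i * \<kappa> i * (\<alpha> i * (\<beta> i + \<tau> i))) = c i * \<kappa> i * \<alpha> i * (u z * (\<beta> i + \<tau> i))" by simp
      also have "\<dots> = c i * \<kappa> i * \<alpha> i * (K * (\<zeta> \<bullet> e i))" unfolding first ..
      finally show ?thesis by (simp add: \<alpha>_def inner_commute)
    qed
    then show ?thesis unfolding sum_distrib_left by (intro sum.cong refl)
  qed
  have s2: "u z * (\<Sum>i\<in>UNIV. c i * q i) = (\<Sum>i\<in>UNIV. c i) - w * \<sigma>"
  proof -
    have "u z * (c i * q i) = c i - w * (c i * \<kappa> i)" for i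
      using arg_cong[OF uq[of i], of "\<lambda>x. c i * x"] by (simp add: algebra_simps)
    then have "u z * (\<Sum>i\<in>UNIV. c i * q i) = (\<Sum>i\<in>UNIV. c i - w * (c i * \<kappa> i))"
      unfolding sum_distrib_left by (intro sum.cong refl)
    then show ?thesis
      by (simp add: sum_subtractf sum_distrib_left[symmetric] curvature_frameD(8)[OF fr])
  qed
  have "u z * (\<sigma> / w * (p \<bullet> (H *v X)) + 2 * w * (\<Sum>i\<in>UNIV. c i * \<kappa> i * (\<alpha> i * (\<beta> i + \<tau> i)))
      - K * w * \<sigma> + K * \<rho> * (\<Sum>i\<in>UNIV. c i * q i)) \<le> 0"
    using main u0 by (simp add: mult_nonneg_nonpos)
  also have "u z * (\<sigma> / w * (p \<bullet> (H *v X)) + 2 * w * (\<Sum>i\<in>UNIV. c i * \<kappa> i * (\<alpha> i * (\<beta> i + \<tau> i)))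
      - K * w * \<sigma> + K * \<rho> * (\<Sum>i\<in>UNIV. c i * q i))
     = \<sigma> / w * (u z * (p \<bullet> (H *v X))) + 2 * w * (u z * (\<Sum>i\<in>UNIV. c i * \<kappa> i * (\<alpha> i * (\<beta> i + \<tau> i))))
      - K * (u z * w * \<sigma>) + K * \<rho> * (u z * (\<Sum>i\<in>UNIV. c i * q i))"
    by (simp add: algebra_simps)
  also have "\<dots> = K * (\<sigma> / w * (p \<bullet> \<zeta>) + 2 * w * (\<Sum>i\<in>UNIV. c i * \<kappa> i * ((\<zeta> \<bullet> e i) * (p \<bullet> e i)))
      - u z * w * \<sigma> + \<rho> * ((\<Sum>i\<in>UNIV. c i) - w * \<sigma>))"
    unfolding pX s1 s2 by (simp add: inner_commute[of \<zeta> p] algebra_simps)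
  finally show ?thesis using K by (simp add: mult_le_0_iff p_def w_def)
qed

text \<open>From 1 - w^2 = |Du|^2 \<ge> (s - \<tau>)^2 and s^2 = 1 - 1/\<sigma>^2. The excess over 1
  is linear in \<tau>, so that both the maximum principle and the use of (F8) can absorb it.\<close>

lemma wfun_upper:
  assumes x: "x \<in> closure \<Omega>" and N: "norm N = 1" and p: "norm (grad u x - slope \<sigma> *\<^sub>R N) \<le> \<tau>" and t: "0 \<le> \<tau>" "\<tau> \<le> slope \<sigma>"
  shows "wfun u x * \<sigma> \<le> 1 + \<sigma>\<^sup>2 * \<tau>"
proof -
  let ?s = "slope \<sigma>"
  note sb = slope_bounds[OF sigma]
  have "norm (?s *\<^sub>R N) = ?s" using N sb by simp
  then have "?s - \<tau> \<le> norm (grad u x)"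
    using norm_triangle_ineq2[of "?s *\<^sub>R N" "grad u x"] p by (simp add: norm_minus_commute)
  then have "(?s - \<tau>)\<^sup>2 \<le> (norm (grad u x))\<^sup>2" using t by (intro power_mono) auto
  moreover have "?s\<^sup>2 - 2 * \<tau> \<le> (?s - \<tau>)\<^sup>2"
  proof -
    have "?s * \<tau> \<le> 1 * \<tau>" using sb t by (intro mult_right_mono) auto
    then show ?thesis unfolding power2_diff using zero_le_power2[of \<tau>] by linarith
  qed
  ultimately have "(wfun u x)\<^sup>2 \<le> 1 / \<sigma>\<^sup>2 + 2 * \<tau>"
    unfolding wfun_square[OF grad_less_1[OF x]] using sb(3) by linarith
  then have "(wfun u x)\<^sup>2 * \<sigma>\<^sup>2 \<le> (1 / \<sigma>\<^sup>2 + 2 * \<tau>) * \<sigma>\<^sup>2" by (intro mult_right_mono) auto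
  also have "\<dots> = 1 + 2 * (\<sigma>\<^sup>2 * \<tau>)" using sigma by (simp add: field_simps)
  also have "\<dots> \<le> (1 + \<sigma>\<^sup>2 * \<tau>)\<^sup>2" by (simp add: power2_sum)
  finally have "(wfun u x * \<sigma>)\<^sup>2 \<le> (1 + \<sigma>\<^sup>2 * \<tau>)\<^sup>2" by (simp add: power_mult_distrib)
  then show ?thesis by (rule power2_le_imp_le) (use t in simp)
qed

text \<open>Here z - y0 is about r N, Du about s N, \<rho> about r, and u and Z are about 0, so
  \<zeta> is about \<mu> Du with \<mu> = r (1 - s) / s. The first term is then about \<sigma> \<mu>
  s^2 / w, the sum over \<kappa>_i is nonnegative up to the error, and the last term is bounded
  below because sum c_i \<ge> 1 and w \<sigma> \<le> 1 + \<sigma>^2 \<tau>. This contradicts the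
  inequality of \<open>killing_touching\<close>.\<close>

lemma killing_positive:
  fixes r \<tau> \<rho> Z :: real and y0 z :: "real^'n"
  defines "s \<equiv> slope \<sigma>"
  defines "\<mu> \<equiv> r * (1 - s) / s"
  assumes z: "z \<in> \<Omega>" and r: "r > 0" and fr: "curvature_frame z e \<kappa> c" and N: "norm N = 1"
    and p: "norm (grad u z - s *\<^sub>R N) \<le> \<tau>" and d1: "norm (z - y0 - r *\<^sub>R N) \<le> \<tau>"
    and small: "u z \<le> \<tau>" "0 \<le> Z" "Z \<le> \<tau>" "\<bar>\<rho> - r\<bar> \<le> \<tau>" "0 \<le> \<rho>"
    and t: "0 < \<tau>" "\<tau> \<le> 1" "\<tau> \<le> s / 2" "24 * (r / s + 4) * \<tau> \<le> \<mu> * s\<^sup>2"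
      "16 * (\<sigma> + (r + 1) * \<sigma>\<^sup>2) * \<tau> \<le> \<sigma> * \<mu> * s\<^sup>2"
  defines "\<zeta> \<equiv> z - y0 - (u z + Z + \<rho>) *\<^sub>R grad u z"
  shows "\<sigma> / wfun u z * (grad u z \<bullet> \<zeta>)
      + 2 * wfun u z * (\<Sum>i\<in>UNIV. c i * \<kappa> i * ((\<zeta> \<bullet> e i) * (grad u z \<bullet> e i)))
      - u z * wfun u z * \<sigma> + \<rho> * ((\<Sum>i\<in>UNIV. c i) - wfun u z * \<sigma>) > 0"
proof -
  have z': "z \<in> closure \<Omega>" using z Omega_closure by blast
  note sb = slope_bounds[OF sigma, folded s_def]
  define q where "q = grad u z" define w where "w = wfun u z"
  have q1: "norm q < 1" using grad_less_1[OF z'] by (simp add: q_def)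
  have w: "0 < w" "w \<le> 1" using w_pos[OF z'] wfun_le_1[OF grad_less_1[OF z']] by (simp_all add: w_def)
  have u0: "u z > 0" using u_pos[OF z'] .
  have mu: "\<mu> > 0" using sb r by (simp add: \<mu>_def)
  have tri: "norm (a - b - d) \<le> norm a + norm b + norm d" for a b d :: "real^'n"
    using norm_triangle_ineq4[of "a - b" d] norm_triangle_ineq4[of a b] by linarith
  define E where "E = \<zeta> - \<mu> *\<^sub>R q"
  have "E = (z - y0 - r *\<^sub>R N) - (r / s) *\<^sub>R (q - s *\<^sub>R N) - (u z + Z + (\<rho> - r)) *\<^sub>R q"
    using sb(1) by (simp add: E_def \<zeta>_def \<mu>_def q_def[symmetric] algebra_simps diff_divide_distrib)
  then have "norm E \<le> norm (z - y0 - r *\<^sub>R N) + norm ((r / s) *\<^sub>R (q - s *\<^sub>R N)) + norm ((u z + Z + (\<rho> - r)) *\<^sub>R q)"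
    by (simp only: tri)
  also have "norm ((r / s) *\<^sub>R (q - s *\<^sub>R N)) \<le> r / s * \<tau>"
    using p r sb by (simp add: q_def[symmetric] divide_right_mono mult_left_mono)
  also have "norm ((u z + Z + (\<rho> - r)) *\<^sub>R q) \<le> 3 * \<tau> * 1"
    unfolding norm_scaleR using small u0 q1 by (intro mult_mono) auto
  finally have E: "norm E \<le> (r / s + 4) * \<tau>" using d1 by (simp add: algebra_simps)
  have zE: "\<zeta> = \<mu> *\<^sub>R q + E" by (simp add: E_def)
  have nq: "s / 2 \<le> norm q"
  proof -
    have "norm (s *\<^sub>R N) = s" using N sb by simp
    then have "s - \<tau> \<le> norm q"
      using norm_triangle_ineq2[of "s *\<^sub>R N" q] p by (simp add: norm_minus_commute q_def)
    then show ?thesis using t by simp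
  qed
  have qz: "\<mu> * s\<^sup>2 / 4 - norm E \<le> q \<bullet> \<zeta>"
  proof -
    have "(s / 2)\<^sup>2 \<le> (norm q)\<^sup>2" using nq sb by (intro power_mono) auto
    then have "\<mu> * (s\<^sup>2 / 4) \<le> \<mu> * (q \<bullet> q)"
      using mu by (intro mult_left_mono) (auto simp: power2_norm_eq_inner power_divide)
    moreover have "\<bar>q \<bullet> E\<bar> \<le> 1 * norm E"
      using Cauchy_Schwarz_ineq2[of q E] mult_right_mono[OF less_imp_le[OF q1] norm_ge_zero[of E]]
      by linarith
    ultimately show ?thesis unfolding zE by (simp add: inner_add_right)
  qed
  have each: "- norm E / w\<^sup>2 \<le> (\<zeta> \<bullet> e i) * (q \<bullet> e i)" for i
  proof -
    have ne: "norm (e i) \<le> 1 / w" using curvature_frameD(4)[OF fr] by (simp add: w_def)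
    have "\<bar>E \<bullet> e i\<bar> * \<bar>q \<bullet> e i\<bar> \<le> (norm E * (1 / w)) * (1 * (1 / w))"
    proof (rule mult_mono)
      show "\<bar>E \<bullet> e i\<bar> \<le> norm E * (1 / w)"
        using Cauchy_Schwarz_ineq2[of E "e i"] mult_left_mono[OF ne norm_ge_zero[of E]] by linarith
      have "norm q * norm (e i) \<le> 1 * (1 / w)" using q1 ne by (intro mult_mono) auto
      then show "\<bar>q \<bullet> e i\<bar> \<le> 1 * (1 / w)" using Cauchy_Schwarz_ineq2[of q "e i"] by linarith
    qed (use w in auto)
    then have "\<bar>(E \<bullet> e i) * (q \<bullet> e i)\<bar> \<le> norm E / w\<^sup>2" by (simp add: abs_mult power2_eq_square)
    then have "- norm E / w\<^sup>2 \<le> (E \<bullet> e i) * (q \<bullet> e i)" by linarith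
    also have "\<dots> \<le> (\<zeta> \<bullet> e i) * (q \<bullet> e i)"
      unfolding zE inner_add_left inner_scaleR_left distrib_right
      using mult_nonneg_nonneg[OF less_imp_le[OF mu] zero_le_square[of "q \<bullet> e i"]]
      by (simp add: mult.assoc)
    finally show ?thesis .
  qed
  have "(\<Sum>i\<in>UNIV. c i * \<kappa> i * (- norm E / w\<^sup>2)) \<le> (\<Sum>i\<in>UNIV. c i * \<kappa> i * ((\<zeta> \<bullet> e i) * (q \<bullet> e i)))"
    using curvature_frameD(5,6)[OF fr] each by (intro sum_mono mult_left_mono) (auto simp: less_imp_le)
  moreover have "(\<Sum>i\<in>UNIV. c i * \<kappa> i * (- norm E / w\<^sup>2)) = - \<sigma> * norm E / w\<^sup>2"
    by (simp add: sum_distrib_right[symmetric] sum_negf curvature_frameD(8)[OF fr] sum_divide_distrib[symmetric])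
  ultimately have "2 * w * (- \<sigma> * norm E / w\<^sup>2) \<le> 2 * w * (\<Sum>i\<in>UNIV. c i * \<kappa> i * ((\<zeta> \<bullet> e i) * (q \<bullet> e i)))"
    using w by (intro mult_left_mono) auto
  moreover have "2 * w * (- \<sigma> * norm E / w\<^sup>2) = \<sigma> / w * (- 2 * norm E)"
    using w by (simp add: power2_eq_square)
  moreover have "\<sigma> / w * (\<mu> * s\<^sup>2 / 4 - norm E) \<le> \<sigma> / w * (q \<bullet> \<zeta>)"
    using qz sigma w by (intro mult_left_mono) auto
  \<comment> \<open>Half of \<mu> s^2 / 4 absorbs \<open>3 * norm E\<close>, by the condition with
    factor 24; the condition with factor 16 makes the remaining lower-order terms smaller than the
    other half.\<close>
  moreover have "\<sigma> * (\<mu> * s\<^sup>2 / 8) \<le> \<sigma> / w * (\<mu> * s\<^sup>2 / 4 - 3 * norm E)"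
  proof (rule mult_mono)
    show "\<sigma> \<le> \<sigma> / w" using sigma w by (simp add: pos_le_divide_eq mult_left_le)
    show "\<mu> * s\<^sup>2 / 8 \<le> \<mu> * s\<^sup>2 / 4 - 3 * norm E" using E t(4) by linarith
  qed (use sigma w mu in auto)
  moreover have "\<sigma> / w * (\<mu> * s\<^sup>2 / 4 - 3 * norm E) = \<sigma> / w * (\<mu> * s\<^sup>2 / 4 - norm E) + \<sigma> / w * (- 2 * norm E)"
    by (simp only: distrib_left[symmetric]) simp
  moreover have "u z * w * \<sigma> \<le> \<sigma> * \<tau>"
  proof -
    have "u z * w \<le> \<tau> * 1" using small u0 w by (intro mult_mono) auto
    then show ?thesis using sigma by (simp add: mult.commute)
  qed
  moreover have "- ((r + 1) * \<sigma>\<^sup>2 * \<tau>) \<le> \<rho> * ((\<Sum>i\<in>UNIV. c i) - w * \<sigma>)"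
  proof -
    have "w * \<sigma> \<le> 1 + \<sigma>\<^sup>2 * \<tau>"
      using wfun_upper[OF z' N, of \<tau>] p t sb by (simp add: s_def w_def)
    then have "\<rho> * (- (\<sigma>\<^sup>2 * \<tau>)) \<le> \<rho> * ((\<Sum>i\<in>UNIV. c i) - w * \<sigma>)"
      using curvature_frameD(9)[OF fr] small by (intro mult_left_mono) auto
    moreover have "\<rho> * (\<sigma>\<^sup>2 * \<tau>) \<le> (r + 1) * (\<sigma>\<^sup>2 * \<tau>)"
      using small t by (intro mult_right_mono) auto
    ultimately show ?thesis by (simp add: mult.assoc)
  qed
  moreover have "\<sigma> * \<tau> + (r + 1) * \<sigma>\<^sup>2 * \<tau> < \<sigma> * (\<mu> * s\<^sup>2 / 8)"
  proof -
    have "0 < \<sigma> * \<mu> * s\<^sup>2" using sigma mu sb by simp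
    then show ?thesis using t(5) by (simp add: algebra_simps)
  qed
  ultimately show ?thesis unfolding q_def[symmetric] w_def[symmetric] by linarith
qed

end

section \<open>Tangential and mixed second derivatives on the boundary\<close>

lemma disjoint_balls_dist:
  fixes a b :: "'a::euclidean_space"
  assumes "ball a r \<inter> ball b s = {}" "r > 0" "s > 0"
  shows "r + s \<le> dist a b"
proof (rule ccontr)
  assume "\<not> ?thesis"
  then have lt: "dist a b < r + s" by simp
  define p where "p = a + (r / (r + s)) *\<^sub>R (b - a)"
  have rs: "r + s > 0" using assms by simp
  have "dist a p = r / (r + s) * dist a b"
    using assms by (simp add: p_def dist_norm norm_minus_commute)
  also have "\<dots> < r / (r + s) * (r + s)" using assms rs by (intro mult_strict_left_mono lt) auto
  finally have 1: "dist a p < r" using rs by simp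
  have "1 - r / (r + s) = s / (r + s)" using rs by (simp add: field_simps)
  moreover have "b - p = (1 - r / (r + s)) *\<^sub>R (b - a)" by (simp add: p_def algebra_simps)
  ultimately have "dist b p = s / (r + s) * dist a b"
    using assms by (simp add: dist_norm norm_minus_commute)
  also have "\<dots> < s / (r + s) * (r + s)" using assms rs by (intro mult_strict_left_mono lt) auto
  finally have 2: "dist b p < s" using rs by simp
  show False using 1 2 assms(1) by auto
qed

lemma norm_add_scaleR_unit:
  fixes a n :: "'a::real_inner"
  assumes "norm n = 1"
  shows "(norm (a + k *\<^sub>R n))\<^sup>2 = (norm a)\<^sup>2 + 2 * k * (a \<bullet> n) + k\<^sup>2"
proof -
  have "n \<bullet> n = 1" using assms by (simp add: norm_eq_1)
  then show ?thesis
    unfolding power2_norm_eq_inner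
    by (simp add: inner_add_left inner_add_right inner_commute[of n a] power2_eq_square
        distrib_left)
qed

text \<open>N is the inner unit normal. This uniform ball condition, together with
  \<open>infinitesimal_rotation_bound\<close>, carries all the boundary regularity that the
  estimates use.\<close>

definition two_sided_balls :: "(real^'n::finite) set \<Rightarrow> real \<Rightarrow> (real^'n \<Rightarrow> real^'n) \<Rightarrow> bool" where
  "two_sided_balls \<Omega> r N \<longleftrightarrow> r > 0 \<and> (\<forall>x\<in>frontier \<Omega>. norm (N x) = 1 \<and>
     ball (x + r *\<^sub>R N x) r \<subseteq> \<Omega> \<and> ball (x - r *\<^sub>R N x) r \<inter> \<Omega> = {})"

text \<open>Each ball is disjoint from the opposite one at the other point, so the centers are at
  least 2 r apart. Adding the two squared inequalities cancels the cross terms, and the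
  parallelogram law remains. The case x = y shows that the normal is unique.\<close>

lemma opposite_balls_normals:
  fixes x y :: "'a::euclidean_space"
  assumes r: "r > 0" and n: "norm n = 1" "norm m = 1"
    and d: "ball (x + r *\<^sub>R n) r \<inter> ball (y - r *\<^sub>R m) r = {}"
      "ball (y + r *\<^sub>R m) r \<inter> ball (x - r *\<^sub>R n) r = {}"
  shows "norm (n - m) \<le> norm (x - y) / r"
proof -
  have 1: "2 * r \<le> norm ((x - y) + r *\<^sub>R (n + m))"
    using disjoint_balls_dist[OF d(1) r r] by (simp add: dist_norm algebra_simps)
  have 2: "2 * r \<le> norm ((y - x) + r *\<^sub>R (n + m))"
    using disjoint_balls_dist[OF d(2) r r] by (simp add: dist_norm algebra_simps)
  have "(2 * r)\<^sup>2 \<le> (norm ((x - y) + r *\<^sub>R (n + m)))\<^sup>2" using 1 r by (intro power_mono) auto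
  moreover have "(2 * r)\<^sup>2 \<le> (norm ((y - x) + r *\<^sub>R (n + m)))\<^sup>2" using 2 r by (intro power_mono) auto
  ultimately have A: "4 * r\<^sup>2 \<le> (norm (x - y))\<^sup>2 + r\<^sup>2 * (norm (n + m))\<^sup>2"
    unfolding power2_norm_eq_inner by (simp add: inner_simps inner_commute power2_eq_square algebra_simps)
  have S: "(norm (n + m))\<^sup>2 = 4 - (norm (n - m))\<^sup>2"
    using n by (simp add: power2_norm_eq_inner inner_simps inner_commute norm_eq_1)
  have "r\<^sup>2 * (norm (n - m))\<^sup>2 \<le> (norm (x - y))\<^sup>2"
    using A unfolding S by (simp add: right_diff_distrib)
  then have "(r * norm (n - m))\<^sup>2 \<le> (norm (x - y))\<^sup>2" by (simp add: power_mult_distrib)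
  then have "r * norm (n - m) \<le> norm (x - y)" by (rule power2_le_imp_le) simp
  then show ?thesis using r by (simp add: field_simps)
qed

lemma two_sided_ballsD:
  assumes "two_sided_balls \<Omega> r N" "x \<in> frontier \<Omega>"
  shows "r > 0" "norm (N x) = 1" "ball (x + r *\<^sub>R N x) r \<subseteq> \<Omega>" "ball (x - r *\<^sub>R N x) r \<inter> \<Omega> = {}"
  using assms by (auto simp: two_sided_balls_def)

lemma normal_lipschitz:
  assumes b: "two_sided_balls \<Omega> r N" and x: "x \<in> frontier \<Omega>" "y \<in> frontier \<Omega>"
  shows "norm (N x - N y) \<le> norm (x - y) / r"
  using two_sided_ballsD[OF b x(1)] two_sided_ballsD[OF b x(2)]
  by (intro opposite_balls_normals) auto

text \<open>The ball around z and the exterior ball at x are disjoint, so their centers are at least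
  d + r apart. That is the length of the broken line through x, hence z - x points along N.\<close>

lemma nearest_point_normal:
  assumes b: "two_sided_balls \<Omega> r N" and x: "x \<in> frontier \<Omega>" and z: "ball z (dist z x) \<subseteq> \<Omega>" "z \<noteq> x"
  shows "z = x + dist z x *\<^sub>R N x"
proof -
  note bd = two_sided_ballsD[OF b x]
  define d where "d = dist z x"
  have d: "d > 0" using z by (simp add: d_def)
  have nd: "norm (z - x) = d" by (simp add: d_def dist_norm)
  have "ball z d \<inter> ball (x - r *\<^sub>R N x) r = {}" using z bd(4) by (auto simp: d_def)
  then have "d + r \<le> dist z (x - r *\<^sub>R N x)" by (rule disjoint_balls_dist[OF _ d bd(1)])
  then have "(d + r)\<^sup>2 \<le> (norm ((z - x) + r *\<^sub>R N x))\<^sup>2"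
    using d bd(1) by (intro power_mono) (auto simp: dist_norm algebra_simps)
  then have "d\<^sup>2 + 2 * d * r + r\<^sup>2 \<le> d\<^sup>2 + 2 * r * ((z - x) \<bullet> N x) + r\<^sup>2"
    unfolding norm_add_scaleR_unit[OF bd(2)] nd power2_sum by simp
  then have "d \<le> (z - x) \<bullet> N x" using bd(1) by (simp add: mult.commute)
  moreover have "(norm ((z - x) - d *\<^sub>R N x))\<^sup>2 = d\<^sup>2 - 2 * d * ((z - x) \<bullet> N x) + d\<^sup>2"
    using norm_add_scaleR_unit[OF bd(2), of "z - x" "- d"] by (simp add: nd)
  ultimately have "(norm ((z - x) - d *\<^sub>R N x))\<^sup>2 \<le> 0"
    using d mult_left_mono[of d "(z - x) \<bullet> N x" d] by (simp add: power2_eq_square)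
  then show ?thesis by (simp add: d_def algebra_simps)
qed

context steady_state_graph
begin

section \<open>Gradient and tangential second derivatives on the boundary\<close>

lemma u_curve:
  assumes "(\<gamma> has_vector_derivative \<gamma>') (at t)" "\<gamma> t \<in> closure \<Omega>"
  shows "((\<lambda>t. u (\<gamma> t)) has_real_derivative \<gamma>' \<bullet> grad u (\<gamma> t)) (at t)"
proof -
  have "(u has_derivative (\<lambda>h. h \<bullet> grad u (\<gamma> t))) (at (\<gamma> t) within range \<gamma>)"
    using u_has_derivative[OF assms(2)] has_derivative_at_withinI by blast
  from vector_derivative_diff_chain_within[OF assms(1) this] show ?thesis
    by (simp add: o_def has_real_derivative_iff_has_vector_derivative)
qed

lemma grad_curve:
  assumes "(\<gamma> has_vector_derivative \<gamma>') (at t)" "\<gamma> t \<in> closure \<Omega>"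
  shows "((\<lambda>t. grad u (\<gamma> t)) has_vector_derivative hess u (\<gamma> t) *v \<gamma>') (at t)"
proof -
  have "(grad u has_derivative (\<lambda>h. hess u (\<gamma> t) *v h)) (at (\<gamma> t) within range \<gamma>)"
    using grad_has_derivative'[OF assms(2)] has_derivative_at_withinI by blast
  from vector_derivative_diff_chain_within[OF assms(1) this] show ?thesis
    by (simp add: o_def)
qed

text \<open>Evaluating \<open>u\<close> along the parabola \<open>x + ta + (t\<^sup>2/r) N\<close>, which lies in the interior ball.\<close>

lemma tangential_bounds:
  assumes b: "two_sided_balls \<Omega> r N" and x: "x \<in> frontier \<Omega>" and a: "norm a = 1" "a \<bullet> N x = 0"
  shows "a \<bullet> grad u x = 0" "\<bar>a \<bullet> (hess u x *v a)\<bar> \<le> 6 / r"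
proof -
  note bd = two_sided_ballsD[OF b x]
  let ?N = "N x"
  have r: "r > 0" and r0: "r \<noteq> 0" using bd(1) by simp_all
  have xcl: "x \<in> closure \<Omega>" using frontier_closure[OF x] .
  \<comment> \<open>The coefficient 1 / r is twice that of the parabola osculating the sphere, which
    leaves room inside the ball: |\<gamma> - center|^2 = r^2 - t^2 + t^4 / r^2.\<close>
  define \<gamma> where "\<gamma> = (\<lambda>t. x + t *\<^sub>R a + (t\<^sup>2 / r) *\<^sub>R ?N)"
  have n2: "(norm (t *\<^sub>R a + k *\<^sub>R ?N))\<^sup>2 = t\<^sup>2 + k\<^sup>2" for t k :: real
    using a by (simp add: norm_add_scaleR_unit[OF bd(2)])
  have cl: "\<gamma> t \<in> closure \<Omega>" if t: "\<bar>t\<bar> < r" for t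
  proof (cases "t = 0")
    case True
    then show ?thesis using xcl by (simp add: \<gamma>_def)
  next
    case False
    have "\<gamma> t - (x + r *\<^sub>R ?N) = t *\<^sub>R a + (t\<^sup>2 / r - r) *\<^sub>R ?N" by (simp add: \<gamma>_def algebra_simps)
    then have "(norm (\<gamma> t - (x + r *\<^sub>R ?N)))\<^sup>2 = t\<^sup>2 + (t\<^sup>2 / r - r)\<^sup>2" by (simp only: n2)
    also have "\<dots> < r\<^sup>2"
    proof -
      have "t\<^sup>2 < r\<^sup>2" using power_strict_mono[OF t, of 2] by simp
      then have "t\<^sup>2 * t\<^sup>2 < t\<^sup>2 * r\<^sup>2" using False by (intro mult_strict_left_mono) auto
      moreover have "t\<^sup>2 + (t\<^sup>2 / r - r)\<^sup>2 = r\<^sup>2 - t\<^sup>2 + t\<^sup>2 * t\<^sup>2 / r\<^sup>2"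
        unfolding power2_diff power_divide by (simp add: r0 power2_eq_square)
      ultimately show ?thesis using r by (simp add: field_simps)
    qed
    finally have "norm (\<gamma> t - (x + r *\<^sub>R ?N)) < r" by (rule power2_less_imp_less) (use r in simp)
    then have "\<gamma> t \<in> ball (x + r *\<^sub>R ?N) r" by (simp only: mem_ball dist_norm norm_minus_commute)
    then show ?thesis using bd(3) Omega_closure by blast
  qed
  have d\<gamma>: "(\<gamma> has_vector_derivative (a + (2 * t / r) *\<^sub>R ?N)) (at t)" for t
    unfolding \<gamma>_def using r0 by (auto intro!: derivative_eq_intros)
  have du: "((\<lambda>t. u (\<gamma> t)) has_real_derivative (a + (2 * t / r) *\<^sub>R ?N) \<bullet> grad u (\<gamma> t)) (at t)" if "\<bar>t\<bar> < r" for t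
    by (rule u_curve[OF d\<gamma> cl[OF that]])
  have \<gamma>0: "\<gamma> 0 = x" by (simp add: \<gamma>_def)
  have ddu: "((\<lambda>t. (a + (2 * t / r) *\<^sub>R ?N) \<bullet> grad u (\<gamma> t)) has_real_derivative
      (a \<bullet> (hess u x *v a) + (2 / r) * (?N \<bullet> grad u x))) (at 0)"
  proof -
    have "((\<lambda>t. a + (2 * t / r) *\<^sub>R ?N) has_vector_derivative (2 / r) *\<^sub>R ?N) (at 0)"
      using r0 by (auto intro!: derivative_eq_intros)
    moreover have "((\<lambda>t. grad u (\<gamma> t)) has_vector_derivative hess u x *v a) (at 0)"
      using grad_curve[OF d\<gamma>[of 0] cl[of 0]] r by (simp add: \<gamma>0)
    ultimately show ?thesis using has_real_derivative_inner by (fastforce simp: \<gamma>0)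
  qed
  have ux: "u x = \<epsilon>" by (rule u_boundary[OF x])
  have lo: "u (\<gamma> 0) \<le> u (\<gamma> t)" if "\<bar>t\<bar> < r" for t
    using u_ge_eps[OF cl[OF that]] by (simp add: \<gamma>0 ux)
  show "a \<bullet> grad u x = 0"
    using second_derivative_local_min(1)[OF r du ddu lo] by (simp add: \<gamma>0)
  have low: "0 \<le> a \<bullet> (hess u x *v a) + (2 / r) * (?N \<bullet> grad u x)"
    by (rule second_derivative_local_min(2)[OF r du ddu lo])
  \<comment> \<open>The exterior cone bounds u along the curve by \<epsilon> + 2 t^2 / r. Hence the
    second derivative along the curve at t = 0 lies between 0 and 4 / r, and the bending of \<gamma>
    accounts for at most 2 / r more.\<close>
  have hi: "u (\<gamma> t) \<le> \<epsilon> + 2 * t\<^sup>2 / r" if t: "\<bar>t\<bar> < r" for t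
  proof -
    have "\<gamma> t - (x - r *\<^sub>R ?N) = t *\<^sub>R a + (t\<^sup>2 / r + r) *\<^sub>R ?N" by (simp add: \<gamma>_def algebra_simps)
    then have "(norm (\<gamma> t - (x - r *\<^sub>R ?N)))\<^sup>2 = t\<^sup>2 + (t\<^sup>2 / r + r)\<^sup>2" by (simp only: n2)
    also have "\<dots> = r\<^sup>2 + 3 * t\<^sup>2 + (t\<^sup>2 / r)\<^sup>2"
      using r by (simp add: power2_sum)
    also have "\<dots> \<le> r\<^sup>2 + 4 * t\<^sup>2 + 4 * (t\<^sup>2 / r)\<^sup>2" by simp
    also have "\<dots> = (r + 2 * t\<^sup>2 / r)\<^sup>2"
      using r by (simp add: power2_sum power_divide power_mult_distrib)
    finally have "norm (\<gamma> t - (x - r *\<^sub>R ?N)) \<le> r + 2 * t\<^sup>2 / r"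
      by (rule power2_le_imp_le) (use r in simp)
    then show ?thesis using u_le_exterior_cone[OF bd(4) r cl[OF t]] by linarith
  qed
  have "0 \<le> 4 / r - (a \<bullet> (hess u x *v a) + (2 / r) * (?N \<bullet> grad u x))"
  proof (rule second_derivative_local_min(2)[OF r])
    fix t assume t: "\<bar>t\<bar> < r"
    show "((\<lambda>t. 2 * t\<^sup>2 / r - u (\<gamma> t)) has_real_derivative 4 * t / r - (a + (2 * t / r) *\<^sub>R ?N) \<bullet> grad u (\<gamma> t)) (at t)"
      by (rule DERIV_diff[OF _ du[OF t]]) (use r0 in \<open>auto intro!: derivative_eq_intros\<close>)
    show "2 * 0\<^sup>2 / r - u (\<gamma> 0) \<le> 2 * t\<^sup>2 / r - u (\<gamma> t)"
      using hi[OF t] by (simp add: \<gamma>0 ux)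
  next
    show "((\<lambda>t. 4 * t / r - (a + (2 * t / r) *\<^sub>R ?N) \<bullet> grad u (\<gamma> t)) has_real_derivative
        4 / r - (a \<bullet> (hess u x *v a) + (2 / r) * (?N \<bullet> grad u x))) (at 0)"
      by (rule DERIV_diff[OF _ ddu]) (use r0 in \<open>auto intro!: derivative_eq_intros\<close>)
  qed
  moreover have "\<bar>(2 / r) * (?N \<bullet> grad u x)\<bar> \<le> (2 / r) * 1"
    unfolding abs_mult using r Cauchy_Schwarz_ineq2[of ?N "grad u x"] grad_less_1[OF xcl] bd(2)
    by (intro mult_mono) auto
  moreover have "6 / r = 4 / r + (2 / r) * 1" by (simp add: add_divide_distrib[symmetric])
  moreover have "0 < 4 / r" using r by simp
  ultimately show "\<bar>a \<bullet> (hess u x *v a)\<bar> \<le> 6 / r" using low by linarith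
qed

lemma boundary_gradient:
  assumes b: "two_sided_balls \<Omega> r N" and x: "x \<in> frontier \<Omega>"
  shows "grad u x = (N x \<bullet> grad u x) *\<^sub>R N x"
proof -
  define q where "q = grad u x - (N x \<bullet> grad u x) *\<^sub>R N x"
  have NN: "N x \<bullet> N x = 1" using two_sided_ballsD(2)[OF b x] by (simp add: norm_eq_1)
  have qN: "q \<bullet> N x = 0" by (simp add: q_def inner_diff_left NN inner_commute[of "grad u x"])
  have "q = 0"
  proof (rule ccontr)
    assume "q \<noteq> 0"
    then have "norm ((1 / norm q) *\<^sub>R q) = 1" "((1 / norm q) *\<^sub>R q) \<bullet> N x = 0" using qN by auto
    from tangential_bounds(1)[OF b x this] have "q \<bullet> grad u x = 0" using \<open>q \<noteq> 0\<close> by simp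
    then have "q \<bullet> q = 0" using qN by (simp add: q_def inner_diff_right)
    then show False using \<open>q \<noteq> 0\<close> by simp
  qed
  then show ?thesis by (simp add: q_def)
qed

section \<open>Mixed second derivatives on the boundary\<close>

text \<open>Sharpens the cone of slope 1 to a slope below 1 that does not depend on \<epsilon>: for
  small \<epsilon> the barrier radius is at least R0, and up to distance L the hyperboloid has slope
  at most L / sqrt (R0^2 + L^2). The gap to 1 makes the light-cone function grow quadratically away
  from x0.\<close>

lemma cone_bound:
  assumes b: "ball y r \<inter> \<Omega> = {}" and r: "r > 0" and er: "\<epsilon> < r"
    and e: "(\<sigma> + 1) * \<epsilon> / (\<sigma>\<^sup>2 - 1) \<le> r / (2 * sqrt (\<sigma>\<^sup>2 - 1))"
    and L: "r \<le> L" "norm (z - y) \<le> L" and z: "z \<in> closure \<Omega>"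
  defines "R0 \<equiv> r / (2 * sqrt (\<sigma>\<^sup>2 - 1))"
  shows "u z \<le> \<epsilon> + (L / sqrt (R0\<^sup>2 + L\<^sup>2)) * (norm (z - y) - r)"
proof -
  obtain R where R: "R > 0" "\<epsilon> + \<sigma> * R = sqrt (R\<^sup>2 + r\<^sup>2)" "r / sqrt (\<sigma>\<^sup>2 - 1) - (\<sigma> + 1) * \<epsilon> / (\<sigma>\<^sup>2 - 1) \<le> R"
    using barrier_radius[OF sigma r eps er] by metis
  have a: "\<sigma>\<^sup>2 - 1 > 0" using sigma by (simp add: one_less_power)
  have R0: "R0 > 0" using r a by (simp add: R0_def)
  have "r / sqrt (\<sigma>\<^sup>2 - 1) = 2 * R0" by (simp add: R0_def)
  then have R0R: "R0 \<le> R" using R(3) e by (simp add: R0_def)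
  define t where "t = norm (z - y)"
  define s1 where "s1 = L / sqrt (R0\<^sup>2 + L\<^sup>2)"
  have L0: "L > 0" using L r by simp
  have S0: "sqrt (R0\<^sup>2 + L\<^sup>2) > 0" using L0 by (simp add: add_nonneg_pos)
  have s1: "s1 > 0" using L0 S0 by (simp add: s1_def)
  have tr: "r \<le> t" using exterior_ball_closure[OF b z] by (simp add: t_def)
  have ratio: "v \<le> s1 * sqrt (R\<^sup>2 + v\<^sup>2)" if v: "0 \<le> v" "v \<le> L" for v
  proof -
    have "v * sqrt (R0\<^sup>2 + L\<^sup>2) \<le> L * sqrt (R\<^sup>2 + v\<^sup>2)"
    proof (rule power2_le_imp_le)
      have "v\<^sup>2 * R0\<^sup>2 \<le> L\<^sup>2 * R\<^sup>2" using v R0 R0R by (intro mult_mono power_mono) auto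
      then show "(v * sqrt (R0\<^sup>2 + L\<^sup>2))\<^sup>2 \<le> (L * sqrt (R\<^sup>2 + v\<^sup>2))\<^sup>2"
        by (simp add: power_mult_distrib algebra_simps)
    qed (use L0 in simp)
    then show ?thesis using S0 by (simp add: s1_def pos_le_divide_eq)
  qed
  have "(u z + \<sigma> * R)\<^sup>2 \<le> R\<^sup>2 + t\<^sup>2"
    unfolding t_def by (rule upper_barrier[OF b er R(1) _ z]) (simp add: R(2))
  then have "u z + \<sigma> * R \<le> sqrt (R\<^sup>2 + t\<^sup>2)" by (rule real_le_rsqrt)
  then have "u z \<le> \<epsilon> + (sqrt (R\<^sup>2 + t\<^sup>2) - sqrt (R\<^sup>2 + r\<^sup>2))" using R(2) by linarith
  moreover have "sqrt (R\<^sup>2 + t\<^sup>2) - sqrt (R\<^sup>2 + r\<^sup>2) \<le> s1 * (t - r)"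
  proof -
    let ?S = "sqrt (R\<^sup>2 + t\<^sup>2) + sqrt (R\<^sup>2 + r\<^sup>2)"
    have S: "?S > 0" using R(1) by (simp add: add_pos_nonneg)
    have "t + r \<le> s1 * ?S" using ratio[of t] ratio[of r] L r tr by (simp add: t_def distrib_left)
    then have "(t - r) * (t + r) \<le> (t - r) * (s1 * ?S)" using tr by (intro mult_left_mono) auto
    then have "t\<^sup>2 - r\<^sup>2 \<le> s1 * (t - r) * ?S" by (simp add: power2_eq_square algebra_simps)
    then have "(t\<^sup>2 - r\<^sup>2) / ?S \<le> s1 * (t - r)" using S by (subst pos_divide_le_eq) auto
    then show ?thesis using sqrt_diff_bounds(1)[OF R(1) _ tr] r by simp
  qed
  ultimately show ?thesis by (simp add: t_def s1_def)
qed

text \<open>Origin of the constants: \<open>c1\<close> comes from the quadratic growth of u Z with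
  the gap 1 - s1; within distance \<open>l\<close> of x0 the gradient is \<tau>-close to s N; Z <
  \<delta> forces that distance; K exceeds C2 / \<delta>, which excludes a ratio \<eta> / Z above K
  where Z \<ge> \<delta>, and C2 / c1, which excludes it on the boundary.\<close>

lemma mixed_one_sided:
  fixes B :: "real^'n \<Rightarrow> real^'n" and b x0 :: "real^'n" and r L s1 C2 \<tau> D :: real
  defines "s \<equiv> slope \<sigma>"
  defines "\<mu> \<equiv> r * (1 - s) / s"
  defines "c1 \<equiv> (1 - s1) / 8"
  defines "l \<equiv> min (\<tau> / 2) (min D (\<tau> * r / 2))"
  defines "\<delta> \<equiv> min \<tau> (c1 * l\<^sup>2 / (1 + L))"
  defines "K \<equiv> C2 / c1 + C2 / \<delta> + 1"
  defines "\<eta> \<equiv> \<lambda>y. (b + B y) \<bullet> grad u y"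
  assumes balls: "two_sided_balls \<Omega> (2 * r) N" and x0: "x0 \<in> frontier \<Omega>"
    and L: "\<And>z. z \<in> closure \<Omega> \<Longrightarrow> norm (z - x0) \<le> L"
    and B: "linear B" and anti: "\<And>v w. v \<bullet> B w = - (w \<bullet> B v)"
    and C2: "C2 \<ge> 0" "\<And>z. z \<in> closure \<Omega> \<Longrightarrow> \<eta> z \<le> C2" "\<And>z. z \<in> frontier \<Omega> \<Longrightarrow> \<eta> z \<le> C2 * (norm (z - x0))\<^sup>2"
    and tang: "(b + B x0) \<bullet> N x0 = 0"
    and s1: "0 \<le> s1" "s1 < 1" and cone: "\<And>z. z \<in> closure \<Omega> \<Longrightarrow> u z \<le> \<epsilon> + s1 * (norm (z - (x0 - r *\<^sub>R N x0)) - r)"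
    and D: "D > 0" and close: "\<And>x1 d. x1 \<in> frontier \<Omega> \<Longrightarrow> 0 \<le> d \<Longrightarrow> d \<le> D \<Longrightarrow>
        norm (grad u (x1 + d *\<^sub>R N x1) - s *\<^sub>R N x1) \<le> \<tau> / 2"
    and t: "0 < \<tau>" "\<tau> \<le> 1" "\<tau> \<le> s / 2" "24 * (r / s + 4) * \<tau> \<le> \<mu> * s\<^sup>2"
      "16 * (\<sigma> + (r + 1) * \<sigma>\<^sup>2) * \<tau> \<le> \<sigma> * \<mu> * s\<^sup>2"
    and e: "\<epsilon> \<le> 1" "2 * \<epsilon> \<le> \<tau>" "2 * \<epsilon> < r"
  shows "\<epsilon> * ((b + B x0) \<bullet> (hess u x0 *v N x0)) \<le> 2 * K * r"
proof -
  note bd = two_sided_ballsD[OF balls x0]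
  let ?N = "N x0"
  have r: "r > 0" using bd(1) by simp
  note sb = slope_bounds[OF sigma, folded s_def]
  have c1: "c1 > 0" using s1 by (simp add: c1_def)
  have l: "l > 0" "l \<le> \<tau> / 2" "l \<le> D" "l \<le> \<tau> * r / 2" using t D r by (auto simp: l_def)
  have x0cl: "x0 \<in> closure \<Omega>" using frontier_closure[OF x0] .
  have L0: "L \<ge> 0" using L[OF x0cl] by simp
  have del: "\<delta> > 0" "\<delta> \<le> \<tau>" "\<delta> * (1 + L) \<le> c1 * l\<^sup>2"
  proof -
    show "\<delta> > 0" using t c1 l L0 by (auto simp: \<delta>_def intro!: divide_pos_pos mult_pos_pos)
    have "\<delta> \<le> c1 * l\<^sup>2 / (1 + L)" by (simp add: \<delta>_def)
    then show "\<delta> * (1 + L) \<le> c1 * l\<^sup>2" using L0 by (simp add: pos_le_divide_eq)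
  qed (simp add: \<delta>_def)
  have K: "K > 0" "C2 / c1 \<le> K" "C2 / \<delta> \<le> K" using C2(1) c1 del(1) by (simp_all add: K_def add_nonneg_pos)
  define y0 where "y0 = x0 - r *\<^sub>R ?N"
  \<comment> \<open>The exterior ball of radius 2 r makes the ball of radius r around y0 touch the
    closure only at x0, with quadratic separation.\<close>
  have ext2: "(norm (z - x0))\<^sup>2 / 2 \<le> (norm (z - y0))\<^sup>2 - r\<^sup>2" if z: "z \<in> closure \<Omega>" for z
  proof -
    have "(2 * r)\<^sup>2 \<le> (norm ((z - x0) + (2 * r) *\<^sub>R ?N))\<^sup>2"
      using exterior_ball_closure[OF bd(4) z] r by (intro power_mono) (auto simp: algebra_simps)
    also have "\<dots> = (norm (z - x0))\<^sup>2 + 4 * r * ((z - x0) \<bullet> ?N) + 4 * r\<^sup>2"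
      unfolding norm_add_scaleR_unit[OF bd(2)] by (simp add: power_mult_distrib)
    finally have *: "- ((norm (z - x0))\<^sup>2) / 2 \<le> 2 * r * ((z - x0) \<bullet> ?N)" by (simp add: power_mult_distrib)
    have zy: "z - y0 = (z - x0) + r *\<^sub>R ?N" by (simp add: y0_def)
    show ?thesis unfolding zy norm_add_scaleR_unit[OF bd(2)] using * by simp
  qed
  have tr: "r \<le> norm (z - y0)" if z: "z \<in> closure \<Omega>" for z
  proof (rule power2_le_imp_le)
    show "r\<^sup>2 \<le> (norm (z - y0))\<^sup>2" using ext2[OF z] zero_le_power2[of "norm (z - x0)"] by linarith
  qed simp
  have u_le: "u z \<le> \<epsilon> + norm (z - x0)" if "z \<in> closure \<Omega>" for z
    using u_le_dist_frontier[OF that x0] by (simp add: dist_norm)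
  \<comment> \<open>\<rho> < r - \<epsilon> keeps Z positive up to the boundary, so that \<eta> / Z
    attains its maximum; Z vanishes at x0 only in the limit \<rho> = r - \<epsilon>.\<close>
  have main: "u z * \<eta> z \<le> K * ((norm (z - y0))\<^sup>2 - (u z + \<rho>)\<^sup>2) / 2"
    if rho: "r - 2 * \<epsilon> < \<rho>" "\<rho> < r - \<epsilon>" and z: "z \<in> closure \<Omega>" for \<rho> z
  proof -
    define Z where "Z = (\<lambda>z. ((norm (z - y0))\<^sup>2 - (u z + \<rho>)\<^sup>2) / (2 * u z))"
    have rho0: "\<rho> > 0" using rho e by linarith
    have Zlow: "c1 * (norm (z - x0))\<^sup>2 / u z \<le> Z z" and Zpos: "Z z > 0" if z: "z \<in> closure \<Omega>" for z
    proof -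
      let ?t = "norm (z - y0)"
      have u0: "u z > 0" by (rule u_pos[OF z])
      \<comment> \<open>The cone bound leaves the fraction 1 - s1 of |z - y0| - r in the first
        factor of |z - y0|^2 - (u + \<rho>)^2.\<close>
      have f: "(1 - s1) * (?t - r) + (r - \<epsilon> - \<rho>) \<le> ?t - \<rho> - u z"
        using cone[OF z] by (simp add: y0_def algebra_simps)
      have p1: "0 \<le> (1 - s1) * (?t - r)" using s1 tr[OF z] by simp
      have g: "(?t + r) / 2 \<le> ?t + \<rho> + u z" using tr[OF z] u0 rho0 by simp
      have fac: "?t\<^sup>2 - (u z + \<rho>)\<^sup>2 = (?t - \<rho> - u z) * (?t + \<rho> + u z)" by (simp add: power2_eq_square algebra_simps)
      have q1: "0 < ?t - \<rho> - u z" using f p1 rho(2) by linarith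
      have q2: "0 < ?t + \<rho> + u z" using tr[OF z] r u0 rho0 by linarith
      have "0 < (?t - \<rho> - u z) * (?t + \<rho> + u z)" by (rule mult_pos_pos[OF q1 q2])
      then show "Z z > 0" unfolding Z_def fac using u0 by simp
      have "2 * (c1 * (norm (z - x0))\<^sup>2) = (1 - s1) / 2 * ((norm (z - x0))\<^sup>2 / 2)"
        by (simp add: c1_def)
      also have "\<dots> \<le> (1 - s1) / 2 * (?t\<^sup>2 - r\<^sup>2)"
        using s1 ext2[OF z] by (intro mult_left_mono) auto
      also have "\<dots> = (1 - s1) * (?t - r) * ((?t + r) / 2)"
        by (simp add: power2_eq_square field_simps)
      also have "\<dots> \<le> (?t - \<rho> - u z) * (?t + \<rho> + u z)"
      proof (rule mult_mono)
        show "(1 - s1) * (?t - r) \<le> ?t - \<rho> - u z" using f rho(2) by linarith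
      qed (use g q1 tr[OF z] r in auto)
      finally have "2 * (c1 * (norm (z - x0))\<^sup>2) \<le> ?t\<^sup>2 - (u z + \<rho>)\<^sup>2"
        unfolding fac .
      then have "2 * (c1 * (norm (z - x0))\<^sup>2) / (2 * u z) \<le> Z z"
        unfolding Z_def using u0 by (intro divide_right_mono) auto
      then show "c1 * (norm (z - x0))\<^sup>2 / u z \<le> Z z" by simp
    qed
    have cont: "continuous_on (closure \<Omega>) (\<lambda>z. \<eta> z / Z z)"
    proof -
      have "continuous_on (closure \<Omega>) Z"
        unfolding Z_def using u_pos by (intro continuous_intros continuous_on_u) force
      moreover have "continuous_on (closure \<Omega>) \<eta>"
        unfolding \<eta>_def by (intro continuous_intros continuous_on_grad linear_continuous_on) 
          (simp add: B linear_conv_bounded_linear[symmetric])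
      ultimately show ?thesis using Zpos by (intro continuous_on_divide) force+
    qed
    have ne: "closure \<Omega> \<noteq> {}" using x0cl by auto
    obtain v where v: "v \<in> closure \<Omega>" "\<And>y. y \<in> closure \<Omega> \<Longrightarrow> \<eta> y / Z y \<le> \<eta> v / Z v"
      using continuous_attains_sup[OF compact_closure_domain ne cont] by blast
    define k where "k = \<eta> v / Z v"
    have eqv: "\<eta> v = k * Z v" using Zpos[OF v(1)] by (simp add: k_def)
    have lek: "\<eta> y \<le> k * Z y" if "y \<in> closure \<Omega>" for y
      using v(2)[OF that] Zpos[OF that] by (simp add: k_def pos_divide_le_eq)
    have "k \<le> K"
    proof (rule ccontr)
      assume "\<not> k \<le> K"
      then have kK: "K < k" by simp
      then have KZ: "K * Z v < \<eta> v" using eqv Zpos[OF v(1)] by simp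
      have small: "Z v < \<delta>"
      proof (rule ccontr)
        assume "\<not> Z v < \<delta>"
        then have "C2 / \<delta> * \<delta> \<le> K * Z v" using K C2(1) del(1) by (intro mult_mono) auto
        then show False using KZ C2(2)[OF v(1)] del(1) by simp
      qed
      have vO: "v \<in> \<Omega>"
      proof (rule ccontr)
        assume "v \<notin> \<Omega>"
        then have vf: "v \<in> frontier \<Omega>" using closure_cases[OF v(1)] by blast
        have "c1 * (norm (v - x0))\<^sup>2 \<le> c1 * (norm (v - x0))\<^sup>2 / \<epsilon>"
          using e eps c1 by (simp add: pos_le_divide_eq mult_left_le)
        also have "\<dots> \<le> Z v" using Zlow[OF v(1)] u_boundary[OF vf] by simp
        finally have "C2 / c1 * (c1 * (norm (v - x0))\<^sup>2) \<le> K * Z v"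
          using K C2(1) c1 by (intro mult_mono) auto
        then show False using KZ C2(3)[OF vf] c1 by simp
      qed
      have dist: "norm (v - x0) < l"
      proof -
        have uv: "u v \<le> 1 + L" using u_le[OF v(1)] L[OF v(1)] e by simp
        have u0: "u v > 0" by (rule u_pos[OF v(1)])
        have "c1 * (norm (v - x0))\<^sup>2 \<le> Z v * u v" using Zlow[OF v(1)] u0 by (simp add: pos_divide_le_eq)
        also have "\<dots> < \<delta> * u v" using small u0 by simp
        also have "\<dots> \<le> \<delta> * (1 + L)" using uv del by (intro mult_left_mono) auto
        also have "\<dots> \<le> c1 * l\<^sup>2" by (rule del(3))
        finally have "(norm (v - x0))\<^sup>2 < l\<^sup>2" using c1 by simp
        then show ?thesis by (rule power2_less_imp_less) (use l in simp)
      qed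
      \<comment> \<open>The gradient is controlled along normals. The point v lies on the normal
        through its nearest boundary point x1, and N x1 is close to N x0.\<close>
      obtain x1 where x1: "x1 \<in> frontier \<Omega>" "ball v (dist v x1) \<subseteq> \<Omega>" "dist v x1 \<le> dist v x0"
        using nearest_boundary_point[OF vO] x0 by metis
      have "v \<noteq> x1" using vO x1(1) open_domain by (auto simp: frontier_def interior_open)
      then have vx1: "v = x1 + dist v x1 *\<^sub>R N x1" by (rule nearest_point_normal[OF balls x1(1,2)])
      have p1: "norm (grad u v - s *\<^sub>R N x1) \<le> \<tau> / 2"
        using close[OF x1(1), of "dist v x1"] vx1 x1(3) dist l(3) by (simp add: dist_norm)
      have "norm (x1 - x0) \<le> 2 * l"
        using x1(3) dist dist_triangle[of x1 x0 v] by (simp add: dist_norm norm_minus_commute)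
      then have "norm (N x1 - ?N) \<le> 2 * l / (2 * r)"
        using normal_lipschitz[OF balls x1(1) x0] r by (smt (verit) divide_right_mono)
      also have "\<dots> \<le> \<tau> / 2" using l(4) r by (simp add: pos_divide_le_eq)
      finally have N1: "norm (N x1 - ?N) \<le> \<tau> / 2" .
      have p: "norm (grad u v - s *\<^sub>R ?N) \<le> \<tau>"
      proof -
        have "grad u v - s *\<^sub>R ?N = (grad u v - s *\<^sub>R N x1) + s *\<^sub>R (N x1 - ?N)" by (simp add: algebra_simps)
        then have "norm (grad u v - s *\<^sub>R ?N) \<le> norm (grad u v - s *\<^sub>R N x1) + norm (s *\<^sub>R (N x1 - ?N))"
          using norm_triangle_ineq by metis
        moreover have "norm (s *\<^sub>R (N x1 - ?N)) \<le> 1 * (\<tau> / 2)"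
          unfolding norm_scaleR using sb N1 by (intro mult_mono) auto
        ultimately show ?thesis using p1 by linarith
      qed
      have d1: "norm (v - y0 - r *\<^sub>R ?N) \<le> \<tau>"
        using dist l(2) t by (simp add: y0_def)
      obtain E \<kappa> c where fr: "curvature_frame v E \<kappa> c"
        using curvature_frame_ex[OF vO] by blast
      have uv: "u v \<le> \<tau>" using u_le[OF v(1)] dist l(2) e by linarith
      have pos: "\<sigma> / wfun u v * (grad u v \<bullet> (v - y0 - (u v + Z v + \<rho>) *\<^sub>R grad u v))
        + 2 * wfun u v * (\<Sum>i\<in>UNIV. c i * \<kappa> i * (((v - y0 - (u v + Z v + \<rho>) *\<^sub>R grad u v) \<bullet> E i) * (grad u v \<bullet> E i)))
        - u v * wfun u v * \<sigma> + \<rho> * ((\<Sum>i\<in>UNIV. c i) - wfun u v * \<sigma>) > 0"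
        by (rule killing_positive[OF vO r fr bd(2) p[unfolded s_def] d1 uv less_imp_le[OF Zpos[OF v(1)]] _ _ less_imp_le[OF rho0] t[unfolded \<mu>_def s_def]])
          (use small del(2) rho e in auto)
      have kpos: "k > 0" using kK K(1) by simp
      have "\<sigma> / wfun u v * (grad u v \<bullet> (v - y0 - (u v + Z v + \<rho>) *\<^sub>R grad u v))
        + 2 * wfun u v * (\<Sum>i\<in>UNIV. c i * \<kappa> i * (((v - y0 - (u v + Z v + \<rho>) *\<^sub>R grad u v) \<bullet> E i) * (grad u v \<bullet> E i)))
        - u v * wfun u v * \<sigma> + \<rho> * ((\<Sum>i\<in>UNIV. c i) - wfun u v * \<sigma>) \<le> 0"
        unfolding Z_def
      proof (rule killing_touching[OF vO B anti kpos fr])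
        fix y assume "y \<in> \<Omega>"
        then have y: "y \<in> closure \<Omega>" using Omega_closure by blast
        have "u y * \<eta> y \<le> u y * (k * Z y)" using lek[OF y] u_pos[OF y] by (intro mult_left_mono) auto
        also have "\<dots> = k * ((norm (y - y0))\<^sup>2 - (u y + \<rho>)\<^sup>2) / 2"
          using u_pos[OF y] by (simp add: Z_def)
        finally show "u y * ((b + B y) \<bullet> grad u y) \<le> k * ((norm (y - y0))\<^sup>2 - (u y + \<rho>)\<^sup>2) / 2"
          by (simp add: \<eta>_def)
      next
        show "(b + B v) \<bullet> grad u v = k * (((norm (v - y0))\<^sup>2 - (u v + \<rho>)\<^sup>2) / (2 * u v))"
          using eqv by (simp add: \<eta>_def Z_def)
      qed
      then show False using pos by linarith
    qed
    then have "\<eta> z \<le> K * Z z"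
      using lek[OF z] Zpos[OF z] mult_right_mono[of k K "Z z"] by linarith
    then have "u z * \<eta> z \<le> u z * (K * Z z)" using u_pos[OF z] by (intro mult_left_mono) auto
    then show ?thesis using u_pos[OF z] by (simp add: Z_def)
  qed
  have lim: "u z * \<eta> z \<le> K * ((norm (z - y0))\<^sup>2 - (u z + (r - \<epsilon>))\<^sup>2) / 2" if z: "z \<in> closure \<Omega>" for z
  proof -
    let ?g = "\<lambda>\<rho>. K * ((norm (z - y0))\<^sup>2 - (u z + \<rho>)\<^sup>2) / 2"
    have "(?g \<longlongrightarrow> ?g (r - \<epsilon>)) (at_left (r - \<epsilon>))" by (intro tendsto_intros) auto
    moreover have "\<forall>\<^sub>F \<rho> in at_left (r - \<epsilon>). u z * \<eta> z \<le> ?g \<rho>"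
      unfolding eventually_at_left_field using main[OF _ _ z] eps by (intro exI[of _ "r - 2 * \<epsilon>"]) auto
    ultimately show ?thesis by (intro tendsto_lowerbound) auto
  qed
  define Xb where "Xb = b + B x0"
  define \<gamma> where "\<gamma> = (\<lambda>t. x0 + t *\<^sub>R ?N)"
  have cl: "\<gamma> t \<in> closure \<Omega>" if t: "0 \<le> t" "t < 2 * r" for t
  proof (cases "t = 0")
    case True
    then show ?thesis using x0cl by (simp add: \<gamma>_def)
  next
    case False
    have "\<gamma> t - (x0 + (2 * r) *\<^sub>R ?N) = (t - 2 * r) *\<^sub>R ?N" by (simp add: \<gamma>_def algebra_simps)
    then have "norm (\<gamma> t - (x0 + (2 * r) *\<^sub>R ?N)) = \<bar>t - 2 * r\<bar>" using bd(2) by simp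
    then have "\<gamma> t \<in> ball (x0 + (2 * r) *\<^sub>R ?N) (2 * r)"
      using t False by (simp only: mem_ball dist_norm norm_minus_commute)
    then show ?thesis using bd(3) Omega_closure by blast
  qed
  \<comment> \<open>Along the inner normal h \<le> 0 and h 0 = 0, so the derivative at 0 is at most
    0. It contains \<epsilon> times the mixed second derivative, and the light-cone part is K r (1 -
    \<pi>), at most 2 K r.\<close>
  define h where "h = (\<lambda>t. u (\<gamma> t) * \<eta> (\<gamma> t) - K / 2 * ((norm (\<gamma> t - y0))\<^sup>2 - (u (\<gamma> t) + (r - \<epsilon>))\<^sup>2))"
  have hle: "h t \<le> 0" if "0 \<le> t" "t < 2 * r" for t
    using lim[OF cl[OF that]] by (simp add: h_def)
  define \<pi> where "\<pi> = ?N \<bullet> grad u x0"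
  have gp: "grad u x0 = \<pi> *\<^sub>R ?N" unfolding \<pi>_def by (rule boundary_gradient[OF balls x0])
  have ux: "u x0 = \<epsilon>" by (rule u_boundary[OF x0])
  have eta0: "\<eta> x0 = 0" using tang by (simp add: \<eta>_def gp)
  have ny: "norm (\<gamma> t - y0) = \<bar>t + r\<bar>" for t
  proof -
    have "\<gamma> t - y0 = (t + r) *\<^sub>R ?N" by (simp add: \<gamma>_def y0_def algebra_simps)
    then show ?thesis using bd(2) by simp
  qed
  have "h 0 = 0" using r by (simp add: h_def \<gamma>_def eta0[unfolded \<gamma>_def] ny[of 0, unfolded \<gamma>_def, simplified] ux)
  have x0': "x0 + 0 *\<^sub>R ?N \<in> closure \<Omega>" using x0cl by simp
  have dX: "((\<lambda>t. b + B (\<gamma> t)) has_vector_derivative B ?N) (at 0)"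
    unfolding \<gamma>_def by (simp add: linear_add[OF B] linear_cmul[OF B]) (auto intro!: derivative_eq_intros)
  have d\<eta>: "((\<lambda>t. \<eta> (\<gamma> t)) has_real_derivative (Xb \<bullet> (hess u x0 *v ?N) + B ?N \<bullet> grad u x0)) (at 0)"
    using has_real_derivative_inner[OF dX[unfolded \<gamma>_def] grad_line[OF x0']] unfolding \<eta>_def
    by (simp add: Xb_def \<gamma>_def)
  have du: "((\<lambda>t. u (\<gamma> t)) has_real_derivative \<pi>) (at 0)"
    unfolding \<gamma>_def \<pi>_def using u_line[of x0 0 ?N] x0cl by simp
  have dn: "((\<lambda>t. (norm (\<gamma> t - y0))\<^sup>2) has_real_derivative 2 * r) (at 0)"
    unfolding ny by (simp) (auto intro!: derivative_eq_intros)
  have dq: "((\<lambda>t. (u (\<gamma> t) + (r - \<epsilon>))\<^sup>2) has_real_derivative 2 * r * \<pi>) (at 0)"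
    by (rule DERIV_cong[OF DERIV_power[OF DERIV_add[OF du DERIV_const], of _ 2]]) (simp add: \<gamma>_def ux)
  have BN: "B ?N \<bullet> grad u x0 = 0" using anti[of ?N ?N] by (simp add: gp inner_commute)
  have dh: "(h has_real_derivative (\<epsilon> * (Xb \<bullet> (hess u x0 *v ?N)) - K / 2 * (2 * r - 2 * r * \<pi>))) (at 0)"
    unfolding h_def
    by (rule DERIV_cong[OF DERIV_diff[OF DERIV_mult[OF du d\<eta>] DERIV_cmult[OF DERIV_diff[OF dn dq]]]])
      (simp add: \<gamma>_def eta0 ux BN)
  have "\<epsilon> * (Xb \<bullet> (hess u x0 *v ?N)) - K / 2 * (2 * r - 2 * r * \<pi>) \<le> 0"
  proof (rule ccontr)
    assume "\<not> ?thesis"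
    then obtain d where d: "d > 0" "\<And>t. 0 < t \<Longrightarrow> t < d \<Longrightarrow> h 0 < h (0 + t)"
      using DERIV_pos_inc_right[OF dh] by (auto simp: not_le)
    define t where "t = min d r / 2"
    have "0 < t" "t < d" "t < 2 * r" using d r by (auto simp: t_def)
    then show False using d(2)[of t] hle[of t] \<open>h 0 = 0\<close> by simp
  qed
  moreover have "K / 2 * (2 * r - 2 * r * \<pi>) \<le> 2 * K * r"
  proof -
    have "\<bar>\<pi>\<bar> \<le> 1" using grad_less_1[OF x0cl] bd(2) by (simp add: gp)
    then have "K * r * (1 - \<pi>) \<le> K * r * 2" using K r by (intro mult_left_mono) auto
    then show ?thesis by (simp add: algebra_simps)
  qed
  ultimately show ?thesis by (simp add: Xb_def)
qed

end

section \<open>The double normal derivative\<close>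

lemma norm_matrix_vector_le:
  fixes E :: "real^'n::finite^'m::finite"
  shows "norm (E *v q) \<le> norm E * norm q"
proof -
  have "norm (E *v q) \<le> L2_set (\<lambda>i. norm (E $ i) * norm q) UNIV"
    unfolding norm_vec_def[of "E *v q"]
    by (rule L2_set_mono) (simp_all add: matrix_vector_mul_component Cauchy_Schwarz_ineq2)
  also have "\<dots> = norm E * norm q"
    by (simp add: L2_set_right_distrib[symmetric] norm_vec_def[of E] L2_set_left_distrib)
  finally show ?thesis .
qed

context steady_state_graph
begin

lemma continuous_on_Amat: "continuous_on (closure \<Omega>) (Amat u)"
proof -
  have w: "continuous_on (closure \<Omega>) (wfun u)"
    unfolding wfun_def by (intro continuous_intros continuous_on_grad)
  have gi: "continuous_on (closure \<Omega>) (\<lambda>x. grad u x $ i)" for i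
    by (intro continuous_intros continuous_on_grad)
  have gam: "continuous_on (closure \<Omega>) (gam u)"
    unfolding gam_def using w_pos
    by (intro continuous_on_vec_lambda continuous_intros w gi) (force simp: add_pos_pos)
  have mm: "continuous_on S (\<lambda>x. F x ** G x)" if "continuous_on S F" "continuous_on S G"
    for S :: "(real^'n) set" and F G :: "real^'n \<Rightarrow> real^'n^'n"
    unfolding matrix_matrix_mult_def
    by (intro continuous_on_vec_lambda continuous_intros that)
  show ?thesis
    unfolding Amat_def using w_pos
    by (intro continuous_intros w continuous_on_u mm gam continuous_on_hess) force
qed

lemma tangential_vector_bounds:
  assumes balls: "two_sided_balls \<Omega> r N" and x: "x \<in> frontier \<Omega>" and v: "v \<bullet> N x = 0"
    and mixed: "\<And>a. norm a = 1 \<Longrightarrow> a \<bullet> N x = 0 \<Longrightarrow> \<bar>\<epsilon> * (a \<bullet> (hess u x *v N x))\<bar> \<le> C"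
  shows "\<bar>v \<bullet> (hess u x *v v)\<bar> \<le> 6 / r * (norm v)\<^sup>2" "\<bar>\<epsilon> * (v \<bullet> (hess u x *v N x))\<bar> \<le> C * norm v"
proof -
  let ?H = "hess u x"
  have "\<bar>v \<bullet> (?H *v v)\<bar> \<le> 6 / r * (norm v)\<^sup>2 \<and> \<bar>\<epsilon> * (v \<bullet> (?H *v N x))\<bar> \<le> C * norm v"
  proof (cases "v = 0")
    case False
    define a where "a = (1 / norm v) *\<^sub>R v"
    have a: "norm a = 1" "a \<bullet> N x = 0" using False v by (simp_all add: a_def)
    have va: "v = norm v *\<^sub>R a" using False by (simp add: a_def)
    have 1: "\<bar>a \<bullet> (?H *v a)\<bar> * (norm v)\<^sup>2 \<le> 6 / r * (norm v)\<^sup>2"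
      using tangential_bounds(2)[OF balls x a] by (intro mult_right_mono) auto
    have 2: "\<bar>\<epsilon> * (a \<bullet> (?H *v N x))\<bar> * norm v \<le> C * norm v"
      using mixed[OF a] by (intro mult_right_mono) auto
    have "v \<bullet> (?H *v v) = (norm v)\<^sup>2 * (a \<bullet> (?H *v a))"
      by (subst (1 2) va) (simp add: matrix_vector_mult_scaleR power2_eq_square)
    moreover have "v \<bullet> (?H *v N x) = norm v * (a \<bullet> (?H *v N x))"
      by (subst va) simp
    ultimately show ?thesis using 1 2 by (simp add: abs_mult mult.commute mult.left_commute)
  qed simp
  then show "\<bar>v \<bullet> (?H *v v)\<bar> \<le> 6 / r * (norm v)\<^sup>2" "\<bar>\<epsilon> * (v \<bullet> (?H *v N x))\<bar> \<le> C * norm v" by blast+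
qed

text \<open>(F8) concerns tuples stretched along one axis, whereas N need not be an eigenvector. The
  supporting functional at a nearby point converts (F8) into 1 + e0 / 2 \<le> sum c_i + R c_j for
  every j; averaging over j with the weights (q_j\<cdot>N)^2 spreads the stretch over the
  frame.\<close>

lemma double_normal:
  fixes R e0 \<theta> \<tau> Cm r :: real and x0 :: "real^'n"
  assumes balls: "two_sided_balls \<Omega> r N" and x0: "x0 \<in> frontier \<Omega>"
    and R: "R \<ge> 0" and growth: "\<And>i. 1 + e0 / 2 \<le> f ((\<chi> j. 1) + R *\<^sub>R axis i 1)" and e0: "e0 > 0"
    and th: "0 < \<theta>" "1 + e0 / 4 \<le> (1 - 3 * \<theta>) * (1 + e0 / 2)"
    and t: "0 < \<tau>" "\<tau> \<le> slope \<sigma>" "\<sigma>\<^sup>2 * \<tau> < e0 / 4"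
    and close: "norm (grad u x0 - slope \<sigma> *\<^sub>R N x0) \<le> \<tau>"
    and e: "\<epsilon> * (6 / r) \<le> \<theta>"
    and mixed: "\<And>a. norm a = 1 \<Longrightarrow> a \<bullet> N x0 = 0 \<Longrightarrow> \<bar>\<epsilon> * (a \<bullet> (hess u x0 *v N x0))\<bar> \<le> Cm"
  shows "mform u x0 (N x0) (N x0) \<le> Cm\<^sup>2 / \<theta> + (1 + R)"
proof (rule ccontr)
  let ?N = "N x0" and ?H = "hess u x0"
  assume "\<not> ?thesis"
  then have m: "1 + R \<le> mform u x0 ?N ?N - Cm\<^sup>2 / \<theta>" by simp
  note bd = two_sided_ballsD[OF balls x0]
  have x0cl: "x0 \<in> closure \<Omega>" using frontier_closure[OF x0] .
  have ux: "u x0 = \<epsilon>" by (rule u_boundary[OF x0])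
  define w where "w = wfun u x0"
  have w: "0 < w" "w \<le> 1" using w_pos[OF x0cl] wfun_le_1[OF grad_less_1[OF x0cl]] by (simp_all add: w_def)
  have NN: "?N \<bullet> ?N = 1" using bd(2) by (simp add: norm_eq_1)
  define \<pi> where "\<pi> = ?N \<bullet> grad u x0"
  have gp: "grad u x0 = \<pi> *\<^sub>R ?N" unfolding \<pi>_def by (rule boundary_gradient[OF balls x0])
  have pi2: "\<pi>\<^sup>2 = (1 - w) * (1 + w)"
    using wfun_square[OF grad_less_1[OF x0cl]] bd(2) by (simp add: gp w_def power2_eq_square algebra_simps)
  have th1: "0 \<le> 1 - 3 * \<theta>"
  proof (rule ccontr)
    assume "\<not> ?thesis"
    then have "(1 - 3 * \<theta>) * (1 + e0 / 2) \<le> 0" using e0 by (intro mult_nonpos_nonneg) auto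
    then show False using th e0 by simp
  qed
  \<comment> \<open>One \<theta> pays for the tangential block, the other for the mixed entries via
    the arithmetic-geometric mean inequality, which takes Cm^2 / \<theta> from the normal
    entry.\<close>
  have lower: "(1 - 2 * \<theta>) / w * ((norm q)\<^sup>2 + R * (q \<bullet> ?N)\<^sup>2) \<le> q \<bullet> (Amat u x0 *v q)" for q
  proof -
    define n where "n = q \<bullet> ?N"
    define q' where "q' = q - n *\<^sub>R ?N"
    define k where "k = n / w"
    have qN: "q' \<bullet> ?N = 0" by (simp add: q'_def n_def inner_diff_left NN)
    have nq: "(norm q)\<^sup>2 = (norm q')\<^sup>2 + n\<^sup>2"
      using norm_add_scaleR_unit[OF bd(2), of q' n] qN by (simp add: q'_def)
    have "gam u x0 *v q = q + (\<pi>\<^sup>2 * n / (w * (1 + w))) *\<^sub>R ?N"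
      unfolding gam_vec[OF grad_less_1[OF x0cl]]
      by (simp add: gp n_def w_def[symmetric] inner_commute[of ?N q] power2_eq_square)
    also have "\<pi>\<^sup>2 * n / (w * (1 + w)) = k - n"
    proof -
      have "(1 - w) * (1 + w) * n / (w * (1 + w)) = (1 - w) * n * (1 + w) / (w * (1 + w))" by simp
      also have "\<dots> = (1 - w) * n / w" using w by (intro mult_divide_mult_cancel_right) simp
      also have "\<dots> = k - n" using w by (simp add: k_def left_diff_distrib diff_divide_distrib)
      finally show ?thesis unfolding pi2 .
    qed
    finally have gq: "gam u x0 *v q = q' + k *\<^sub>R ?N" by (simp add: q'_def algebra_simps)
    have hs: "?N \<bullet> (?H *v q') = q' \<bullet> (?H *v ?N)" by (rule hess_dot[OF x0cl])
    have mf: "mform u x0 (q' + k *\<^sub>R ?N) (q' + k *\<^sub>R ?N)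
        = (norm q')\<^sup>2 - \<epsilon> * (q' \<bullet> (?H *v q')) - 2 * k * (\<epsilon> * (q' \<bullet> (?H *v ?N))) + k\<^sup>2 * mform u x0 ?N ?N"
      unfolding mform_def gform_def power2_norm_eq_inner ux gp
      by (simp add: matrix_vector_right_distrib matrix_vector_mult_scaleR inner_add_left inner_add_right hs
          qN NN inner_commute[of ?N q'] power2_eq_square algebra_simps)
    note tv = tangential_vector_bounds[OF balls x0 qN mixed]
    have mix: "\<bar>\<epsilon> * (q' \<bullet> (?H *v ?N))\<bar> \<le> Cm * norm q'" by (rule tv(2))
    have "\<epsilon> * (q' \<bullet> (?H *v q')) \<le> \<epsilon> * (6 / r * (norm q')\<^sup>2)"
      using tv(1) eps by (intro mult_left_mono) auto
    also have "\<dots> \<le> \<theta> * (norm q')\<^sup>2" using mult_right_mono[OF e, of "(norm q')\<^sup>2"] by simp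
    finally have tan: "\<epsilon> * (q' \<bullet> (?H *v q')) \<le> \<theta> * (norm q')\<^sup>2" .
    have amgm: "2 * k * (\<epsilon> * (q' \<bullet> (?H *v ?N))) \<le> \<theta> * (norm q')\<^sup>2 + k\<^sup>2 * (Cm\<^sup>2 / \<theta>)"
    proof -
      have "2 * k * (\<epsilon> * (q' \<bullet> (?H *v ?N))) \<le> 2 * \<bar>k\<bar> * (Cm * norm q')"
      proof -
        have "k * (\<epsilon> * (q' \<bullet> (?H *v ?N))) \<le> \<bar>k\<bar> * \<bar>\<epsilon> * (q' \<bullet> (?H *v ?N))\<bar>"
          by (metis abs_ge_self abs_mult)
        also have "\<dots> \<le> \<bar>k\<bar> * (Cm * norm q')" using mix by (intro mult_left_mono) auto
        finally show ?thesis by simp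
      qed
      moreover have "0 \<le> (\<theta> * norm q' - \<bar>k\<bar> * Cm)\<^sup>2 / \<theta>" using th by simp
      moreover have "(\<theta> * norm q' - \<bar>k\<bar> * Cm)\<^sup>2 / \<theta> = \<theta> * (norm q')\<^sup>2 - 2 * \<bar>k\<bar> * (Cm * norm q') + k\<^sup>2 * (Cm\<^sup>2 / \<theta>)"
      proof -
        have "(\<theta> * norm q' - \<bar>k\<bar> * Cm)\<^sup>2 = \<theta> * (\<theta> * (norm q')\<^sup>2) - \<theta> * (2 * \<bar>k\<bar> * (Cm * norm q')) + k\<^sup>2 * Cm\<^sup>2"
          by (simp add: power2_diff power_mult_distrib) (simp add: power2_eq_square)
        then show ?thesis using th by (simp add: add_divide_distrib diff_divide_distrib)
      qed
      ultimately show ?thesis by linarith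
    qed
    have k2: "n\<^sup>2 \<le> k\<^sup>2"
    proof -
      have "w\<^sup>2 \<le> 1" using w by (simp add: power_le_one)
      then have "n\<^sup>2 * w\<^sup>2 \<le> n\<^sup>2" by (simp add: mult_left_le)
      then show ?thesis using w by (simp add: k_def power_divide pos_le_divide_eq)
    qed
    have "(1 - 2 * \<theta>) * ((norm q)\<^sup>2 + R * n\<^sup>2) = (1 - 2 * \<theta>) * (norm q')\<^sup>2 + (1 - 2 * \<theta>) * ((1 + R) * n\<^sup>2)"
      unfolding nq by (simp add: algebra_simps)
    also have "(1 - 2 * \<theta>) * ((1 + R) * n\<^sup>2) \<le> 1 * ((1 + R) * n\<^sup>2)"
      using th R by (intro mult_right_mono) auto
    also have "1 * ((1 + R) * n\<^sup>2) \<le> (mform u x0 ?N ?N - Cm\<^sup>2 / \<theta>) * k\<^sup>2"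
      unfolding mult_1 using m k2 R by (intro mult_mono) auto
    finally have "(1 - 2 * \<theta>) * ((norm q)\<^sup>2 + R * n\<^sup>2) \<le> (1 - 2 * \<theta>) * (norm q')\<^sup>2 + (mform u x0 ?N ?N - Cm\<^sup>2 / \<theta>) * k\<^sup>2"
      by simp
    also have "\<dots> \<le> mform u x0 (q' + k *\<^sub>R ?N) (q' + k *\<^sub>R ?N)"
      unfolding mf using tan amgm by (simp add: algebra_simps)
    finally show ?thesis
      unfolding Amat_form[OF grad_less_1[OF x0cl]] gq w_def[symmetric] n_def[symmetric]
      using w by (simp add: divide_right_mono)
  qed
  have "\<theta> / w > 0" using th w by simp
  \<comment> \<open>The equation holds inside the domain only, so the lower bound is moved from x0
    to a nearby interior point; the perturbation of \<open>Amat\<close> costs a third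
    \<theta>.\<close>
  then obtain d where d: "d > 0" "\<And>z. z \<in> closure \<Omega> \<Longrightarrow> dist z x0 < d \<Longrightarrow> dist (Amat u z) (Amat u x0) < \<theta> / w"
    using continuous_on_Amat x0cl unfolding continuous_on_iff by metis
  obtain z where z: "z \<in> \<Omega>" "dist z x0 < d" using x0cl d(1) closure_approachable by blast
  have nA: "norm (Amat u z - Amat u x0) < \<theta> / w"
    using d(2)[OF Omega_closure[OF z(1)] z(2)] by (simp add: dist_norm)
  obtain q \<kappa> where q: "orthonormal_frame q" "\<And>i. Amat u z *v q i = \<kappa> i *\<^sub>R q i"
    "(\<chi> i. \<kappa> i) \<in> Kpos" "f (\<chi> i. \<kappa> i) = \<sigma>" using spectral_curvatures[OF z(1)] by blast
  obtain c where c: "\<And>i. c i > 0" "(\<Sum>i\<in>UNIV. c i * (\<chi> i. \<kappa> i) $ i) = f (\<chi> i. \<kappa> i)"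
    "\<And>mu. mu \<in> Kpos \<Longrightarrow> f mu \<le> (\<Sum>i\<in>UNIV. c i * mu $ i)"
    using supporting_functional[OF F q(3)] by blast
  define \<omega> where "\<omega> = (\<lambda>i. (q i \<bullet> ?N)\<^sup>2)"
  have omega: "(\<Sum>i\<in>UNIV. \<omega> i) = 1"
    using orthonormal_frame_inner[OF q(1), of ?N ?N] NN by (simp add: \<omega>_def power2_eq_square)
  have kap: "(1 - 3 * \<theta>) / w * (1 + R * \<omega> i) \<le> \<kappa> i" for i
  proof -
    note q1 = orthonormal_frameD(3)[OF q(1), of i]
    have "\<kappa> i = q i \<bullet> (Amat u z *v q i)" using orthonormal_frameD(1)[OF q(1), of i] by (simp add: q(2))
    also have "\<dots> = q i \<bullet> (Amat u x0 *v q i) + q i \<bullet> ((Amat u z - Amat u x0) *v q i)"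
      by (simp add: matrix_vector_mult_diff_rdistrib inner_diff_right)
    finally have k: "\<kappa> i = q i \<bullet> (Amat u x0 *v q i) + q i \<bullet> ((Amat u z - Amat u x0) *v q i)" .
    have "\<bar>q i \<bullet> ((Amat u z - Amat u x0) *v q i)\<bar> \<le> norm (Amat u z - Amat u x0)"
      using Cauchy_Schwarz_ineq2[of "q i" "(Amat u z - Amat u x0) *v q i"]
        norm_matrix_vector_le[of "Amat u z - Amat u x0" "q i"] q1 by simp
    moreover have "(1 - 2 * \<theta>) / w * (1 + R * \<omega> i) \<le> q i \<bullet> (Amat u x0 *v q i)"
      using lower[of "q i"] q1 by (simp add: \<omega>_def)
    moreover have "(1 - 3 * \<theta>) / w * (1 + R * \<omega> i) \<le> (1 - 2 * \<theta>) / w * (1 + R * \<omega> i) - \<theta> / w"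
    proof -
      have "\<theta> / w * 1 \<le> \<theta> / w * (1 + R * \<omega> i)"
        using th w R by (intro mult_left_mono) (auto simp: \<omega>_def)
      moreover have "(1 - 2 * \<theta>) / w * (1 + R * \<omega> i) - (1 - 3 * \<theta>) / w * (1 + R * \<omega> i) = \<theta> / w * (1 + R * \<omega> i)"
        by (simp only: left_diff_distrib[symmetric] diff_divide_distrib[symmetric]) simp
      ultimately show ?thesis by linarith
    qed
    ultimately show ?thesis using k nA by linarith
  qed
  have growth': "1 + e0 / 2 \<le> (\<Sum>i\<in>UNIV. c i) + R * c j" for j
  proof -
    have "(\<chi> j. 1) + R *\<^sub>R axis j 1 \<in> Kpos" using R by (auto simp: Kpos_def axis_def)
    from c(3)[OF this] growth[of j]
    have "1 + e0 / 2 \<le> (\<Sum>i\<in>UNIV. c i * ((\<chi> j. 1) + R *\<^sub>R axis j 1) $ i)" by linarith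
    also have "\<dots> = (\<Sum>i\<in>UNIV. c i + (if i = j then R * c i else 0))"
      by (intro sum.cong refl) (auto simp: axis_def algebra_simps)
    finally show ?thesis by (simp add: sum.distrib)
  qed
  have "1 + e0 / 2 = (\<Sum>j\<in>UNIV. \<omega> j * (1 + e0 / 2))" by (simp add: sum_distrib_right[symmetric] omega)
  also have "\<dots> \<le> (\<Sum>j\<in>UNIV. \<omega> j * ((\<Sum>i\<in>UNIV. c i) + R * c j))"
    using growth' by (intro sum_mono mult_left_mono) (auto simp: \<omega>_def)
  also have "\<dots> = (\<Sum>j\<in>UNIV. \<omega> j) * (\<Sum>i\<in>UNIV. c i) + (\<Sum>j\<in>UNIV. R * (c j * \<omega> j))"
    unfolding sum_distrib_right sum.distrib[symmetric] by (intro sum.cong refl) (simp add: algebra_simps)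
  also have "\<dots> = (\<Sum>i\<in>UNIV. c i * (1 + R * \<omega> i))"
    unfolding omega by (simp add: sum.distrib distrib_left mult.left_commute)
  finally have S: "1 + e0 / 2 \<le> (\<Sum>i\<in>UNIV. c i * (1 + R * \<omega> i))" .
  have "(1 - 3 * \<theta>) / w * (1 + e0 / 2) \<le> (1 - 3 * \<theta>) / w * (\<Sum>i\<in>UNIV. c i * (1 + R * \<omega> i))"
    using th1 w S by (intro mult_left_mono) auto
  also have "\<dots> = (\<Sum>i\<in>UNIV. c i * ((1 - 3 * \<theta>) / w * (1 + R * \<omega> i)))"
    by (simp add: sum_distrib_left ac_simps)
  also have "\<dots> \<le> (\<Sum>i\<in>UNIV. c i * \<kappa> i)"
    using kap c(1) by (intro sum_mono mult_left_mono) (auto simp: less_imp_le)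
  also have "\<dots> = \<sigma>" using c(2) q(4) by simp
  finally have "(1 - 3 * \<theta>) * (1 + e0 / 2) \<le> w * \<sigma>" using w by (simp add: field_simps)
  moreover have "w * \<sigma> \<le> 1 + \<sigma>\<^sup>2 * \<tau>"
    unfolding w_def by (rule wfun_upper[OF x0cl bd(2) close]) (use t in auto)
  ultimately show False using th(2) t(3) by linarith
qed

end

section \<open>Geometry of the domain near its boundary\<close>

lemma smooth_on_Taylor:
  fixes g :: "real^'n::finite \<Rightarrow> real"
  assumes g: "smooth_on U g" and C: "compact C" "convex C" "C \<subseteq> U"
  obtains K where "K \<ge> 0" "\<And>x y. x \<in> C \<Longrightarrow> y \<in> C \<Longrightarrow> \<bar>g y - g x - (y - x) \<bullet> grad g x\<bar> \<le> K * (norm (y - x))\<^sup>2"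
    "\<And>x y. x \<in> C \<Longrightarrow> y \<in> C \<Longrightarrow> norm (grad g y - grad g x) \<le> K * norm (y - x)"
    "\<And>x. x \<in> C \<Longrightarrow> norm (hess g x) \<le> K"
proof -
  have "continuous_on U (hess g)"
    using hess_has_derivative[OF g] by (meson has_derivative_continuous continuous_at_imp_continuous_on)
  then have "compact (hess g ` C)" using C by (meson compact_continuous_image continuous_on_subset)
  then have "\<exists>K>0. \<forall>A\<in>hess g ` C. norm A \<le> K"
    using compact_imp_bounded bounded_pos by metis
  then obtain K where K: "K > 0" "\<And>x. x \<in> C \<Longrightarrow> norm (hess g x) \<le> K" by auto
  have lip: "norm (grad g y - grad g x) \<le> K * norm (y - x)" if xy: "x \<in> C" "y \<in> C" for x y
  proof (rule differentiable_bound[OF C(2) _ _ xy(2,1)])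
    fix z assume z: "z \<in> C"
    show "(grad g has_derivative (\<lambda>h. hess g z *v h)) (at z within C)"
      using grad_has_derivative[OF g] z C(3) has_derivative_at_withinI by blast
    show "onorm ((*v) (hess g z)) \<le> K"
      by (rule onorm_bound)
        (use K(1) order_trans[OF norm_matrix_vector_le mult_right_mono[OF K(2)[OF z] norm_ge_zero]] in auto)
  qed
  have tay: "\<bar>g y - g x - (y - x) \<bullet> grad g x\<bar> \<le> K * (norm (y - x))\<^sup>2" if xy: "x \<in> C" "y \<in> C" for x y
  proof -
    have seg: "closed_segment x y \<subseteq> C" using closed_segment_subset[OF xy C(2)] .
    have "norm ((g y - y \<bullet> grad g x) - (g x - x \<bullet> grad g x)) \<le> (K * norm (y - x)) * norm (y - x)"
    proof (rule differentiable_bound[OF convex_closed_segment[of x y]])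
      fix z assume z: "z \<in> closed_segment x y"
      then have zC: "z \<in> C" using seg by blast
      have "((\<lambda>z. g z - z \<bullet> grad g x) has_derivative (\<lambda>h. h \<bullet> grad g z - h \<bullet> grad g x)) (at z)"
        using smooth_on_has_derivative[OF g] zC C(3)
        by (intro has_derivative_diff) (auto intro!: bounded_linear_imp_has_derivative bounded_linear_inner_left)
      then show "((\<lambda>z. g z - z \<bullet> grad g x) has_derivative (\<lambda>h. h \<bullet> grad g z - h \<bullet> grad g x)) (at z within closed_segment x y)"
        by (rule has_derivative_at_withinI)
      have "norm (z - x) \<le> norm (y - x)" using z segment_bound(1)[of z x y] by simp
      then have gz: "norm (grad g z - grad g x) \<le> K * norm (y - x)"
        using lip[OF xy(1) zC] K(1) by (meson less_imp_le mult_left_mono order_trans)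
      have hz: "norm (h \<bullet> grad g z - h \<bullet> grad g x) \<le> norm (grad g z - grad g x) * norm h" for h
        using Cauchy_Schwarz_ineq2[of h "grad g z - grad g x"] by (simp add: inner_diff_right mult.commute)
      show "onorm (\<lambda>h. h \<bullet> grad g z - h \<bullet> grad g x) \<le> K * norm (y - x)"
        by (rule onorm_bound) (use K(1) order_trans[OF hz mult_right_mono[OF gz norm_ge_zero]] in auto)
    qed auto
    then show ?thesis by (simp add: inner_diff_left power2_eq_square algebra_simps)
  qed
  show thesis using that[of K] K lip tay by (simp add: less_imp_le)
qed

lemma frontier_defining_zero:
  assumes o: "open \<Omega>" and U: "open U" "x \<in> U" and r: "smooth_on U \<rho>" "\<Omega> \<inter> U = {x\<in>U. \<rho> x < 0}"
    and x: "x \<in> frontier \<Omega>"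
  shows "\<rho> x = 0"
proof -
  have xO: "x \<notin> \<Omega>" and xc: "x \<in> closure \<Omega>" using x o by (auto simp: frontier_def interior_open)
  have "\<not> \<rho> x < 0" using xO U r(2) by blast
  moreover have "\<not> \<rho> x > 0"
  proof
    assume p: "\<rho> x > 0"
    have "isCont \<rho> x" using smooth_on_continuous[OF r(1)] U by (simp add: continuous_on_eq_continuous_at)
    then obtain d where d: "d > 0" "\<And>y. dist y x < d \<Longrightarrow> dist (\<rho> y) (\<rho> x) < \<rho> x"
      unfolding continuous_at_eps_delta using p by blast
    obtain d' where d': "d' > 0" "ball x d' \<subseteq> U" using U open_contains_ball by blast
    obtain y where y: "y \<in> \<Omega>" "dist y x < min d d'"
      using xc d(1) d'(1) unfolding closure_approachable by (metis min_less_iff_conj)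
    have "y \<in> U" using y d'(2) by (auto simp: dist_commute)
    then have "\<rho> y < 0" using y r(2) by blast
    then show False using d(2)[of y] y by (simp add: dist_real_def)
  qed
  ultimately show ?thesis by simp
qed

section \<open>Uniform balls and rigid motions nearly tangent to the boundary\<close>

text \<open>The field a + B (y - x) is a Killing field of the half-space model because B is skew;
  its normal component along S vanishes to second order at x. As a predicate in S and C it can be
  passed from local pieces to the whole boundary.\<close>

definition infinitesimal_rotation_bound ::
  "real^'n::finite \<Rightarrow> real^'n \<Rightarrow> (real^'n) set \<Rightarrow> (real^'n \<Rightarrow> real^'n) \<Rightarrow> real \<Rightarrow> bool" where
  "infinitesimal_rotation_bound x a S N C \<longleftrightarrow> (\<exists>B. linear B \<and> (\<forall>v w. v \<bullet> B w = - (w \<bullet> B v)) \<and>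
     (\<forall>v. norm (B v) \<le> C * norm v) \<and> (\<forall>y\<in>S. \<bar>(a + B (y - x)) \<bullet> N y\<bar> \<le> C * (norm (y - x))\<^sup>2))"

text \<open>With a defining function \<open>\<rho>\<close>, the rotation generator \<open>B = (k m\<^sup>T - m k\<^sup>T)/\<bar>m\<bar>\<^sup>2\<close>, \<open>m = D\<rho>(x)\<close>, \<open>k = D\<^sup>2\<rho>(x) a\<close>,
  makes \<open>a + B(y - x)\<close> tangent to the boundary to second order at \<open>x\<close>.\<close>

lemma local_geometry:
  fixes \<Omega> :: "(real^'n::finite) set"
  assumes dom: "smooth_bounded_domain \<Omega>" and p: "p \<in> frontier \<Omega>"
  obtains \<delta> r C \<nu> where "\<delta> > 0" "r > 0" "C \<ge> 0"
    "\<And>x s. x \<in> frontier \<Omega> \<inter> ball p \<delta> \<Longrightarrow> 0 < s \<Longrightarrow> s \<le> r \<Longrightarrow>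
       norm (\<nu> x) = 1 \<and> ball (x + s *\<^sub>R \<nu> x) s \<subseteq> \<Omega> \<and> ball (x - s *\<^sub>R \<nu> x) s \<inter> \<Omega> = {}"
    "\<And>x a. x \<in> frontier \<Omega> \<inter> ball p \<delta> \<Longrightarrow> norm a = 1 \<Longrightarrow> a \<bullet> \<nu> x = 0 \<Longrightarrow>
       infinitesimal_rotation_bound x a (frontier \<Omega> \<inter> ball p \<delta>) \<nu> C"
proof -
  have o: "open \<Omega>" using dom by (simp add: smooth_bounded_domain_def)
  obtain U \<rho> where U: "open U" "p \<in> U" "smooth_on U \<rho>" "\<And>x. x \<in> U \<Longrightarrow> grad \<rho> x \<noteq> 0" "\<Omega> \<inter> U = {x\<in>U. \<rho> x < 0}"
    using dom p unfolding smooth_bounded_domain_def by metis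
  obtain e where e: "e > 0" "cball p e \<subseteq> U" using U(1,2) open_contains_cball by blast
  define \<delta> where "\<delta> = e / 3"
  have d: "\<delta> > 0" "3 * \<delta> = e" using e by (simp_all add: \<delta>_def)
  let ?C = "cball p e"
  have C: "compact ?C" "convex ?C" "?C \<subseteq> U" using e by auto
  obtain K where K: "K \<ge> 0" "\<And>x y. x \<in> ?C \<Longrightarrow> y \<in> ?C \<Longrightarrow> \<bar>\<rho> y - \<rho> x - (y - x) \<bullet> grad \<rho> x\<bar> \<le> K * (norm (y - x))\<^sup>2"
    "\<And>x y. x \<in> ?C \<Longrightarrow> y \<in> ?C \<Longrightarrow> norm (grad \<rho> y - grad \<rho> x) \<le> K * norm (y - x)"
    "\<And>x. x \<in> ?C \<Longrightarrow> norm (hess \<rho> x) \<le> K"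
    using smooth_on_Taylor[OF U(3) C] by metis
  have "\<forall>i. \<exists>K\<ge>0. \<forall>x\<in>?C. \<forall>y\<in>?C. \<bar>pd i \<rho> y - pd i \<rho> x - (y - x) \<bullet> grad (pd i \<rho>) x\<bar> \<le> K * (norm (y - x))\<^sup>2"
  proof
    fix i
    show "\<exists>K\<ge>0. \<forall>x\<in>?C. \<forall>y\<in>?C. \<bar>pd i \<rho> y - pd i \<rho> x - (y - x) \<bullet> grad (pd i \<rho>) x\<bar> \<le> K * (norm (y - x))\<^sup>2"
      using smooth_on_Taylor[OF smooth_on_pd[OF U(3), of i] C] by metis
  qed
  then obtain Ki where Ki: "\<And>i. Ki i \<ge> 0"
    "\<And>i x y. x \<in> ?C \<Longrightarrow> y \<in> ?C \<Longrightarrow> \<bar>pd i \<rho> y - pd i \<rho> x - (y - x) \<bullet> grad (pd i \<rho>) x\<bar> \<le> Ki i * (norm (y - x))\<^sup>2"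
    by metis
  define K3 where "K3 = (\<Sum>i\<in>UNIV. Ki i)"
  have K3: "K3 \<ge> 0" unfolding K3_def using Ki(1) by (intro sum_nonneg)
  have tay3: "norm (grad \<rho> y - grad \<rho> x - hess \<rho> x *v (y - x)) \<le> K3 * (norm (y - x))\<^sup>2" if xy: "x \<in> ?C" "y \<in> ?C" for x y
  proof -
    let ?v = "grad \<rho> y - grad \<rho> x - hess \<rho> x *v (y - x)"
    have xU: "x \<in> U" using xy C by blast
    have "norm ?v \<le> (\<Sum>i\<in>UNIV. \<bar>?v $ i\<bar>)" by (rule norm_le_l1_cart)
    also have "\<dots> \<le> (\<Sum>i\<in>UNIV. Ki i * (norm (y - x))\<^sup>2)"
    proof (rule sum_mono)
      fix i
      have "?v $ i = pd i \<rho> y - pd i \<rho> x - (y - x) \<bullet> grad (pd i \<rho>) x"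
        by (simp add: grad_def hess_def matrix_vector_mult_def inner_vec_def pd_commute[OF U(3) xU, of i] mult.commute)
      then show "\<bar>?v $ i\<bar> \<le> Ki i * (norm (y - x))\<^sup>2" using Ki(2)[OF xy, of i] by simp
    qed
    also have "\<dots> = K3 * (norm (y - x))\<^sup>2" by (simp add: K3_def sum_distrib_right)
    finally show ?thesis .
  qed
  have gc: "continuous_on ?C (\<lambda>x. norm (grad \<rho> x))"
    using grad_has_derivative[OF U(3)] C(3)
    by (intro continuous_on_norm continuous_at_imp_continuous_on) (meson has_derivative_continuous ballI subsetD)
  have "?C \<noteq> {}" using e by simp
  then obtain x' where x': "x' \<in> ?C" "\<And>x. x \<in> ?C \<Longrightarrow> norm (grad \<rho> x') \<le> norm (grad \<rho> x)"
    using continuous_attains_inf[OF C(1) _ gc] by blast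
  define m0 where "m0 = norm (grad \<rho> x')"
  have m0: "m0 > 0" using U(4) x'(1) C(3) by (auto simp: m0_def)
  have mge: "m0 \<le> norm (grad \<rho> x)" if "x \<in> ?C" for x using x'(2)[OF that] by (simp add: m0_def)
  have gne: "grad \<rho> x \<noteq> 0" if "x \<in> ?C" for x using U(4) that C(3) by blast
  define \<nu> where "\<nu> = (\<lambda>x. - (1 / norm (grad \<rho> x)) *\<^sub>R grad \<rho> x)"
  have nu1: "norm (\<nu> x) = 1" if "x \<in> ?C" for x using gne[OF that] by (simp add: \<nu>_def)
  have gnu: "grad \<rho> x = - norm (grad \<rho> x) *\<^sub>R \<nu> x" if "x \<in> ?C" for x
    using gne[OF that] by (simp add: \<nu>_def)
  \<comment> \<open>For s \<le> r the quadratic Taylor remainder on a ball tangent at x is dominated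
    by the linear term, since |z|^2 < 2 s z\<cdot>n there and 2 K s < m0.\<close>
  define r where "r = min \<delta> (m0 / (2 * K + 1))"
  have r: "r > 0" "r \<le> \<delta>" using d m0 K(1) by (auto simp: r_def intro!: divide_pos_pos)
  have rK: "2 * K * s < m0" if s: "0 < s" "s \<le> r" for s
  proof -
    have "s * (2 * K + 1) \<le> m0" using s K(1) by (simp add: r_def pos_le_divide_eq)
    then show ?thesis using s by (simp add: algebra_simps)
  qed
  have fr0: "\<rho> x = 0" if "x \<in> frontier \<Omega>" "x \<in> ?C" for x
    using frontier_defining_zero[OF o U(1) _ U(3,5) that(1)] that(2) C(3) by blast
  have sub: "x \<in> ?C" if "x \<in> ball p \<delta>" for x using that d by auto
  have inner: "x + z \<in> ?C \<and> (norm z)\<^sup>2 < 2 * s * (z \<bullet> n)"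
    if x: "x \<in> ball p \<delta>" and s: "0 < s" "s \<le> r" and n: "norm n = 1" and z: "norm (z - s *\<^sub>R n) < s" for x z n s
  proof
    have "(norm (z + (- s) *\<^sub>R n))\<^sup>2 < s\<^sup>2" using z by (intro power_strict_mono) auto
    then show "(norm z)\<^sup>2 < 2 * s * (z \<bullet> n)" unfolding norm_add_scaleR_unit[OF n] by simp
    have "norm z \<le> norm (z - s *\<^sub>R n) + norm (s *\<^sub>R n)" by (rule norm_triangle_sub[of z "s *\<^sub>R n", THEN order_trans]) simp
    then have "norm z < 2 * s" using z n s by simp
    then have "dist p (x + z) < \<delta> + 2 * \<delta>"
      using x s r norm_triangle_ineq4[of "p - x" z] by (simp add: dist_norm algebra_simps)
    then show "x + z \<in> ?C" using d by simp
  qed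
  have balls: "ball (x + s *\<^sub>R \<nu> x) s \<subseteq> \<Omega> \<and> ball (x - s *\<^sub>R \<nu> x) s \<inter> \<Omega> = {}"
    if x: "x \<in> frontier \<Omega> \<inter> ball p \<delta>" and s: "0 < s" "s \<le> r" for x s
  proof
    have xC: "x \<in> ?C" and xb: "x \<in> ball p \<delta>" and xf: "x \<in> frontier \<Omega>" using x sub by blast+
    note n1 = nu1[OF xC]
    have taylor: "\<bar>\<rho> (x + z) + norm (grad \<rho> x) * (z \<bullet> \<nu> x)\<bar> \<le> K * (norm z)\<^sup>2" if "x + z \<in> ?C" for z
    proof -
      have "z \<bullet> grad \<rho> x = - (norm (grad \<rho> x) * (z \<bullet> \<nu> x))"
        by (subst gnu[OF xC]) simp
      then show ?thesis using K(2)[OF xC that] fr0[OF xf xC] by simp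
    qed
    show "ball (x + s *\<^sub>R \<nu> x) s \<subseteq> \<Omega>"
    proof
      fix y assume y: "y \<in> ball (x + s *\<^sub>R \<nu> x) s"
      define z where "z = y - x"
      have "norm (z - s *\<^sub>R \<nu> x) < s" using y by (simp add: z_def dist_norm norm_minus_commute algebra_simps)
      from inner[OF xb s n1 this] have z: "x + z \<in> ?C" "(norm z)\<^sup>2 < 2 * s * (z \<bullet> \<nu> x)" by blast+
      have zn: "z \<bullet> \<nu> x > 0" using z(2) s by (smt (verit) mult_nonneg_nonpos zero_le_power2)
      have "\<rho> (x + z) \<le> K * (norm z)\<^sup>2 - norm (grad \<rho> x) * (z \<bullet> \<nu> x)" using taylor[OF z(1)] by linarith
      also have "\<dots> \<le> K * (2 * s * (z \<bullet> \<nu> x)) - m0 * (z \<bullet> \<nu> x)"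
        using z(2) K(1) mge[OF xC] zn by (intro diff_mono mult_left_mono mult_right_mono) auto
      also have "\<dots> = (2 * K * s - m0) * (z \<bullet> \<nu> x)" by (simp add: algebra_simps)
      also have "\<dots> < 0" using rK[OF s] zn by (simp add: mult_neg_pos)
      finally show "y \<in> \<Omega>" using z(1) C(3) U(5) by (auto simp: z_def)
    qed
    show "ball (x - s *\<^sub>R \<nu> x) s \<inter> \<Omega> = {}"
    proof (rule ccontr)
      assume "\<not> ?thesis"
      then obtain y where y: "y \<in> ball (x - s *\<^sub>R \<nu> x) s" "y \<in> \<Omega>" by blast
      define z where "z = y - x"
      have "norm (z - s *\<^sub>R (- \<nu> x)) < s" using y by (simp add: z_def dist_norm norm_minus_commute algebra_simps)
      from inner[OF xb s _ this] n1 have z: "x + z \<in> ?C" "(norm z)\<^sup>2 < - 2 * s * (z \<bullet> \<nu> x)" by auto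
      define q where "q = - (z \<bullet> \<nu> x)"
      have zq: "(norm z)\<^sup>2 < 2 * s * q" using z(2) by (simp add: q_def)
      have zn: "q > 0" using zq s by (smt (verit) mult_nonneg_nonpos zero_le_power2)
      have "0 < (m0 - 2 * K * s) * q" using rK[OF s] zn by simp
      also have "\<dots> = m0 * q - K * (2 * s * q)" by (simp add: algebra_simps)
      also have "\<dots> \<le> norm (grad \<rho> x) * q - K * (norm z)\<^sup>2"
        using zq K(1) mge[OF xC] zn by (intro diff_mono mult_left_mono mult_right_mono) auto
      also have "\<dots> \<le> \<rho> (x + z)" using taylor[OF z(1)] by (simp add: q_def)
      finally have "0 < \<rho> y" by (simp add: z_def)
      moreover have "y \<in> U" using z(1) C(3) by (auto simp: z_def)
      then have "y \<in> {x\<in>U. \<rho> x < 0}" using y(2) U(5) by blast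
      ultimately show False by simp
    qed
  qed
  define Cc where "Cc = 2 * K / m0 + (K * K / m0 + 2 * K * K / m0 + K3) / m0"
  have Cc: "Cc \<ge> 0" "2 * K / m0 \<le> Cc" using K(1) K3 m0 by (simp_all add: Cc_def)
  have rot: "infinitesimal_rotation_bound x a (frontier \<Omega> \<inter> ball p \<delta>) \<nu> Cc"
    if x: "x \<in> frontier \<Omega> \<inter> ball p \<delta>" and a: "norm a = 1" "a \<bullet> \<nu> x = 0" for x a
  proof -
    have xC: "x \<in> ?C" and xf: "x \<in> frontier \<Omega>" using x sub by blast+
    have xU: "x \<in> U" using xC C(3) by blast
    define m where "m = grad \<rho> x" define k where "k = hess \<rho> x *v a"
    have m: "m0 \<le> norm m" "norm m > 0" using mge[OF xC] gne[OF xC] by (simp_all add: m_def)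
    have k: "norm k \<le> K"
      using norm_matrix_vector_le[of "hess \<rho> x" a] K(4)[OF xC] a(1) by (simp add: k_def)
    have am: "a \<bullet> m = 0" unfolding m_def by (subst gnu[OF xC]) (simp add: a(2))
    define B where "B = (\<lambda>z. (1 / (norm m)\<^sup>2) *\<^sub>R ((m \<bullet> z) *\<^sub>R k - (k \<bullet> z) *\<^sub>R m))"
    have B: "linear B"
      by (rule linearI) (simp_all add: B_def inner_add_right add_divide_distrib algebra_simps)
    have anti: "v \<bullet> B w = - (w \<bullet> B v)" for v w
      by (simp add: B_def inner_diff_right inner_commute[of v] inner_commute[of w] algebra_simps diff_divide_distrib)
    have Bn: "norm (B z) \<le> 2 * K / m0 * norm z" for z
    proof -
      have "norm ((m \<bullet> z) *\<^sub>R k - (k \<bullet> z) *\<^sub>R m) \<le> \<bar>m \<bullet> z\<bar> * norm k + \<bar>k \<bullet> z\<bar> * norm m"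
        using norm_triangle_ineq4[of "(m \<bullet> z) *\<^sub>R k" "(k \<bullet> z) *\<^sub>R m"] by simp
      also have "\<dots> \<le> (norm m * norm z) * norm k + (norm k * norm z) * norm m"
        by (intro add_mono mult_right_mono Cauchy_Schwarz_ineq2) auto
      also have "\<dots> = norm m * (2 * norm k * norm z)" by simp
      finally have "norm (B z) \<le> (1 / (norm m)\<^sup>2) * (norm m * (2 * norm k * norm z))"
        unfolding B_def norm_scaleR by (simp add: divide_right_mono)
      also have "\<dots> = 2 * norm k * norm z / norm m" using m by (simp add: power2_eq_square)
      also have "\<dots> \<le> 2 * K * norm z / m0" using m k m0 K(1) by (intro frac_le mult_right_mono) auto
      finally show ?thesis by simp
    qed
    have est: "\<bar>(a + B (y - x)) \<bullet> \<nu> y\<bar> \<le> Cc * (norm (y - x))\<^sup>2" if y: "y \<in> frontier \<Omega> \<inter> ball p \<delta>" for y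
    proof -
      have yC: "y \<in> ?C" and yf: "y \<in> frontier \<Omega>" using y sub by blast+
      define z where "z = y - x"
      define E where "E = grad \<rho> y - m - hess \<rho> x *v z"
      have E: "norm E \<le> K3 * (norm z)\<^sup>2" using tay3[OF xC yC] by (simp add: E_def z_def m_def)
      have mz: "\<bar>m \<bullet> z\<bar> \<le> K * (norm z)\<^sup>2"
        using K(2)[OF xC yC] fr0[OF xf xC] fr0[OF yf yC] by (simp add: z_def m_def inner_commute)
      have Bm: "B z \<bullet> m = (k \<bullet> m) * (m \<bullet> z) / (norm m)\<^sup>2 - k \<bullet> z"
      proof -
        have "B z \<bullet> m = (1 / (norm m)\<^sup>2) * ((m \<bullet> z) * (k \<bullet> m) - (k \<bullet> z) * (norm m)\<^sup>2)"
          by (simp only: B_def inner_scaleR_left inner_diff_left power2_norm_eq_inner)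
        then show ?thesis using m(2) by (simp add: diff_divide_distrib mult.commute)
      qed
      have aH: "a \<bullet> (hess \<rho> x *v z) = k \<bullet> z"
        using symmetric_dot[OF hess_symmetric[OF U(3) xU], of a z] by (simp add: k_def inner_commute)
      \<comment> \<open>The terms k\<cdot>z cancel, which is what B is built for. The rest is
        quadratic in z, since m\<cdot>z is quadratic when x and y both lie on the boundary.\<close>
      have split: "(a + B z) \<bullet> grad \<rho> y = (k \<bullet> m) * (m \<bullet> z) / (norm m)\<^sup>2 + B z \<bullet> (grad \<rho> y - m) + a \<bullet> E"
      proof -
        have "grad \<rho> y = m + hess \<rho> x *v z + E" by (simp add: E_def)
        then have "a \<bullet> grad \<rho> y = k \<bullet> z + a \<bullet> E" by (simp add: inner_add_right am aH)
        moreover have "B z \<bullet> grad \<rho> y = B z \<bullet> m + B z \<bullet> (grad \<rho> y - m)" by (simp add: inner_diff_right)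
        ultimately show ?thesis by (simp add: inner_add_left Bm)
      qed
      have t1: "\<bar>(k \<bullet> m) * (m \<bullet> z) / (norm m)\<^sup>2\<bar> \<le> K * K / m0 * (norm z)\<^sup>2"
      proof -
        have "\<bar>k \<bullet> m\<bar> \<le> K * norm m" using Cauchy_Schwarz_ineq2[of k m] k m
          by (smt (verit) mult_right_mono)
        then have "\<bar>k \<bullet> m\<bar> * \<bar>m \<bullet> z\<bar> \<le> (K * norm m) * (K * (norm z)\<^sup>2)"
          using mz K(1) by (intro mult_mono) auto
        then have "\<bar>(k \<bullet> m) * (m \<bullet> z) / (norm m)\<^sup>2\<bar> \<le> (K * norm m) * (K * (norm z)\<^sup>2) / (norm m)\<^sup>2"
          by (simp add: abs_mult divide_right_mono)
        also have "\<dots> = K * K * (norm z)\<^sup>2 / norm m" using m by (simp add: power2_eq_square)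
        also have "\<dots> \<le> K * K * (norm z)\<^sup>2 / m0" using m m0 K(1) by (intro divide_left_mono) auto
        finally show ?thesis by simp
      qed
      have t2: "\<bar>B z \<bullet> (grad \<rho> y - m)\<bar> \<le> 2 * K * K / m0 * (norm z)\<^sup>2"
      proof -
        have "\<bar>B z \<bullet> (grad \<rho> y - m)\<bar> \<le> norm (B z) * norm (grad \<rho> y - m)" by (rule Cauchy_Schwarz_ineq2)
        also have "\<dots> \<le> (2 * K / m0 * norm z) * (K * norm z)"
          using Bn[of z] K(3)[OF xC yC] K(1) m0 by (intro mult_mono) (auto simp: m_def z_def)
        finally show ?thesis by (simp add: power2_eq_square ac_simps)
      qed
      have t3: "\<bar>a \<bullet> E\<bar> \<le> K3 * (norm z)\<^sup>2" using Cauchy_Schwarz_ineq2[of a E] a(1) E by simp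
      have "\<bar>(a + B z) \<bullet> grad \<rho> y\<bar> \<le> (K * K / m0 + 2 * K * K / m0 + K3) * (norm z)\<^sup>2"
        unfolding split distrib_right using t1 t2 t3 by linarith
      moreover have "(a + B z) \<bullet> \<nu> y = - ((a + B z) \<bullet> grad \<rho> y) / norm (grad \<rho> y)"
        by (simp add: \<nu>_def)
      ultimately have "\<bar>(a + B z) \<bullet> \<nu> y\<bar> \<le> (K * K / m0 + 2 * K * K / m0 + K3) * (norm z)\<^sup>2 / norm (grad \<rho> y)"
        by (simp add: divide_right_mono)
      also have "\<dots> \<le> (K * K / m0 + 2 * K * K / m0 + K3) * (norm z)\<^sup>2 / m0"
        using mge[OF yC] gne[OF yC] m0 K(1) K3 by (intro divide_left_mono mult_nonneg_nonneg mult_pos_pos) auto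
      also have "\<dots> = (K * K / m0 + 2 * K * K / m0 + K3) / m0 * (norm z)\<^sup>2" by simp
      also have "\<dots> \<le> Cc * (norm z)\<^sup>2" using K(1) m0 by (intro mult_right_mono) (auto simp: Cc_def)
      finally show ?thesis by (simp add: z_def)
    qed
    have "norm (B v) \<le> Cc * norm v" for v
      using Bn[of v] Cc(2) by (meson mult_right_mono norm_ge_zero order_trans)
    then show ?thesis unfolding infinitesimal_rotation_bound_def using B anti est by blast
  qed
  show thesis
    using that[OF d(1) r(1) Cc(1), of \<nu>] balls rot nu1 sub by blast
qed

lemma infinitesimal_rotation_bound_mono:
  assumes "infinitesimal_rotation_bound x a S N C" "C \<le> C'"
  shows "infinitesimal_rotation_bound x a S N C'"
  using assms unfolding infinitesimal_rotation_bound_def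
  by (meson mult_right_mono norm_ge_zero order_trans zero_le_power2)

text \<open>A finite cover by local pieces gives common constants. The normals agree on overlaps
  because touching balls determine the normal. Points at distance at least D from x, possibly in
  other pieces, are absorbed into the constant, as |y - x|^2 \<ge> D^2 there.\<close>

lemma domain_geometry:
  fixes \<Omega> :: "(real^'n::finite) set"
  assumes dom: "smooth_bounded_domain \<Omega>"
  obtains r N C where "two_sided_balls \<Omega> r N" "C \<ge> 0"
    "\<And>x a. x \<in> frontier \<Omega> \<Longrightarrow> norm a = 1 \<Longrightarrow> a \<bullet> N x = 0 \<Longrightarrow> infinitesimal_rotation_bound x a (frontier \<Omega>) N C"
proof -
  define P where "P = (\<lambda>p \<delta> r C \<nu>. \<delta> > 0 \<and> r > 0 \<and> C \<ge> 0 \<and>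
    (\<forall>x s. x \<in> frontier \<Omega> \<inter> ball p \<delta> \<longrightarrow> 0 < s \<longrightarrow> s \<le> r \<longrightarrow>
       norm (\<nu> x) = 1 \<and> ball (x + s *\<^sub>R \<nu> x) s \<subseteq> \<Omega> \<and> ball (x - s *\<^sub>R \<nu> x) s \<inter> \<Omega> = {}) \<and>
    (\<forall>x a. x \<in> frontier \<Omega> \<inter> ball p \<delta> \<longrightarrow> norm a = 1 \<longrightarrow> a \<bullet> \<nu> x = 0 \<longrightarrow>
       infinitesimal_rotation_bound x a (frontier \<Omega> \<inter> ball p \<delta>) \<nu> C))"
  have "\<exists>\<delta> r C \<nu>. P p \<delta> r C \<nu>" if "p \<in> frontier \<Omega>" for p
    by (rule local_geometry[OF dom that]) (unfold P_def, blast)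
  then obtain \<delta> r C \<nu> where lp: "\<And>p. p \<in> frontier \<Omega> \<Longrightarrow> P p (\<delta> p) (r p) (C p) (\<nu> p)" by metis
  have bd: "bounded \<Omega>" using dom by (simp add: smooth_bounded_domain_def)
  then have comp: "compact (frontier \<Omega>)" by (simp add: compact_frontier_bounded)
  have dpos: "p \<in> frontier \<Omega> \<Longrightarrow> \<delta> p > 0" for p using lp[of p] by (simp add: P_def)
  have "frontier \<Omega> \<subseteq> (\<Union>p\<in>frontier \<Omega>. ball p (\<delta> p / 2))" using dpos by force
  then obtain Q where Q: "Q \<subseteq> frontier \<Omega>" "finite Q" "frontier \<Omega> \<subseteq> (\<Union>p\<in>Q. ball p (\<delta> p / 2))"
    using compactE_image[OF comp, of "frontier \<Omega>" "\<lambda>p. ball p (\<delta> p / 2)"] by blast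
  obtain pt where pt: "\<And>x. x \<in> frontier \<Omega> \<Longrightarrow> pt x \<in> Q \<and> x \<in> ball (pt x) (\<delta> (pt x) / 2)"
    using Q(3) by (metis (no_types, lifting) UN_iff subsetD)
  define R where "R = Min (insert 1 (r ` Q))"
  define D where "D = Min (insert 1 (\<delta> ` Q)) / 2"
  define c where "c = Max (insert 0 (C ` Q))"
  have Rpos: "R > 0" unfolding R_def using Q lp by (subst Min_gr_iff) (auto simp: P_def)
  have Dpos: "D > 0" unfolding D_def using Q dpos by (auto simp: Min_gr_iff)
  have cpos: "c \<ge> 0" unfolding c_def using Q(2) by (intro Max_ge) auto
  have Rle: "R \<le> r p" and Dle: "D \<le> \<delta> p / 2" and cge: "C p \<le> c" if "p \<in> Q" for p
    using that Q(2) by (auto simp: R_def D_def c_def intro!: Min_le Max_ge divide_right_mono)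
  define N where "N = (\<lambda>x. \<nu> (pt x) x)"
  have two: "norm (\<nu> p x) = 1 \<and> ball (x + R *\<^sub>R \<nu> p x) R \<subseteq> \<Omega> \<and> ball (x - R *\<^sub>R \<nu> p x) R \<inter> \<Omega> = {}"
    if "p \<in> Q" "x \<in> frontier \<Omega>" "x \<in> ball p (\<delta> p)" for p x
    using lp[of p] Q(1) that Rpos Rle[OF that(1)] unfolding P_def by blast
  have ptb: "pt x \<in> Q" "x \<in> ball (pt x) (\<delta> (pt x))" if "x \<in> frontier \<Omega>" for x
    using pt[OF that] dpos[of "pt x"] Q(1) by (auto simp: subset_iff)
  have tsb: "two_sided_balls \<Omega> R N"
    unfolding two_sided_balls_def N_def using two ptb Rpos by blast
  have same: "\<nu> p x = N x" if "p \<in> Q" "x \<in> frontier \<Omega>" "x \<in> ball p (\<delta> p)" for p x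
  proof -
    have "norm (\<nu> p x - N x) \<le> norm (x - x) / R"
      using two[OF that] two_sided_ballsD[OF tsb that(2)]
      by (intro opposite_balls_normals[OF Rpos]) blast+
    then show ?thesis by simp
  qed
  have b': "bounded (frontier \<Omega>)" using comp compact_imp_bounded by blast
  obtain L where L: "L \<ge> 0" "\<And>x y. x \<in> frontier \<Omega> \<Longrightarrow> y \<in> frontier \<Omega> \<Longrightarrow> norm (y - x) \<le> L"
  proof -
    obtain b where b: "b > 0" "\<And>x. x \<in> frontier \<Omega> \<Longrightarrow> norm x \<le> b"
      using b' unfolding bounded_pos by blast
    have "norm (y - x) \<le> 2 * b" if "x \<in> frontier \<Omega>" "y \<in> frontier \<Omega>" for x y
      using norm_triangle_ineq4[of y x] b(2)[OF that(1)] b(2)[OF that(2)] by linarith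
    then show thesis using that[of "2 * b"] b(1) by simp
  qed
  define Cf where "Cf = c + (1 + c * L) / D\<^sup>2"
  have Cf: "c \<le> Cf" "(1 + c * L) / D\<^sup>2 \<le> Cf" using cpos L Dpos by (simp_all add: Cf_def)
  have "infinitesimal_rotation_bound x a (frontier \<Omega>) N Cf"
    if x: "x \<in> frontier \<Omega>" and a: "norm a = 1" "a \<bullet> N x = 0" for x a
  proof -
    let ?p = "pt x"
    have "infinitesimal_rotation_bound x a (frontier \<Omega> \<inter> ball ?p (\<delta> ?p)) (\<nu> ?p) (C ?p)"
      using lp[of ?p] Q(1) ptb[OF x] x a unfolding P_def N_def by blast
    then have "infinitesimal_rotation_bound x a (frontier \<Omega> \<inter> ball ?p (\<delta> ?p)) (\<nu> ?p) c"
      by (rule infinitesimal_rotation_bound_mono) (rule cge[OF ptb(1)[OF x]])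
    then obtain B where B: "linear B" "\<And>v w. v \<bullet> B w = - (w \<bullet> B v)" "\<And>v. norm (B v) \<le> c * norm v"
      "\<And>y. y \<in> frontier \<Omega> \<inter> ball ?p (\<delta> ?p) \<Longrightarrow> \<bar>(a + B (y - x)) \<bullet> \<nu> ?p y\<bar> \<le> c * (norm (y - x))\<^sup>2"
      unfolding infinitesimal_rotation_bound_def by blast
    have "\<bar>(a + B (y - x)) \<bullet> N y\<bar> \<le> Cf * (norm (y - x))\<^sup>2" if y: "y \<in> frontier \<Omega>" for y
    proof (cases "norm (y - x) < D")
      case True
      have "dist ?p y \<le> dist ?p x + dist x y" by (rule dist_triangle)
      also have "\<dots> < \<delta> ?p / 2 + \<delta> ?p / 2"
        using pt[OF x] True Dle[OF ptb(1)[OF x]] by (simp add: dist_norm norm_minus_commute[of x y])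
      finally have yb: "y \<in> ball ?p (\<delta> ?p)" by simp
      have "\<bar>(a + B (y - x)) \<bullet> N y\<bar> \<le> c * (norm (y - x))\<^sup>2"
        using B(4)[of y] y yb same[OF ptb(1)[OF x] y yb] by simp
      also have "\<dots> \<le> Cf * (norm (y - x))\<^sup>2" using Cf by (intro mult_right_mono) auto
      finally show ?thesis .
    next
      case False
      have "\<bar>(a + B (y - x)) \<bullet> N y\<bar> \<le> norm (a + B (y - x)) * norm (N y)" by (rule Cauchy_Schwarz_ineq2)
      also have "\<dots> \<le> 1 + c * L"
      proof -
        have "norm (B (y - x)) \<le> c * L" using B(3)[of "y - x"] L(2)[OF x y] cpos by (meson mult_left_mono order_trans)
        then show ?thesis using norm_triangle_ineq[of a "B (y - x)"] a(1) two_sided_ballsD(2)[OF tsb y] by simp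
      qed
      also have "\<dots> = (1 + c * L) / D\<^sup>2 * D\<^sup>2" using Dpos by simp
      also have "\<dots> \<le> Cf * (norm (y - x))\<^sup>2"
        using Cf False Dpos cpos L(1) by (intro mult_mono power_mono) auto
      finally show ?thesis .
    qed
    moreover have "norm (B v) \<le> Cf * norm v" for v
      using B(3)[of v] Cf(1) by (meson mult_right_mono norm_ge_zero order_trans)
    ultimately show ?thesis unfolding infinitesimal_rotation_bound_def using B(1,2) by blast
  qed
  then show thesis using that[OF tsb, of Cf] cpos Cf(1) by force
qed

section \<open>The boundary estimate\<close>

context steady_state_graph
begin

text \<open>The one-sided bound is applied to the Killing field and to its negative. The Killing
  derivative is at most 1 + C L everywhere and at most C |z - x0|^2 on the boundary, where Du is
  normal; 1 + C L + C serves as one constant for both.\<close>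

lemma mixed_two_sided:
  fixes x0 a :: "real^'n" and r L s1 C \<tau> D :: real
  defines "s \<equiv> slope \<sigma>"
  defines "\<mu> \<equiv> r * (1 - s) / s"
  defines "c1 \<equiv> (1 - s1) / 8"
  defines "l \<equiv> min (\<tau> / 2) (min D (\<tau> * r / 2))"
  defines "\<delta> \<equiv> min \<tau> (c1 * l\<^sup>2 / (1 + L))"
  defines "K \<equiv> (1 + C * L + C) / c1 + (1 + C * L + C) / \<delta> + 1"
  assumes balls: "two_sided_balls \<Omega> (2 * r) N" and x0: "x0 \<in> frontier \<Omega>"
    and L: "\<And>z. z \<in> closure \<Omega> \<Longrightarrow> norm (z - x0) \<le> L"
    and C: "C \<ge> 0" "infinitesimal_rotation_bound x0 a (frontier \<Omega>) N C"
    and a: "norm a = 1" "a \<bullet> N x0 = 0"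
    and s1: "0 \<le> s1" "s1 < 1" and cone: "\<And>z. z \<in> closure \<Omega> \<Longrightarrow> u z \<le> \<epsilon> + s1 * (norm (z - (x0 - r *\<^sub>R N x0)) - r)"
    and D: "D > 0" and close: "\<And>x1 d. x1 \<in> frontier \<Omega> \<Longrightarrow> 0 \<le> d \<Longrightarrow> d \<le> D \<Longrightarrow>
        norm (grad u (x1 + d *\<^sub>R N x1) - s *\<^sub>R N x1) \<le> \<tau> / 2"
    and t: "0 < \<tau>" "\<tau> \<le> 1" "\<tau> \<le> s / 2" "24 * (r / s + 4) * \<tau> \<le> \<mu> * s\<^sup>2"
      "16 * (\<sigma> + (r + 1) * \<sigma>\<^sup>2) * \<tau> \<le> \<sigma> * \<mu> * s\<^sup>2"
    and e: "\<epsilon> \<le> 1" "2 * \<epsilon> \<le> \<tau>" "2 * \<epsilon> < r"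
  shows "\<bar>\<epsilon> * (a \<bullet> (hess u x0 *v N x0))\<bar> \<le> 2 * K * r"
proof -
  obtain B where B: "linear B" "\<And>v w. v \<bullet> B w = - (w \<bullet> B v)" "\<And>v. norm (B v) \<le> C * norm v"
    "\<And>y. y \<in> frontier \<Omega> \<Longrightarrow> \<bar>(a + B (y - x0)) \<bullet> N y\<bar> \<le> C * (norm (y - x0))\<^sup>2"
    using C(2) unfolding infinitesimal_rotation_bound_def by blast
  have x0cl: "x0 \<in> closure \<Omega>" using frontier_closure[OF x0] .
  have L0: "L \<ge> 0" using L[OF x0cl] by simp
  have one: "\<epsilon> * ((j *\<^sub>R a) \<bullet> (hess u x0 *v N x0)) \<le> 2 * K * r" if j: "\<bar>j\<bar> = 1" for j
  proof -
    define b where "b = j *\<^sub>R a - j *\<^sub>R B x0"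
    have bB: "b + j *\<^sub>R B z = j *\<^sub>R (a + B (z - x0))" for z
      by (simp add: b_def linear_diff[OF B(1)] algebra_simps)
    have "\<epsilon> * ((b + j *\<^sub>R B x0) \<bullet> (hess u x0 *v N x0)) \<le> 2 * K * r"
      unfolding K_def \<delta>_def l_def c1_def
    proof (rule mixed_one_sided[OF balls x0 L _ _ _ _ _ _ s1 cone D close[unfolded s_def] t(1,2) t(3-5)[unfolded \<mu>_def s_def] e])
      show "linear (\<lambda>z. j *\<^sub>R B z)" by (intro linear_compose_scale_right B(1))
      show "v \<bullet> j *\<^sub>R B w = - (w \<bullet> j *\<^sub>R B v)" for v w using B(2)[of v w] by simp
      show "0 \<le> 1 + C * L + C" using C(1) L0 by simp
      show "(b + j *\<^sub>R B z) \<bullet> grad u z \<le> 1 + C * L + C" if z: "z \<in> closure \<Omega>" for z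
      proof -
        have "(b + j *\<^sub>R B z) \<bullet> grad u z \<le> norm (a + B (z - x0)) * norm (grad u z)"
          unfolding bB using norm_cauchy_schwarz[of "j *\<^sub>R (a + B (z - x0))" "grad u z"] j by simp
        also have "\<dots> \<le> norm (a + B (z - x0)) * 1"
          using grad_less_1[OF z] by (intro mult_left_mono) auto
        also have "\<dots> \<le> 1 + C * L"
        proof -
          have "norm (B (z - x0)) \<le> C * L" using B(3)[of "z - x0"] L[OF z] C(1) by (meson mult_left_mono order_trans)
          then show ?thesis using norm_triangle_ineq[of a "B (z - x0)"] a(1) by simp
        qed
        finally show ?thesis using C(1) by simp
      qed
      show "(b + j *\<^sub>R B z) \<bullet> grad u z \<le> (1 + C * L + C) * (norm (z - x0))\<^sup>2" if z: "z \<in> frontier \<Omega>" for z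
      proof -
        define \<pi> where "\<pi> = N z \<bullet> grad u z"
        have gp: "grad u z = \<pi> *\<^sub>R N z" unfolding \<pi>_def by (rule boundary_gradient[OF balls z])
        have "\<bar>\<pi>\<bar> < 1" using grad_less_1[OF frontier_closure[OF z]] two_sided_ballsD(2)[OF balls z] by (simp add: gp)
        have "(b + j *\<^sub>R B z) \<bullet> grad u z = j * \<pi> * ((a + B (z - x0)) \<bullet> N z)" unfolding bB gp by simp
        also have "\<dots> \<le> \<bar>j * \<pi>\<bar> * \<bar>(a + B (z - x0)) \<bullet> N z\<bar>" by (metis abs_ge_self abs_mult)
        also have "\<dots> \<le> 1 * (C * (norm (z - x0))\<^sup>2)"
          using \<open>\<bar>\<pi>\<bar> < 1\<close> j B(4)[OF z] by (intro mult_mono) (auto simp: abs_mult)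
        also have "\<dots> \<le> (1 + C * L + C) * (norm (z - x0))\<^sup>2"
          unfolding mult_1 using C(1) L0 by (intro mult_right_mono) auto
        finally show ?thesis .
      qed
      show "(b + j *\<^sub>R B x0) \<bullet> N x0 = 0" unfolding bB using a(2) by (simp add: linear_0[OF B(1)])
    qed
    then show ?thesis unfolding bB by (simp add: linear_0[OF B(1)])
  qed
  show ?thesis using one[of 1] one[of "-1"] by simp
qed

lemma hess_upper_closure:
  assumes "x \<in> closure \<Omega>"
  shows "u x * (v \<bullet> (hess u x *v v)) \<le> (norm v)\<^sup>2"
proof (rule continuous_le_on_closure[OF _ assms])
  have "continuous_on (closure \<Omega>) (\<lambda>z. hess u z *v v)"
    using continuous_on_hess by (rule bounded_linear.continuous_on[rotated])
      (intro bounded_linearI'[of "\<lambda>A. A *v v"], simp_all add: matrix_vector_mult_add_rdistrib scaleR_matrix_vector_assoc)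
  then show "continuous_on (closure \<Omega>) (\<lambda>z. u z * (v \<bullet> (hess u z *v v)))"
    by (intro continuous_intros continuous_on_u)
  show "u z * (v \<bullet> (hess u z *v v)) \<le> (norm v)\<^sup>2" if "z \<in> \<Omega>" for z by (rule hess_upper[OF that])
qed

text \<open>Splitting v into tangential and normal parts bounds the quadratic form of \<epsilon>
  D^2u by Q |v|^2. Polarization bounds each matrix entry by (4 Q + Q + Q) / 2, and the norm is at
  most the sum of the n^2 absolute entries.\<close>

lemma hess_norm_bound:
  assumes balls: "two_sided_balls \<Omega> r N" and x0: "x0 \<in> frontier \<Omega>" and e1: "\<epsilon> \<le> 1"
    and mixed: "\<And>a. norm a = 1 \<Longrightarrow> a \<bullet> N x0 = 0 \<Longrightarrow> \<bar>\<epsilon> * (a \<bullet> (hess u x0 *v N x0))\<bar> \<le> Cm" and Cm: "Cm \<ge> 0"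
    and nn: "mform u x0 (N x0) (N x0) \<le> Cn" and Cn: "Cn \<ge> 0"
  shows "u x0 * norm (hess u x0) \<le> (real CARD('n))\<^sup>2 * (3 * (6 / r + 2 * Cm + Cn + 1))"
proof -
  note bd = two_sided_ballsD[OF balls x0]
  let ?N = "N x0" and ?H = "hess u x0"
  define Q where "Q = 6 / r + 2 * Cm + Cn + 1"
  have x0cl: "x0 \<in> closure \<Omega>" using frontier_closure[OF x0] .
  have ux: "u x0 = \<epsilon>" by (rule u_boundary[OF x0])
  have NN: "?N \<bullet> ?N = 1" using bd(2) by (simp add: norm_eq_1)
  have nnb: "\<bar>\<epsilon> * (?N \<bullet> (?H *v ?N))\<bar> \<le> Cn + 1"
  proof -
    have "\<epsilon> * (?N \<bullet> (?H *v ?N)) \<le> 1" using hess_upper_closure[OF x0cl, of ?N] bd(2) by (simp add: ux)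
    moreover have "1 - (grad u x0 \<bullet> ?N)\<^sup>2 - \<epsilon> * (?N \<bullet> (?H *v ?N)) \<le> Cn"
      using nn by (simp add: mform_def gform_def NN ux power2_eq_square)
    moreover have "(grad u x0 \<bullet> ?N)\<^sup>2 \<le> 1"
    proof -
      have "\<bar>grad u x0 \<bullet> ?N\<bar> \<le> 1" using Cauchy_Schwarz_ineq2[of "grad u x0" ?N] grad_less_1[OF x0cl] bd(2) by simp
      then show ?thesis by (simp add: abs_square_le_1)
    qed
    ultimately show ?thesis using Cn by linarith
  qed
  have quad: "\<bar>\<epsilon> * (v \<bullet> (?H *v v))\<bar> \<le> Q * (norm v)\<^sup>2" for v
  proof -
    define n where "n = v \<bullet> ?N"
    define v' where "v' = v - n *\<^sub>R ?N"
    have vN: "v' \<bullet> ?N = 0" by (simp add: v'_def n_def inner_diff_left NN)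
    have nv: "(norm v)\<^sup>2 = (norm v')\<^sup>2 + n\<^sup>2"
      using norm_add_scaleR_unit[OF bd(2), of v' n] vN by (simp add: v'_def)
    have l1: "norm v' \<le> norm v" by (rule power2_le_imp_le) (simp_all add: nv)
    have l2: "\<bar>n\<bar> \<le> norm v" using Cauchy_Schwarz_ineq2[of v ?N] bd(2) by (simp add: n_def)
    have hs: "?N \<bullet> (?H *v v') = v' \<bullet> (?H *v ?N)" by (rule hess_dot[OF x0cl])
    have ve: "v = v' + n *\<^sub>R ?N" by (simp add: v'_def)
    have "v \<bullet> (?H *v v) = (v' + n *\<^sub>R ?N) \<bullet> (?H *v (v' + n *\<^sub>R ?N))" using ve by simp
    also have "\<dots> = v' \<bullet> (?H *v v') + 2 * n * (v' \<bullet> (?H *v ?N)) + n\<^sup>2 * (?N \<bullet> (?H *v ?N))"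
      by (simp add: matrix_vector_right_distrib matrix_vector_mult_scaleR inner_add_left inner_add_right hs
          power2_eq_square algebra_simps)
    finally have split: "\<epsilon> * (v \<bullet> (?H *v v)) = \<epsilon> * (v' \<bullet> (?H *v v')) + 2 * (n * (\<epsilon> * (v' \<bullet> (?H *v ?N)))) + n\<^sup>2 * (\<epsilon> * (?N \<bullet> (?H *v ?N)))"
      by (simp add: algebra_simps)
    note tv = tangential_vector_bounds[OF balls x0 vN mixed]
    have "\<bar>\<epsilon>\<bar> * \<bar>v' \<bullet> (?H *v v')\<bar> \<le> 1 * (6 / r * (norm v')\<^sup>2)"
      using tv(1) eps e1 by (intro mult_mono) auto
    also have "\<dots> \<le> 6 / r * (norm v)\<^sup>2"
      unfolding mult_1 using nv bd(1) by (intro mult_left_mono) auto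
    finally have t1: "\<bar>\<epsilon> * (v' \<bullet> (?H *v v'))\<bar> \<le> 6 / r * (norm v)\<^sup>2" by (simp only: abs_mult)
    have t2: "\<bar>n * (\<epsilon> * (v' \<bullet> (?H *v ?N)))\<bar> \<le> Cm * (norm v)\<^sup>2"
    proof -
      have "\<bar>n\<bar> * \<bar>\<epsilon> * (v' \<bullet> (?H *v ?N))\<bar> \<le> norm v * (Cm * norm v)"
        using l1 l2 tv(2) Cm by (intro mult_mono) (auto intro: order_trans mult_left_mono)
      then show ?thesis by (simp add: abs_mult power2_eq_square ac_simps)
    qed
    have t3: "\<bar>n\<^sup>2 * (\<epsilon> * (?N \<bullet> (?H *v ?N)))\<bar> \<le> (Cn + 1) * (norm v)\<^sup>2"
    proof -
      have "n\<^sup>2 * \<bar>\<epsilon> * (?N \<bullet> (?H *v ?N))\<bar> \<le> (norm v)\<^sup>2 * (Cn + 1)"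
        using nnb nv by (intro mult_mono) auto
      then show ?thesis by (simp add: abs_mult mult.commute)
    qed
    have "Q * (norm v)\<^sup>2 = 6 / r * (norm v)\<^sup>2 + 2 * (Cm * (norm v)\<^sup>2) + (Cn + 1) * (norm v)\<^sup>2"
      by (simp add: Q_def algebra_simps)
    then show ?thesis unfolding split using t1 t2 t3 by linarith
  qed
  have Q0: "Q \<ge> 0" using bd(1) Cm Cn by (simp add: Q_def)
  have ent: "\<bar>\<epsilon> * ?H $ i $ j\<bar> \<le> 3 * Q" for i j
  proof -
    let ?a = "axis i 1 :: real^'n" and ?b = "axis j 1 :: real^'n"
    have h: "?H $ i $ j = ?a \<bullet> (?H *v ?b)"
      by (simp add: inner_axis' matrix_vector_mul_component inner_axis)
    have "?b \<bullet> (?H *v ?a) = ?a \<bullet> (?H *v ?b)" by (rule hess_dot[OF x0cl])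
    then have pol: "2 * (\<epsilon> * ?H $ i $ j) = \<epsilon> * ((?a + ?b) \<bullet> (?H *v (?a + ?b))) - \<epsilon> * (?a \<bullet> (?H *v ?a)) - \<epsilon> * (?b \<bullet> (?H *v ?b))"
      unfolding h by (simp add: matrix_vector_right_distrib inner_add_left inner_add_right algebra_simps)
    have "norm (?a + ?b) \<le> 2" by (rule order_trans[OF norm_triangle_ineq]) simp
    then have "(norm (?a + ?b))\<^sup>2 \<le> 2\<^sup>2" by (rule power_mono) simp
    then have "Q * (norm (?a + ?b))\<^sup>2 \<le> Q * 4" using Q0 by (intro mult_left_mono) auto
    then have "\<bar>\<epsilon> * ((?a + ?b) \<bullet> (?H *v (?a + ?b)))\<bar> \<le> 4 * Q" using quad[of "?a + ?b"] by linarith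
    moreover have "\<bar>\<epsilon> * (?a \<bullet> (?H *v ?a))\<bar> \<le> Q" "\<bar>\<epsilon> * (?b \<bullet> (?H *v ?b))\<bar> \<le> Q"
      using quad[of ?a] quad[of ?b] by simp_all
    ultimately show ?thesis using pol by linarith
  qed
  have "norm ?H \<le> (\<Sum>i\<in>UNIV. norm (?H $ i))" unfolding norm_vec_def[of ?H] by (rule L2_set_le_sum) simp
  also have "\<dots> \<le> (\<Sum>i\<in>UNIV. \<Sum>j\<in>UNIV. \<bar>?H $ i $ j\<bar>)" by (intro sum_mono norm_le_l1_cart)
  finally have "\<epsilon> * norm ?H \<le> \<epsilon> * (\<Sum>i\<in>UNIV. \<Sum>j\<in>UNIV. \<bar>?H $ i $ j\<bar>)" using eps by (intro mult_left_mono) auto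
  also have "\<dots> = (\<Sum>i\<in>UNIV. \<Sum>j\<in>UNIV. \<bar>\<epsilon> * ?H $ i $ j\<bar>)" using eps by (simp add: sum_distrib_left abs_mult)
  also have "\<dots> \<le> (\<Sum>i\<in>(UNIV::'n set). \<Sum>j\<in>(UNIV::'n set). 3 * Q)" by (intro sum_mono ent)
  also have "\<dots> = (real CARD('n))\<^sup>2 * (3 * Q)" by (simp add: power2_eq_square)
  finally show ?thesis by (simp only: ux Q_def)
qed

end

theorem theorem5p1:
  fixes \<Omega> :: "(real^'n::finite) set" and f :: "real^'n \<Rightarrow> real" and \<sigma> :: real
  assumes "smooth_bounded_domain \<Omega>"
    and "\<sigma> > 1"
    and "F_conditions f"
  shows "\<exists>\<epsilon>0>0. \<exists>C. \<forall>\<epsilon>. 0 < \<epsilon> \<and> \<epsilon> < \<epsilon>0 \<longrightarrow>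
           (\<forall>u. admissible_solution \<Omega> f \<sigma> \<epsilon> u \<longrightarrow>
              (\<forall>x\<in>frontier \<Omega>. u x * norm (hess u x) \<le> C))"
proof -
  have o: "open \<Omega>" "bounded \<Omega>" using assms(1) by (simp_all add: smooth_bounded_domain_def)
  obtain r0 N C where geo: "two_sided_balls \<Omega> r0 N" "C \<ge> 0"
    "\<And>x a. x \<in> frontier \<Omega> \<Longrightarrow> norm a = 1 \<Longrightarrow> a \<bullet> N x = 0 \<Longrightarrow> infinitesimal_rotation_bound x a (frontier \<Omega>) N C"
    using domain_geometry[OF assms(1)] by blast
  \<comment> \<open>Halving leaves balls of radius 2 r on both sides, as the light-cone comparison
    requires.\<close>
  define r where "r = r0 / 2"
  have r0: "r0 = 2 * r" "r > 0" using geo(1) by (auto simp: r_def two_sided_balls_def)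
  note balls = geo(1)[unfolded r0]
  obtain L where L: "L > 0" "\<And>x z. x \<in> closure \<Omega> \<Longrightarrow> z \<in> closure \<Omega> \<Longrightarrow> norm (z - x) \<le> L"
  proof -
    have "bounded (closure \<Omega>)" using o(2) by (rule bounded_closure)
    then have "\<exists>b>0. \<forall>x\<in>closure \<Omega>. norm x \<le> b" by (simp only: bounded_pos)
    then obtain b where b: "b > 0" "\<And>x. x \<in> closure \<Omega> \<Longrightarrow> norm x \<le> b" by blast
    have "norm (z - x) \<le> 2 * b" if "x \<in> closure \<Omega>" "z \<in> closure \<Omega>" for x z
      using norm_triangle_ineq4[of z x] b(2)[OF that(1)] b(2)[OF that(2)] by linarith
    then show thesis using that[of "2 * b"] b(1) by simp
  qed
  obtain e0 R where e0: "e0 > 0" and R: "R \<ge> 0" "\<And>i. 1 + e0 / 2 \<le> f ((\<chi> j. 1) + R *\<^sub>R axis i 1)"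
  proof -
    obtain e0 d0 where e0: "e0 > 0" "d0 > 0"
      and g: "\<And>i \<eta>. \<eta> > 0 \<Longrightarrow> \<exists>R0. \<forall>R\<ge>R0. \<forall>lam\<in>ball (\<chi> j. 1) d0. 1 + e0 - \<eta> \<le> f (lam + R *\<^sub>R axis i 1)"
      using F_growth[OF assms(3)] by blast
    have "\<forall>i. \<exists>R0. \<forall>R\<ge>R0. 1 + e0 / 2 \<le> f ((\<chi> j. 1) + R *\<^sub>R axis i 1)"
    proof
      fix i
      obtain R0 where "\<forall>R\<ge>R0. \<forall>lam\<in>ball (\<chi> j. 1) d0. 1 + e0 - e0 / 2 \<le> f (lam + R *\<^sub>R axis i 1)"
        using g[of "e0 / 2" i] e0(1) by auto
      then show "\<exists>R0. \<forall>R\<ge>R0. 1 + e0 / 2 \<le> f ((\<chi> j. 1) + R *\<^sub>R axis i 1)"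
        using e0(2) by (intro exI[of _ R0]) (force simp: field_simps)
    qed
    then obtain R0 where R0: "\<And>i R. R \<ge> R0 i \<Longrightarrow> 1 + e0 / 2 \<le> f ((\<chi> j. 1) + R *\<^sub>R axis i 1)" by metis
    define R where "R = Max (insert 0 (range R0))"
    have "R \<ge> 0" "\<And>i. R \<ge> R0 i" unfolding R_def by (rule Max_ge; simp)+
    then show thesis using that[OF e0(1), of R] R0 by blast
  qed
  \<comment> \<open>Solves 3 \<theta> (1 + e0 / 2) = e0 / 4, so three losses of \<theta> still leave
    1 + e0 / 4, against the 1 + \<sigma>^2 \<tau> permitted by the gradient estimate.\<close>
  define \<theta> where "\<theta> = e0 / (12 + 6 * e0)"
  have th: "\<theta> > 0" "1 + e0 / 4 \<le> (1 - 3 * \<theta>) * (1 + e0 / 2)"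
  proof -
    have p: "12 + 6 * e0 > 0" using e0 by simp
    then show "\<theta> > 0" using e0 by (simp add: \<theta>_def)
    have "3 * \<theta> * (1 + e0 / 2) = e0 / 4" using p by (simp add: \<theta>_def field_simps)
    then show "1 + e0 / 4 \<le> (1 - 3 * \<theta>) * (1 + e0 / 2)" by (simp only: left_diff_distrib) simp
  qed
  define s where "s = slope \<sigma>"
  note sb = slope_bounds[OF assms(2), folded s_def]
  define \<mu> where "\<mu> = r * (1 - s) / s"
  have mu: "\<mu> > 0" using r0 sb by (simp add: \<mu>_def)
  obtain \<tau> where t: "0 < \<tau>" "\<tau> \<le> 1" "\<tau> \<le> s / 2" "24 * (r / s + 4) * \<tau> \<le> \<mu> * s\<^sup>2"
      "16 * (\<sigma> + (r + 1) * \<sigma>\<^sup>2) * \<tau> \<le> \<sigma> * \<mu> * s\<^sup>2" "\<sigma>\<^sup>2 * \<tau> < e0 / 4"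
  proof -
    let ?A = "24 * (r / s + 4)" and ?B = "16 * (\<sigma> + (r + 1) * \<sigma>\<^sup>2)"
    have A: "?A > 0" "?B > 0" "\<sigma>\<^sup>2 > 0" using r0 sb assms(2) by (auto intro!: add_pos_pos divide_pos_pos mult_pos_pos)
    define \<tau> where "\<tau> = min (min 1 (s / 2)) (min (\<mu> * s\<^sup>2 / ?A) (min (\<sigma> * \<mu> * s\<^sup>2 / ?B) (e0 / 8 / \<sigma>\<^sup>2)))"
    have "0 < \<tau>" unfolding \<tau>_def using A sb mu assms(2) e0 by (auto intro!: divide_pos_pos mult_pos_pos)
    moreover have "\<tau> \<le> 1" "\<tau> \<le> s / 2" "\<tau> \<le> \<mu> * s\<^sup>2 / ?A" "\<tau> \<le> \<sigma> * \<mu> * s\<^sup>2 / ?B" "\<tau> \<le> e0 / 8 / \<sigma>\<^sup>2"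
      unfolding \<tau>_def by (simp_all only: min.coboundedI1 min.coboundedI2 min.cobounded1 min.cobounded2 order_refl)
    moreover have "?A * \<tau> \<le> \<mu> * s\<^sup>2" using calculation(4) A(1) by (simp only: pos_le_divide_eq mult.commute)
    moreover have "?B * \<tau> \<le> \<sigma> * \<mu> * s\<^sup>2" using calculation(5) A(2) by (simp only: pos_le_divide_eq mult.commute)
    moreover have "\<sigma>\<^sup>2 * \<tau> \<le> e0 / 8" using calculation(6) A(3) by (simp only: pos_le_divide_eq mult.commute)
    ultimately show thesis using that[of \<tau>] e0 by linarith
  qed
  have t2: "\<tau> / 2 > 0" and r02: "2 * r > 0" using t r0 by simp_all
  obtain \<epsilon>1 D where gc: "\<epsilon>1 > 0" "D > 0"
    "\<And>\<Omega> (f :: real^'n \<Rightarrow> real) \<epsilon> u x1 N d. steady_state_graph \<Omega> f \<sigma> \<epsilon> u \<Longrightarrow> \<epsilon> < \<epsilon>1 \<Longrightarrow> norm N = 1 \<Longrightarrow>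
      ball (x1 + (2 * r) *\<^sub>R N) (2 * r) \<subseteq> \<Omega> \<Longrightarrow> ball (x1 - (2 * r) *\<^sub>R N) (2 * r) \<inter> \<Omega> = {} \<Longrightarrow> x1 \<in> closure \<Omega> \<Longrightarrow>
      0 \<le> d \<Longrightarrow> d \<le> D \<Longrightarrow> norm (grad u (x1 + d *\<^sub>R N) - slope \<sigma> *\<^sub>R N) \<le> \<tau> / 2"
    by (rule gradient_close[OF assms(2) r02 t2]) blast
  let ?a = "\<sigma>\<^sup>2 - 1"
  have a: "?a > 0" using assms(2) by (simp add: one_less_power)
  define R0 where "R0 = r / (2 * sqrt ?a)"
  \<comment> \<open>\<open>L + r\<close> bounds the distance from points of the closure to the
    center of an exterior ball of radius r.\<close>
  define s1 where "s1 = (L + r) / sqrt (R0\<^sup>2 + (L + r)\<^sup>2)"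
  have R0: "R0 > 0" using r0 a by (simp add: R0_def)
  have s1: "0 \<le> s1" "s1 < 1"
  proof -
    have lr: "L + r > 0" using L r0 by simp
    have lt: "L + r < sqrt (R0\<^sup>2 + (L + r)\<^sup>2)" using R0 by (intro real_less_rsqrt) simp
    then have "0 < sqrt (R0\<^sup>2 + (L + r)\<^sup>2)" using lr by linarith
    then show "0 \<le> s1" "s1 < 1"
      unfolding s1_def using lt lr by (simp, subst pos_divide_less_eq, simp_all)
  qed
  define l where "l = min (\<tau> / 2) (min D (\<tau> * r / 2))"
  define \<delta> where "\<delta> = min \<tau> ((1 - s1) / 8 * l\<^sup>2 / (1 + L))"
  define K where "K = (1 + C * L + C) / ((1 - s1) / 8) + (1 + C * L + C) / \<delta> + 1"
  define Cm where "Cm = 2 * K * r"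
  have Cm: "Cm \<ge> 0"
  proof -
    have "l > 0" using t gc(2) r0 by (simp add: l_def)
    then have "\<delta> > 0" unfolding \<delta>_def using t s1 L(1) by simp
    then have "K \<ge> 0" unfolding K_def using geo(2) L(1) s1 by (intro add_nonneg_nonneg divide_nonneg_nonneg) auto
    then show ?thesis using r0 by (simp add: Cm_def)
  qed
  define Cn where "Cn = Cm\<^sup>2 / \<theta> + (1 + R)"
  have Cn: "Cn \<ge> 0" using th R by (simp add: Cn_def)
  \<comment> \<open>Each entry is one smallness requirement: the gradient estimate, \<epsilon> \<le>
    1, closeness of \<rho> to r, positivity of \<rho>, the tangential loss \<theta>, and the lower
    bound R0 for the barrier radius. All constants above are independent of \<epsilon> and
    u.\<close>
  define \<epsilon>0 where "\<epsilon>0 = min (min \<epsilon>1 1) (min (min (\<tau> / 2) (r / 2)) (min (\<theta> * r / 3) (R0 * ?a / (\<sigma> + 1))))"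
  have "\<epsilon>0 > 0" unfolding \<epsilon>0_def using gc(1) t r0 th a R0 assms(2) by simp
  moreover have "u x * norm (hess u x) \<le> (real CARD('n))\<^sup>2 * (3 * (6 / (2 * r) + 2 * Cm + Cn + 1))"
    if e: "0 < \<epsilon>" "\<epsilon> < \<epsilon>0" and sol: "admissible_solution \<Omega> f \<sigma> \<epsilon> u" and x: "x \<in> frontier \<Omega>" for \<epsilon> u x
  proof -
    interpret steady_state_graph \<Omega> f \<sigma> \<epsilon> u
      using o assms(2,3) e(1) sol by unfold_locales
    have e': "\<epsilon> < \<epsilon>1" "\<epsilon> \<le> 1" "2 * \<epsilon> \<le> \<tau>" "2 * \<epsilon> < r" "\<epsilon> \<le> \<theta> * r / 3" "\<epsilon> \<le> R0 * ?a / (\<sigma> + 1)"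
      using e(2) by (auto simp: \<epsilon>0_def)
    note bd = two_sided_ballsD[OF balls]
    have close: "norm (grad u (x1 + d *\<^sub>R N x1) - slope \<sigma> *\<^sub>R N x1) \<le> \<tau> / 2"
      if "x1 \<in> frontier \<Omega>" "0 \<le> d" "d \<le> D" for x1 d
      by (rule gc(3)[OF steady_state_graph_axioms e'(1) bd(2-4)[OF that(1)] frontier_closure[OF that(1)] that(2,3)])
    have cone: "u z \<le> \<epsilon> + s1 * (norm (z - (x - r *\<^sub>R N x)) - r)" if z: "z \<in> closure \<Omega>" for z
      unfolding s1_def R0_def
    proof (rule cone_bound[OF _ r0(2) _ _ _ _ z])
      have "ball (x - r *\<^sub>R N x) r \<subseteq> ball (x - (2 * r) *\<^sub>R N x) (2 * r)"
      proof
        fix y assume y: "y \<in> ball (x - r *\<^sub>R N x) r"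
        have "(x - r *\<^sub>R N x) - (x - (2 * r) *\<^sub>R N x) = r *\<^sub>R N x"
          by (simp add: algebra_simps flip: scaleR_2)
        then have "dist (x - r *\<^sub>R N x) (x - (2 * r) *\<^sub>R N x) = norm (r *\<^sub>R N x)"
          unfolding dist_norm by (rule arg_cong)
        also have "\<dots> = r" using bd(2)[OF x] r0(2) by simp
        finally show "y \<in> ball (x - (2 * r) *\<^sub>R N x) (2 * r)"
          using y dist_triangle[of "x - (2 * r) *\<^sub>R N x" y "x - r *\<^sub>R N x"]
          unfolding mem_ball dist_commute[of "x - (2 * r) *\<^sub>R N x" "x - r *\<^sub>R N x"] by linarith
      qed
      then show "ball (x - r *\<^sub>R N x) r \<inter> \<Omega> = {}" using bd(4)[OF x] by blast
      show "\<epsilon> < r" using e'(4) e(1) by linarith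
      have "(\<sigma> + 1) * \<epsilon> \<le> R0 * ?a" using e'(6) assms(2) by (simp add: pos_le_divide_eq mult.commute)
      then show "(\<sigma> + 1) * \<epsilon> / ?a \<le> r / (2 * sqrt ?a)" using a by (simp add: pos_divide_le_eq R0_def)
      show "r \<le> L + r" using L(1) by simp
      have "norm ((z - x) + r *\<^sub>R N x) \<le> L + r"
        using norm_triangle_ineq[of "z - x" "r *\<^sub>R N x"] L(2)[OF frontier_closure[OF x] z] bd(2)[OF x] r0(2) by simp
      moreover have "z - (x - r *\<^sub>R N x) = (z - x) + r *\<^sub>R N x" by simp
      ultimately show "norm (z - (x - r *\<^sub>R N x)) \<le> L + r" by (simp only:)
    qed
    have mixed: "\<bar>\<epsilon> * (b \<bullet> (hess u x *v N x))\<bar> \<le> Cm" if b: "norm b = 1" "b \<bullet> N x = 0" for b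
      unfolding Cm_def K_def \<delta>_def l_def
      by (rule mixed_two_sided[OF balls x L(2)[OF frontier_closure[OF x]] geo(2,3) b s1 cone gc(2) close
            t(1,2) t(3-5)[unfolded \<mu>_def s_def] e'(2-4)]) (use x b in auto)
    have nn: "mform u x (N x) (N x) \<le> Cn"
      unfolding Cn_def
    proof (rule double_normal[OF balls x R e0 th t(1) _ t(6) _ _ mixed])
      show "\<tau> \<le> slope \<sigma>" using t(3) sb(1) by (simp add: s_def)
      show "norm (grad u x - slope \<sigma> *\<^sub>R N x) \<le> \<tau>" using close[OF x, of 0] gc(2) t(1) by simp
      show "\<epsilon> * (6 / (2 * r)) \<le> \<theta>" using e'(5) r0(2) by (simp add: field_simps)
    qed
    show ?thesis by (rule hess_norm_bound[OF balls x e'(2) mixed Cm nn Cn])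
  qed
  ultimately show ?thesis by blast
qed

end
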